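(* Let $\mathcal H,\mathcal G,\mathcal X$ be groupoids such that: - $s_{\mathcal H}$, $s_{\mathcal G}$ and $s_{\mathcal X}$ are open maps; - $\mathcal H$ has a self-similar left action on $\mathcal X$ that is free and proper; - $\mathcal G$ has a self-similar right action on $\mathcal X$ that is free and proper; - the two actions are in tune. Then $\mathcal X$ is a groupoid equivalence from $(\mathcal X/\mathcal G)\bowtie\mathcal H$ to $\mathcal G\bowtie(\mathcal H\backslash\mathcal X)$ with the following structure: the momentum maps are $\mathfrak r\colon\mathcal X\to[(\mathcal X/\mathcal G)\bowtie\mathcal H]^{(0)}\cong\mathcal X^{(0)}/\mathcal G$, $\mathfrak r(x)=r_{\mathcal X}(x)\blacktriangleleft\mathcal G$, and $\mathfrak s\colon\mathcal X\to[\mathcal G\bowtie(\mathcal H\backslash\mathcal X)]^{(0)}\cong\mathcal H\backslash\mathcal X^{(0)}$, $\mathfrak s(x)=\mathcal H\triangleright s_{\mathcal X}(x)$; the left action is $(\xi,h)\cdot y=x(h\triangleright y)$, where $x\in\xi$ is the element with $(x,h\triangleright y)\in\mathcal X^{(2)}$; and the right action is $y\cdot(t,\eta)=(y\blacktriangleleft t)z$, where $z\in\eta$ is the element with $(y\blacktriangleleft t,z)\in\mathcal X^{(2)}$.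
   Context: **Conventions.** All groupoids are topological groupoids that are locally compact Hausdorff and second countable; $r,s$ denote range and source maps, $\mathcal K^{(0)}$ the unit space and $\mathcal K^{(2)}$ the composable pairs ($(x,y)$ with $s(x)=r(y)$) of a groupoid $\mathcal K$. **Self-similar left action.** A self-similar left action of $\mathcal H$ on $\mathcal X$ consists of a continuous surjection $\rho^{(0)}\colon\mathcal X^{(0)}\to\mathcal H^{(0)}$ and, with $\rho=\rho^{(0)}\circ r_{\mathcal X}$, two continuous maps defined on $\{(h,x)\in\mathcal H\times\mathcal X: s_{\mathcal H}(h)=\rho(x)\}$, $(h,x)\mapsto h\triangleright x\in\mathcal X$ and $(h,x)\mapsto h\triangleleft x\in\mathcal H$, such that whenever the expressions make sense: (L1) $r(h)=\rho(h\triangleright x)$, $s(h\triangleleft x)=\rho(x^{-1})$, $r(h\triangleleft x)=\rho((h\triangleright x)^{-1})$; (L2) $h\triangleleft v=h$ for $v\in\mathcal X^{(0)}$, and $\rho(x)\triangleright x=x$; for $(x,y)\in\mathcal X^{(2)}$: $s(h\triangleright x)=r((h\triangleleft x)\triangleright y)$, (L3) $h\triangleleft(xy)=(h\triangleleft x)\triangleleft y$, (L4) $h\triangleright(xy)=(h\triangleright x)[(h\triangleleft x)\triangleright y]$; for $(h,k)\in\mathcal H^{(2)}$: (L5) $(hk)\triangleright x=h\triangleright(k\triangleright x)$, (L6) $(hk)\triangleleft x=[h\triangleleft(k\triangleright x)](k\triangleleft x)$. It is free (proper) if $\triangleright$ is a free (proper) action of $\mathcal H$ on the space $\mathcal X$.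 **Self-similar right action.** A self-similar right action of $\mathcal G$ on $\mathcal X$ consists of a continuous surjection $\sigma^{(0)}\colon\mathcal X^{(0)}\to\mathcal G^{(0)}$ and, with $\sigma=\sigma^{(0)}\circ s_{\mathcal X}$, two continuous maps on $\{(x,t):\sigma(x)=r_{\mathcal G}(t)\}$, $(x,t)\mapsto x\blacktriangleleft t\in\mathcal X$ and $(x,t)\mapsto x\blacktriangleright t\in\mathcal G$, such that: (R1) $\sigma(x\blacktriangleleft t)=s(t)$, $\sigma(x^{-1})=r(x\blacktriangleright t)$, $\sigma((x\blacktriangleleft t)^{-1})=s(x\blacktriangleright t)$; (R2) $v\blacktriangleright t=t$ for $v\in\mathcal X^{(0)}$, $x\blacktriangleleft\sigma(x)=x$; for $(x,y)\in\mathcal X^{(2)}$: $s(x\blacktriangleleft(y\blacktriangleright t))=r(y\blacktriangleleft t)$, (R3) $(xy)\blacktriangleright t=x\blacktriangleright(y\blacktriangleright t)$, (R4) $(xy)\blacktriangleleft t=[x\blacktriangleleft(y\blacktriangleright t)](y\blacktriangleleft t)$; for $(t,t')\in\mathcal G^{(2)}$: (R5) $x\blacktriangleleft(tt')=(x\blacktriangleleft t)\blacktriangleleft t'$, (R6) $x\blacktriangleright(tt')=(x\blacktriangleright t)[(x\blacktriangleleft t)\blacktriangleright t']$. Free/proper refers to $\blacktriangleleft$. **In tune.** The actions are in tune if, whenever $s(h)=\rho(x)$ and $\sigma(x)=r(t)$: $\sigma(h\triangleright x)=\sigma(x)$, $\rho(x\blacktriangleleft t)=\rho(x)$, $h\triangleright(x\blacktriangleleft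 t)=(h\triangleright x)\blacktriangleleft t$, $(h\triangleright x)\blacktriangleright t=x\blacktriangleright t$, $h\triangleleft(x\blacktriangleleft t)=h\triangleleft x$. **Self-similar product groupoids.** $\mathcal X\bowtie\mathcal H=\{(x,h):\rho(x^{-1})=r(h)\}$ with $(x,h)(y,k)=(x(h\triangleright y),(h\triangleleft y)k)$ when $s(x)=h\triangleright r(y)$, $(x,h)^{-1}=(h^{-1}\triangleright x^{-1},h^{-1}\triangleleft x^{-1})$; unit space identified with $\mathcal X^{(0)}$ via $(u,\rho(u))\leftrightarrow u$, so that $r(x,h)=r(x)$, $s(x,h)=h^{-1}\triangleright s(x)$. Likewise $\mathcal G\bowtie\mathcal X=\{(t,x):s(t)=\sigma(x^{-1})\}$ with $(s,x)(t,y)=(s(x\blacktriangleright t),(x\blacktriangleleft t)y)$ when $s(x)=r(y)\blacktriangleleft t^{-1}$, $(t,x)^{-1}=(x^{-1}\blacktriangleright t^{-1},x^{-1}\blacktriangleleft t^{-1})$; unit space identified with $\mathcal X^{(0)}$, $r(t,x)=r(x)\blacktriangleleft t^{-1}$, $s(t,x)=s(x)$. Subspace topologies. **Quotient groupoids.** Under the stated hypotheses, $\mathcal H\backslash\mathcal X=\{\mathcal H\triangleright x\}$ with quotient topology is a groupoid with unit space $\mathcal H\backslash\mathcal X^{(0)}$, $s(\mathcal H\triangleright x)=\mathcal H\triangleright s(x)$, $r(\mathcal H\triangleright x)=\mathcal H\triangleright r(x)$, $\xi\eta=\mathcal H\triangleright(xy)$ for any $x\in\xi,y\in\eta$ with $s(x)=r(y)$,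 $(\mathcal H\triangleright x)^{-1}=\mathcal H\triangleright x^{-1}$; similarly $\mathcal X/\mathcal G=\{x\blacktriangleleft\mathcal G\}$. $\mathcal H$ has a self-similar left action on $\mathcal X/\mathcal G$ with momentum map $x\blacktriangleleft\mathcal G\mapsto\rho(x)$: $h\triangleright(x\blacktriangleleft\mathcal G)=(h\triangleright x)\blacktriangleleft\mathcal G$, $h\triangleleft(x\blacktriangleleft\mathcal G)=h\triangleleft x$. $\mathcal G$ has a self-similar right action on $\mathcal H\backslash\mathcal X$ with momentum map $\mathcal H\triangleright x\mapsto\sigma(x)$: $(\mathcal H\triangleright x)\blacktriangleleft t=\mathcal H\triangleright(x\blacktriangleleft t)$, $(\mathcal H\triangleright x)\blacktriangleright t=x\blacktriangleright t$. These define $(\mathcal X/\mathcal G)\bowtie\mathcal H$ and $\mathcal G\bowtie(\mathcal H\backslash\mathcal X)$. **Groupoid equivalence** (Muhly–Renault–Williams). A locally compact Hausdorff space $Z$ is an equivalence from $\mathcal K$ to $\mathcal L$ if it carries commuting free and proper continuous actions of $\mathcal K$ on the left and $\mathcal L$ on the right, whose momentum maps $\mathfrak r\colon Z\to\mathcal K^{(0)}$, $\mathfrak s\colon Z\to\mathcal L^{(0)}$ are continuous open surjections, such that $\mathfrak r$ induces a homeomorphism $Z/\mathcal L\to\mathcal K^{(0)}$ and $\mathfrak s$ induces a homeomorphism $\mathcal K\backslash Z\to\mathcal L^{(0)}$. *)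

theory Defs
  imports "HOL-Analysis.Analysis"
begin

section \<open>Quotient topologies and functions on classes\<close>

definition quotient_topology :: "'a topology \<Rightarrow> ('a \<Rightarrow> 'b) \<Rightarrow> 'b topology" where
  "quotient_topology T q =
     topology (\<lambda>U. U \<subseteq> q ` topspace T \<and> openin T {x \<in> topspace T. q x \<in> U})"

lemma openin_quotient_topology:
  "openin (quotient_topology T q) U \<longleftrightarrow>
     U \<subseteq> q ` topspace T \<and> openin T {x \<in> topspace T. q x \<in> U}"
proof -
  have int: "openin T {x \<in> topspace T. q x \<in> A \<inter> B}"
    if "openin T {x \<in> topspace T. q x \<in> A}" "openin T {x \<in> topspace T. q x \<in> B}" for A B
  proof -
    have "{x \<in> topspace T. q x \<in> A \<inter> B} =
        {x \<in> topspace T. q x \<in> A} \<inter> {x \<in> topspace T. q x \<in> B}" by auto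
    then show ?thesis using that by (simp add: openin_Int)
  qed
  have un: "openin T {x \<in> topspace T. q x \<in> \<Union>\<K>}"
    if "\<And>A. A \<in> \<K> \<Longrightarrow> openin T {x \<in> topspace T. q x \<in> A}" for \<K>
  proof -
    have "{x \<in> topspace T. q x \<in> \<Union>\<K>} = (\<Union>A\<in>\<K>. {x \<in> topspace T. q x \<in> A})" by auto
    moreover have "openin T (\<Union>A\<in>\<K>. {x \<in> topspace T. q x \<in> A})"
      by (rule openin_Union) (use that in blast)
    ultimately show ?thesis by (simp only:)
  qed
  have "istopology (\<lambda>U. U \<subseteq> q ` topspace T \<and> openin T {x \<in> topspace T. q x \<in> U})"
    unfolding istopology_def using int un by (simp add: Sup_le_iff le_infI1)
  then show ?thesis
    unfolding quotient_topology_def by (simp add: topology_inverse')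
qed

lemma topspace_quotient_topology [simp]:
  "topspace (quotient_topology T q) = q ` topspace T"
proof -
  have "{x \<in> topspace T. q x \<in> q ` topspace T} = topspace T" by auto
  then have "openin (quotient_topology T q) (q ` topspace T)"
    by (simp add: openin_quotient_topology)
  then show ?thesis
    by (metis openin_quotient_topology openin_subset openin_topspace subset_antisym)
qed

lemma quotient_map_quotient_topology: "quotient_map T (quotient_topology T q) q"
  by (simp add: quotient_map_def openin_quotient_topology)

text \<open>The value on a class of a function that is constant on that class.\<close>

definition on_class :: "('a \<Rightarrow> 'b) \<Rightarrow> 'a set \<Rightarrow> 'b" where
  "on_class f \<xi> = the_elem (f ` \<xi>)"


section \<open>Topological groupoids\<close>

text \<open>Units are particular arrows. The operations are only meaningful on the arrows
  (\<open>gmul\<close> on composable pairs of arrows).\<close>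

record 'a groupoid =
  arr_top :: "'a topology"
  units :: "'a set"
  rng :: "'a \<Rightarrow> 'a"
  src :: "'a \<Rightarrow> 'a"
  gmul :: "'a \<Rightarrow> 'a \<Rightarrow> 'a" (infixl "\<odot>\<index>" 70)
  ginv :: "'a \<Rightarrow> 'a"

abbreviation arrows :: "'a groupoid \<Rightarrow> 'a set" where
  "arrows K \<equiv> topspace (arr_top K)"

definition unit_space :: "'a groupoid \<Rightarrow> 'a topology" where
  "unit_space K = subtopology (arr_top K) (units K)"

definition composable :: "'a groupoid \<Rightarrow> ('a \<times> 'a) set" where
  "composable K = {(x, y). x \<in> arrows K \<and> y \<in> arrows K \<and> src K x = rng K y}"

locale lc_groupoid =
  fixes K :: "'a groupoid" (structure)
  assumes units_arrows: "units K \<subseteq> arrows K"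
    and rng_units: "x \<in> arrows K \<Longrightarrow> rng K x \<in> units K"
    and src_units: "x \<in> arrows K \<Longrightarrow> src K x \<in> units K"
    and rng_unit: "u \<in> units K \<Longrightarrow> rng K u = u"
    and src_unit: "u \<in> units K \<Longrightarrow> src K u = u"
    and mul_arrows: "(x, y) \<in> composable K \<Longrightarrow> x \<odot> y \<in> arrows K"
    and rng_mul: "(x, y) \<in> composable K \<Longrightarrow> rng K (x \<odot> y) = rng K x"
    and src_mul: "(x, y) \<in> composable K \<Longrightarrow> src K (x \<odot> y) = src K y"
    and mul_assoc: "(x, y) \<in> composable K \<Longrightarrow> (y, z) \<in> composable K \<Longrightarrow>
          x \<odot> y \<odot> z = x \<odot> (y \<odot> z)"
    and rng_mul_self: "x \<in> arrows K \<Longrightarrow> rng K x \<odot> x = x"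
    and mul_src_self: "x \<in> arrows K \<Longrightarrow> x \<odot> src K x = x"
    and inv_arrows: "x \<in> arrows K \<Longrightarrow> ginv K x \<in> arrows K"
    and rng_inv: "x \<in> arrows K \<Longrightarrow> rng K (ginv K x) = src K x"
    and src_inv: "x \<in> arrows K \<Longrightarrow> src K (ginv K x) = rng K x"
    and mul_inv: "x \<in> arrows K \<Longrightarrow> x \<odot> ginv K x = rng K x"
    and inv_mul: "x \<in> arrows K \<Longrightarrow> ginv K x \<odot> x = src K x"
    and continuous_mul:
      "continuous_map (subtopology (prod_topology (arr_top K) (arr_top K)) (composable K))
         (arr_top K) (\<lambda>(x, y). x \<odot> y)"
    and continuous_inv: "continuous_map (arr_top K) (arr_top K) (ginv K)"
    and locally_compact: "locally_compact_space (arr_top K)"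
    and Hausdorff: "Hausdorff_space (arr_top K)"
    and second_countable: "second_countable (arr_top K)"

definition open_source :: "'a groupoid \<Rightarrow> bool" where
  "open_source K \<longleftrightarrow> open_map (arr_top K) (unit_space K) (src K)"


section \<open>Actions of groupoids on spaces\<close>

text \<open>The fibre products on which left actions (with momentum map \<open>m\<close>) and right actions
  (with momentum map \<open>n\<close>) are defined.\<close>

definition left_pairs :: "'k groupoid \<Rightarrow> 'z topology \<Rightarrow> ('z \<Rightarrow> 'k) \<Rightarrow> ('k \<times> 'z) topology" where
  "left_pairs K Z m = subtopology (prod_topology (arr_top K) Z) {(k, z). src K k = m z}"

definition right_pairs :: "'z topology \<Rightarrow> 'l groupoid \<Rightarrow> ('z \<Rightarrow> 'l) \<Rightarrow> ('z \<times> 'l) topology" where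
  "right_pairs Z L n = subtopology (prod_topology Z (arr_top L)) {(z, l). n z = rng L l}"

locale left_groupoid_action =
  fixes K :: "'k groupoid" and Z :: "'z topology"
    and m :: "'z \<Rightarrow> 'k" and act :: "'k \<Rightarrow> 'z \<Rightarrow> 'z"
  assumes continuous_momentum: "continuous_map Z (unit_space K) m"
    and continuous_act: "continuous_map (left_pairs K Z m) Z (\<lambda>(k, z). act k z)"
    and momentum_act: "k \<in> arrows K \<Longrightarrow> z \<in> topspace Z \<Longrightarrow> src K k = m z \<Longrightarrow>
          m (act k z) = rng K k"
    and unit_act: "z \<in> topspace Z \<Longrightarrow> act (m z) z = z"
    and mul_act: "(k, l) \<in> composable K \<Longrightarrow> z \<in> topspace Z \<Longrightarrow> src K l = m z \<Longrightarrow>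
          act (k \<odot>\<^bsub>K\<^esub> l) z = act k (act l z)"

locale right_groupoid_action =
  fixes L :: "'l groupoid" and Z :: "'z topology"
    and n :: "'z \<Rightarrow> 'l" and act :: "'z \<Rightarrow> 'l \<Rightarrow> 'z"
  assumes continuous_momentum: "continuous_map Z (unit_space L) n"
    and continuous_act: "continuous_map (right_pairs Z L n) Z (\<lambda>(z, l). act z l)"
    and momentum_act: "z \<in> topspace Z \<Longrightarrow> l \<in> arrows L \<Longrightarrow> n z = rng L l \<Longrightarrow>
          n (act z l) = src L l"
    and unit_act: "z \<in> topspace Z \<Longrightarrow> act z (n z) = z"
    and mul_act: "z \<in> topspace Z \<Longrightarrow> (k, l) \<in> composable L \<Longrightarrow> n z = rng L k \<Longrightarrow>
          act z (k \<odot>\<^bsub>L\<^esub> l) = act (act z k) l"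

definition free_left :: "'k groupoid \<Rightarrow> 'z topology \<Rightarrow> ('z \<Rightarrow> 'k) \<Rightarrow> ('k \<Rightarrow> 'z \<Rightarrow> 'z) \<Rightarrow> bool" where
  "free_left K Z m act \<longleftrightarrow>
     (\<forall>k\<in>arrows K. \<forall>z\<in>topspace Z. src K k = m z \<longrightarrow> act k z = z \<longrightarrow> k \<in> units K)"

definition free_right :: "'l groupoid \<Rightarrow> 'z topology \<Rightarrow> ('z \<Rightarrow> 'l) \<Rightarrow> ('z \<Rightarrow> 'l \<Rightarrow> 'z) \<Rightarrow> bool" where
  "free_right L Z n act \<longleftrightarrow>
     (\<forall>z\<in>topspace Z. \<forall>l\<in>arrows L. n z = rng L l \<longrightarrow> act z l = z \<longrightarrow> l \<in> units L)"

definition proper_left :: "'k groupoid \<Rightarrow> 'z topology \<Rightarrow> ('z \<Rightarrow> 'k) \<Rightarrow> ('k \<Rightarrow> 'z \<Rightarrow> 'z) \<Rightarrow> bool" where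
  "proper_left K Z m act \<longleftrightarrow>
     proper_map (left_pairs K Z m) (prod_topology Z Z) (\<lambda>(k, z). (act k z, z))"

definition proper_right :: "'l groupoid \<Rightarrow> 'z topology \<Rightarrow> ('z \<Rightarrow> 'l) \<Rightarrow> ('z \<Rightarrow> 'l \<Rightarrow> 'z) \<Rightarrow> bool" where
  "proper_right L Z n act \<longleftrightarrow>
     proper_map (right_pairs Z L n) (prod_topology Z Z) (\<lambda>(z, l). (z, act z l))"

definition left_orbit :: "'k groupoid \<Rightarrow> ('z \<Rightarrow> 'k) \<Rightarrow> ('k \<Rightarrow> 'z \<Rightarrow> 'z) \<Rightarrow> 'z \<Rightarrow> 'z set" where
  "left_orbit K m act z = {act k z | k. k \<in> arrows K \<and> src K k = m z}"

definition right_orbit :: "'l groupoid \<Rightarrow> ('z \<Rightarrow> 'l) \<Rightarrow> ('z \<Rightarrow> 'l \<Rightarrow> 'z) \<Rightarrow> 'z \<Rightarrow> 'z set" where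
  "right_orbit L n act z = {act z l | l. l \<in> arrows L \<and> n z = rng L l}"


section \<open>Groupoid equivalence\<close>

locale groupoid_equivalence =
  K: lc_groupoid K + L: lc_groupoid L +
  left: left_groupoid_action K Z m lact + right: right_groupoid_action L Z n ract
  for K :: "'k groupoid" and L :: "'l groupoid" and Z :: "'z topology"
    and m :: "'z \<Rightarrow> 'k" and n :: "'z \<Rightarrow> 'l"
    and lact :: "'k \<Rightarrow> 'z \<Rightarrow> 'z" and ract :: "'z \<Rightarrow> 'l \<Rightarrow> 'z" +
  assumes locally_compact: "locally_compact_space Z"
    and Hausdorff: "Hausdorff_space Z"
    and left_free: "free_left K Z m lact"
    and left_proper: "proper_left K Z m lact"
    and right_free: "free_right L Z n ract"
    and right_proper: "proper_right L Z n ract"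
    and n_left_invariant: "k \<in> arrows K \<Longrightarrow> z \<in> topspace Z \<Longrightarrow> src K k = m z \<Longrightarrow>
          n (lact k z) = n z"
    and m_right_invariant: "z \<in> topspace Z \<Longrightarrow> l \<in> arrows L \<Longrightarrow> n z = rng L l \<Longrightarrow>
          m (ract z l) = m z"
    and commute: "k \<in> arrows K \<Longrightarrow> z \<in> topspace Z \<Longrightarrow> l \<in> arrows L \<Longrightarrow>
          src K k = m z \<Longrightarrow> n z = rng L l \<Longrightarrow> ract (lact k z) l = lact k (ract z l)"
    and m_open: "open_map Z (unit_space K) m"
    and m_surj: "m ` topspace Z = units K"
    and n_open: "open_map Z (unit_space L) n"
    and n_surj: "n ` topspace Z = units L"
    and m_homeo: "homeomorphic_map (quotient_topology Z (right_orbit L n ract))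
          (unit_space K) (on_class m)"
    and n_homeo: "homeomorphic_map (quotient_topology Z (left_orbit K m lact))
          (unit_space L) (on_class n)"


section \<open>Self-similar actions\<close>

text \<open>\<open>rho_mom X \<rho>0\<close> and \<open>sigma_mom X \<sigma>0\<close> are the momentum maps on all of \<open>X\<close> determined by
  the maps \<open>\<rho>0\<close> and \<open>\<sigma>0\<close> on units.\<close>

abbreviation (input) rho_mom :: "'x groupoid \<Rightarrow> ('x \<Rightarrow> 'h) \<Rightarrow> 'x \<Rightarrow> 'h" where
  "rho_mom X \<rho>0 x \<equiv> \<rho>0 (rng X x)"

abbreviation (input) sigma_mom :: "'x groupoid \<Rightarrow> ('x \<Rightarrow> 'g) \<Rightarrow> 'x \<Rightarrow> 'g" where
  "sigma_mom X \<sigma>0 x \<equiv> \<sigma>0 (src X x)"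

locale self_similar_left =
  H: lc_groupoid H + X: lc_groupoid X
  for H :: "'h groupoid" and X :: "'x groupoid" +
  fixes \<rho>0 :: "'x \<Rightarrow> 'h"
    and act :: "'h \<Rightarrow> 'x \<Rightarrow> 'x" (infixr "\<rhd>" 75)
    and res :: "'h \<Rightarrow> 'x \<Rightarrow> 'h" (infixl "\<lhd>" 75)
  assumes continuous_\<rho>0: "continuous_map (unit_space X) (unit_space H) \<rho>0"
    and surj_\<rho>0: "\<rho>0 ` units X = units H"
    and continuous_act: "continuous_map (left_pairs H (arr_top X) (rho_mom X \<rho>0)) (arr_top X)
          (\<lambda>(h, x). h \<rhd> x)"
    and continuous_res: "continuous_map (left_pairs H (arr_top X) (rho_mom X \<rho>0)) (arr_top H)
          (\<lambda>(h, x). h \<lhd> x)"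
    and L1_rho_act: "h \<in> arrows H \<Longrightarrow> x \<in> arrows X \<Longrightarrow> src H h = rho_mom X \<rho>0 x \<Longrightarrow>
          rng H h = rho_mom X \<rho>0 (h \<rhd> x)"
    and L1_src_res: "h \<in> arrows H \<Longrightarrow> x \<in> arrows X \<Longrightarrow> src H h = rho_mom X \<rho>0 x \<Longrightarrow>
          src H (h \<lhd> x) = rho_mom X \<rho>0 (ginv X x)"
    and L1_rng_res: "h \<in> arrows H \<Longrightarrow> x \<in> arrows X \<Longrightarrow> src H h = rho_mom X \<rho>0 x \<Longrightarrow>
          rng H (h \<lhd> x) = rho_mom X \<rho>0 (ginv X (h \<rhd> x))"
    and L2_res: "h \<in> arrows H \<Longrightarrow> v \<in> units X \<Longrightarrow> src H h = rho_mom X \<rho>0 v \<Longrightarrow> h \<lhd> v = h"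
    and L2_act: "x \<in> arrows X \<Longrightarrow> rho_mom X \<rho>0 x \<rhd> x = x"
    and src_act: "h \<in> arrows H \<Longrightarrow> (x, y) \<in> composable X \<Longrightarrow> src H h = rho_mom X \<rho>0 x \<Longrightarrow>
          src X (h \<rhd> x) = rng X ((h \<lhd> x) \<rhd> y)"
    and L3: "h \<in> arrows H \<Longrightarrow> (x, y) \<in> composable X \<Longrightarrow> src H h = rho_mom X \<rho>0 x \<Longrightarrow>
          h \<lhd> (x \<odot>\<^bsub>X\<^esub> y) = (h \<lhd> x) \<lhd> y"
    and L4: "h \<in> arrows H \<Longrightarrow> (x, y) \<in> composable X \<Longrightarrow> src H h = rho_mom X \<rho>0 x \<Longrightarrow>
          h \<rhd> (x \<odot>\<^bsub>X\<^esub> y) = (h \<rhd> x) \<odot>\<^bsub>X\<^esub> ((h \<lhd> x) \<rhd> y)"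
    and L5: "(h, k) \<in> composable H \<Longrightarrow> x \<in> arrows X \<Longrightarrow> src H k = rho_mom X \<rho>0 x \<Longrightarrow>
          (h \<odot>\<^bsub>H\<^esub> k) \<rhd> x = h \<rhd> (k \<rhd> x)"
    and L6: "(h, k) \<in> composable H \<Longrightarrow> x \<in> arrows X \<Longrightarrow> src H k = rho_mom X \<rho>0 x \<Longrightarrow>
          (h \<odot>\<^bsub>H\<^esub> k) \<lhd> x = (h \<lhd> (k \<rhd> x)) \<odot>\<^bsub>H\<^esub> (k \<lhd> x)"

locale self_similar_right =
  G: lc_groupoid G + X: lc_groupoid X
  for G :: "'g groupoid" and X :: "'x groupoid" +
  fixes \<sigma>0 :: "'x \<Rightarrow> 'g"
    and act :: "'x \<Rightarrow> 'g \<Rightarrow> 'x" (infixl "\<lhd>" 75)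
    and res :: "'x \<Rightarrow> 'g \<Rightarrow> 'g" (infixr "\<rhd>" 75)
  assumes continuous_\<sigma>0: "continuous_map (unit_space X) (unit_space G) \<sigma>0"
    and surj_\<sigma>0: "\<sigma>0 ` units X = units G"
    and continuous_act: "continuous_map (right_pairs (arr_top X) G (sigma_mom X \<sigma>0)) (arr_top X)
          (\<lambda>(x, t). x \<lhd> t)"
    and continuous_res: "continuous_map (right_pairs (arr_top X) G (sigma_mom X \<sigma>0)) (arr_top G)
          (\<lambda>(x, t). x \<rhd> t)"
    and R1_sigma_act: "x \<in> arrows X \<Longrightarrow> t \<in> arrows G \<Longrightarrow> sigma_mom X \<sigma>0 x = rng G t \<Longrightarrow>
          sigma_mom X \<sigma>0 (x \<lhd> t) = src G t"
    and R1_rng_res: "x \<in> arrows X \<Longrightarrow> t \<in> arrows G \<Longrightarrow> sigma_mom X \<sigma>0 x = rng G t \<Longrightarrow>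
          sigma_mom X \<sigma>0 (ginv X x) = rng G (x \<rhd> t)"
    and R1_src_res: "x \<in> arrows X \<Longrightarrow> t \<in> arrows G \<Longrightarrow> sigma_mom X \<sigma>0 x = rng G t \<Longrightarrow>
          sigma_mom X \<sigma>0 (ginv X (x \<lhd> t)) = src G (x \<rhd> t)"
    and R2_res: "v \<in> units X \<Longrightarrow> t \<in> arrows G \<Longrightarrow> sigma_mom X \<sigma>0 v = rng G t \<Longrightarrow> v \<rhd> t = t"
    and R2_act: "x \<in> arrows X \<Longrightarrow> x \<lhd> sigma_mom X \<sigma>0 x = x"
    and src_act: "(x, y) \<in> composable X \<Longrightarrow> t \<in> arrows G \<Longrightarrow> sigma_mom X \<sigma>0 y = rng G t \<Longrightarrow>
          src X (x \<lhd> (y \<rhd> t)) = rng X (y \<lhd> t)"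
    and R3: "(x, y) \<in> composable X \<Longrightarrow> t \<in> arrows G \<Longrightarrow> sigma_mom X \<sigma>0 y = rng G t \<Longrightarrow>
          (x \<odot>\<^bsub>X\<^esub> y) \<rhd> t = x \<rhd> (y \<rhd> t)"
    and R4: "(x, y) \<in> composable X \<Longrightarrow> t \<in> arrows G \<Longrightarrow> sigma_mom X \<sigma>0 y = rng G t \<Longrightarrow>
          (x \<odot>\<^bsub>X\<^esub> y) \<lhd> t = (x \<lhd> (y \<rhd> t)) \<odot>\<^bsub>X\<^esub> (y \<lhd> t)"
    and R5: "x \<in> arrows X \<Longrightarrow> (t, t') \<in> composable G \<Longrightarrow> sigma_mom X \<sigma>0 x = rng G t \<Longrightarrow>
          x \<lhd> (t \<odot>\<^bsub>G\<^esub> t') = (x \<lhd> t) \<lhd> t'"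
    and R6: "x \<in> arrows X \<Longrightarrow> (t, t') \<in> composable G \<Longrightarrow> sigma_mom X \<sigma>0 x = rng G t \<Longrightarrow>
          x \<rhd> (t \<odot>\<^bsub>G\<^esub> t') = (x \<rhd> t) \<odot>\<^bsub>G\<^esub> ((x \<lhd> t) \<rhd> t')"

text \<open>In the two locales above \<open>\<rhd>\<close> and \<open>\<lhd>\<close> are local notation: on the left,
  \<open>act h x\<close> is the action on the space and \<open>res h x\<close> lies in \<open>H\<close>; on the right,
  \<open>act x t\<close> is the action on the space and \<open>res x t\<close> lies in \<open>G\<close>. Below they are
  called \<open>la\<close>, \<open>lr\<close>, \<open>ra\<close>, \<open>rr\<close>.\<close>

definition in_tune ::
  "'h groupoid \<Rightarrow> 'g groupoid \<Rightarrow> 'x groupoid \<Rightarrow>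
   ('x \<Rightarrow> 'h) \<Rightarrow> ('h \<Rightarrow> 'x \<Rightarrow> 'x) \<Rightarrow> ('h \<Rightarrow> 'x \<Rightarrow> 'h) \<Rightarrow>
   ('x \<Rightarrow> 'g) \<Rightarrow> ('x \<Rightarrow> 'g \<Rightarrow> 'x) \<Rightarrow> ('x \<Rightarrow> 'g \<Rightarrow> 'g) \<Rightarrow> bool" where
  "in_tune H G X \<rho>0 la lr \<sigma>0 ra rr \<longleftrightarrow>
     (\<forall>h\<in>arrows H. \<forall>x\<in>arrows X. \<forall>t\<in>arrows G.
        src H h = rho_mom X \<rho>0 x \<longrightarrow> sigma_mom X \<sigma>0 x = rng G t \<longrightarrow>
          sigma_mom X \<sigma>0 (la h x) = sigma_mom X \<sigma>0 x \<and>
          rho_mom X \<rho>0 (ra x t) = rho_mom X \<rho>0 x \<and>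
          la h (ra x t) = ra (la h x) t \<and>
          rr (la h x) t = rr x t \<and>
          lr h (ra x t) = lr h x)"


section \<open>Self-similar product groupoids\<close>

text \<open>The unit corresponding to \<open>u\<close> is \<open>(u, \<rho>0 u)\<close> in the first product and
  \<open>(\<sigma>0 u, u)\<close> in the second. By the action axioms, \<open>src\<close> and \<open>rng\<close> agree exactly for
  pairs with \<open>s(x) = h \<rhd> r(y)\<close>, respectively \<open>s(x) = r(y) \<lhd> t\<inverse>\<close>.\<close>

definition left_product ::
  "'x groupoid \<Rightarrow> 'h groupoid \<Rightarrow> ('x \<Rightarrow> 'h) \<Rightarrow> ('h \<Rightarrow> 'x \<Rightarrow> 'x) \<Rightarrow> ('h \<Rightarrow> 'x \<Rightarrow> 'h) \<Rightarrow>
   ('x \<times> 'h) groupoid" where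
  "left_product X H \<rho>0 la lr =
     \<lparr> arr_top = subtopology (prod_topology (arr_top X) (arr_top H))
                   {(x, h). rho_mom X \<rho>0 (ginv X x) = rng H h},
       units = (\<lambda>u. (u, \<rho>0 u)) ` units X,
       rng = (\<lambda>(x, h). let u = rng X x in (u, \<rho>0 u)),
       src = (\<lambda>(x, h). let u = la (ginv H h) (src X x) in (u, \<rho>0 u)),
       gmul = (\<lambda>(x, h) (y, k). (x \<odot>\<^bsub>X\<^esub> la h y, lr h y \<odot>\<^bsub>H\<^esub> k)),
       ginv = (\<lambda>(x, h). (la (ginv H h) (ginv X x), lr (ginv H h) (ginv X x))) \<rparr>"

definition right_product ::
  "'g groupoid \<Rightarrow> 'x groupoid \<Rightarrow> ('x \<Rightarrow> 'g) \<Rightarrow> ('x \<Rightarrow> 'g \<Rightarrow> 'x) \<Rightarrow> ('x \<Rightarrow> 'g \<Rightarrow> 'g) \<Rightarrow>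
   ('g \<times> 'x) groupoid" where
  "right_product G X \<sigma>0 ra rr =
     \<lparr> arr_top = subtopology (prod_topology (arr_top G) (arr_top X))
                   {(t, x). src G t = sigma_mom X \<sigma>0 (ginv X x)},
       units = (\<lambda>u. (\<sigma>0 u, u)) ` units X,
       rng = (\<lambda>(t, x). let u = ra (rng X x) (ginv G t) in (\<sigma>0 u, u)),
       src = (\<lambda>(t, x). let u = src X x in (\<sigma>0 u, u)),
       gmul = (\<lambda>(s, x) (t, y). (s \<odot>\<^bsub>G\<^esub> rr x t, ra x t \<odot>\<^bsub>X\<^esub> y)),
       ginv = (\<lambda>(t, x). (rr (ginv X x) (ginv G t), ra (ginv X x) (ginv G t))) \<rparr>"


section \<open>Quotient groupoids\<close>

text \<open>Here \<open>q\<close> is the map sending an arrow to its class (in the applications, its orbit).\<close>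

definition quotient_groupoid :: "'x groupoid \<Rightarrow> ('x \<Rightarrow> 'x set) \<Rightarrow> 'x set groupoid" where
  "quotient_groupoid X q =
     \<lparr> arr_top = quotient_topology (arr_top X) q,
       units = q ` units X,
       rng = on_class (\<lambda>x. q (rng X x)),
       src = on_class (\<lambda>x. q (src X x)),
       gmul = (\<lambda>\<xi> \<eta>. the_elem {q (x \<odot>\<^bsub>X\<^esub> y) | x y. x \<in> \<xi> \<and> y \<in> \<eta> \<and> src X x = rng X y}),
       ginv = on_class (\<lambda>x. q (ginv X x)) \<rparr>"

text \<open>For in-tune actions with orbit maps \<open>p x = H \<rhd> x\<close> and \<open>q x = x \<lhd> G\<close>: the product of
  \<open>X/G\<close> with \<open>H\<close> and the product of \<open>G\<close> with the quotient of \<open>X\<close> by \<open>H\<close>, for the induced self-similar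
  actions on the quotients.\<close>

definition quotient_left_product ::
  "'x groupoid \<Rightarrow> ('x \<Rightarrow> 'x set) \<Rightarrow> 'h groupoid \<Rightarrow>
   ('x \<Rightarrow> 'h) \<Rightarrow> ('h \<Rightarrow> 'x \<Rightarrow> 'x) \<Rightarrow> ('h \<Rightarrow> 'x \<Rightarrow> 'h) \<Rightarrow> ('x set \<times> 'h) groupoid" where
  "quotient_left_product X q H \<rho>0 la lr =
     left_product (quotient_groupoid X q) H (on_class \<rho>0)
       (\<lambda>h. on_class (\<lambda>x. q (la h x))) (\<lambda>h. on_class (lr h))"

definition right_quotient_product ::
  "'g groupoid \<Rightarrow> 'x groupoid \<Rightarrow> ('x \<Rightarrow> 'x set) \<Rightarrow>
   ('x \<Rightarrow> 'g) \<Rightarrow> ('x \<Rightarrow> 'g \<Rightarrow> 'x) \<Rightarrow> ('x \<Rightarrow> 'g \<Rightarrow> 'g) \<Rightarrow> ('g \<times> 'x set) groupoid" where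
  "right_quotient_product G X p \<sigma>0 ra rr =
     right_product G (quotient_groupoid X p) (on_class \<sigma>0)
       (\<lambda>\<eta> t. on_class (\<lambda>x. p (ra x t)) \<eta>) (\<lambda>\<eta> t. on_class (\<lambda>x. rr x t) \<eta>)"

end

theory Submission
  imports Defs
begin

text \<open>
  The orbit map of a free and proper action is open, and the arrow carrying one point of an orbit to
  another depends continuously on the two points. Hence, for a class \<open>\<xi>\<close> in \<open>X/G\<close> and an arrow \<open>y\<close> with
  \<open>s(\<xi>) = r(y) \<lhd> G\<close>, the unique \<open>x \<in> \<xi>\<close> with \<open>s(x) = r(y)\<close> depends continuously on \<open>\<xi>\<close> and \<open>y\<close>. This
  makes the multiplication of \<open>X/G\<close> and the left action of the product groupoid \<open>K\<close> on \<open>X\<close> continuous.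
  Two arrows \<open>w\<close> and \<open>y\<close> lie in the same \<open>K\<close>-orbit iff \<open>s(w)\<close> and \<open>s(y)\<close> lie in the same \<open>H\<close>-orbit: from
  \<open>k \<rhd> s(y) = s(w)\<close> one recovers \<open>h = k \<lhd> y\<inverse>\<close> and then \<open>x = w (h \<rhd> y)\<inverse>\<close>. These formulas are
  continuous on a closed set, which gives properness. Everything about the right action follows by
  passing to opposite groupoids.
\<close>

section \<open>Open quotient maps\<close>

text \<open>The operations on quotients are defined on classes, but their continuity has to be read
  off on \<open>X\<close>. For this, products of orbit maps and their restrictions to fibre products
  must be quotient maps; quotient maps in general fail here, open ones do not. This is where the
  open sources of \<open>H\<close> and \<open>G\<close> enter, while that of \<open>X\<close> makes
  the momentum maps open. A freely chosen representative is usually not composable with its partner,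
  so each formula first corrects it by a translating arrow. The recovery of h comes from s(x (h
  \<rhd> y)) = (h \<lhd> y) \<rhd> s(y): freeness determines k = h \<lhd> y from the two sources,
  and (L3) with (L2) gives (h \<lhd> y) \<lhd> y\<inverse> = h \<lhd> r(y) = h. The product groupoid
  of the opposites is, after exchanging coordinates, the opposite of the second product groupoid;
  this is how duality reaches the right action. Only the commutation of the two actions involves
  both sides at once and is computed directly.\<close>

lemma open_map_prod:
  assumes "open_map A B f" "open_map C D g"
  shows "open_map (prod_topology A C) (prod_topology B D) (\<lambda>(x, y). (f x, g y))"
  unfolding open_map_def
proof (intro allI impI)
  fix U assume U: "openin (prod_topology A C) U"
  show "openin (prod_topology B D) ((\<lambda>(x, y). (f x, g y)) ` U)"
    unfolding openin_prod_topology_alt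
  proof (intro allI impI)
    fix b d assume "(b, d) \<in> (\<lambda>(x, y). (f x, g y)) ` U"
    then obtain x y where xy: "(x, y) \<in> U" "b = f x" "d = g y" by auto
    with U obtain V W where "openin A V" "openin C W" "x \<in> V" "y \<in> W" "V \<times> W \<subseteq> U"
      by (force simp: openin_prod_topology_alt)
    then have "openin B (f ` V)" "openin D (g ` W)" "b \<in> f ` V" "d \<in> g ` W"
      using assms xy unfolding open_map_def by blast+
    moreover have "f ` V \<times> g ` W \<subseteq> (\<lambda>(x, y). (f x, g y)) ` U"
    proof
      fix p assume "p \<in> f ` V \<times> g ` W"
      then obtain v w where "v \<in> V" "w \<in> W" "p = (f v, g w)" by blast
      then show "p \<in> (\<lambda>(x, y). (f x, g y)) ` U"
        using \<open>V \<times> W \<subseteq> U\<close> by (intro image_eqI[of _ _ "(v, w)"]) auto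
    qed
    ultimately show "\<exists>V W. openin B V \<and> openin D W \<and> b \<in> V \<and> d \<in> W \<and>
        V \<times> W \<subseteq> (\<lambda>(x, y). (f x, g y)) ` U"
      by blast
  qed
qed

lemma second_countable_prod_topology:
  assumes "second_countable A" "second_countable B"
  shows "second_countable (prod_topology A B)"
proof -
  obtain \<U> \<V> where U: "countable \<U>" "\<And>V. V \<in> \<U> \<Longrightarrow> openin A V"
      "\<And>W x. openin A W \<Longrightarrow> x \<in> W \<Longrightarrow> \<exists>V\<in>\<U>. x \<in> V \<and> V \<subseteq> W"
    and V: "countable \<V>" "\<And>V. V \<in> \<V> \<Longrightarrow> openin B V"
      "\<And>W x. openin B W \<Longrightarrow> x \<in> W \<Longrightarrow> \<exists>V\<in>\<V>. x \<in> V \<and> V \<subseteq> W"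
    using assms unfolding second_countable_def by metis
  let ?B = "(\<lambda>(V, W). V \<times> W) ` (\<U> \<times> \<V>)"
  have "countable ?B" using U(1) V(1) by simp
  moreover have "\<forall>S\<in>?B. openin (prod_topology A B) S"
    using U(2) V(2) by (auto simp: openin_prod_Times_iff)
  moreover have "\<exists>S\<in>?B. p \<in> S \<and> S \<subseteq> N" if N: "openin (prod_topology A B) N" "p \<in> N" for N p
  proof -
    obtain x y where p: "p = (x, y)" by (cases p)
    then obtain S T where ST: "openin A S" "openin B T" "x \<in> S" "y \<in> T" "S \<times> T \<subseteq> N"
      using N unfolding openin_prod_topology_alt by metis
    obtain V where V': "V \<in> \<U>" "x \<in> V" "V \<subseteq> S" using U(3)[OF ST(1,3)] by blast
    obtain W where W': "W \<in> \<V>" "y \<in> W" "W \<subseteq> T" using V(3)[OF ST(2,4)] by blast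
    have "V \<times> W \<subseteq> N" using Sigma_mono[OF V'(3) W'(3)] ST(5) by (rule order_trans)
    then show ?thesis
      using V' W' p by (intro bexI[of _ "V \<times> W"] conjI image_eqI[of _ _ "(V, W)"]) simp_all
  qed
  ultimately show ?thesis unfolding second_countable_def by (intro exI[of _ ?B] conjI allI impI) simp_all
qed

text \<open>A quotient map restricted to the full preimage of an arbitrary \<open>V\<close> may fail
  to be a quotient map; openness survives the restriction and restores the conclusion.\<close>

lemma quotient_map_restriction_open:
  assumes "quotient_map A B f" "open_map A B f" "{x \<in> topspace A. f x \<in> V} = U"
  shows "quotient_map (subtopology A U) (subtopology B V) f"
proof (rule continuous_open_imp_quotient_map)
  have c: "continuous_map A B f" and s: "f ` topspace A = topspace B"
    using assms(1) quotient_imp_continuous_map quotient_imp_surjective_map by blast+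
  show "continuous_map (subtopology A U) (subtopology B V) f"
    using c assms(3) by (auto simp: continuous_map_in_subtopology continuous_map_from_subtopology)
  show "open_map (subtopology A U) (subtopology B V) f"
    using assms open_map_restriction by blast
  show "f ` topspace (subtopology A U) = topspace (subtopology B V)"
    using s assms(3) by auto
qed

lemma quotient_map_ident: "quotient_map A A (\<lambda>x. x)"
  using homeomorphic_map_id[of A A] by (simp add: id_def homeomorphic_map_def)

text \<open>Products of quotient maps need not be quotient maps, but open ones are stable under
  products. With \<open>T\<close> the composable pairs or the fibre product of an action, this
  reduces continuity of an operation on classes to continuity of a formula in representatives.
  Openness is concluded as well, so that the lemma can be iterated.\<close>

lemma quotient_map_prod_restrict:
  assumes "quotient_map A B f" "open_map A B f" "quotient_map C D g" "open_map C D g"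
    and "\<And>x y. x \<in> topspace A \<Longrightarrow> y \<in> topspace C \<Longrightarrow> (f x, g y) \<in> T \<longleftrightarrow> (x, y) \<in> S"
  shows "quotient_map (subtopology (prod_topology A C) S) (subtopology (prod_topology B D) T)
      (\<lambda>(x, y). (f x, g y))"
    and "open_map (subtopology (prod_topology A C) S) (subtopology (prod_topology B D) T)
      (\<lambda>(x, y). (f x, g y))"
proof -
  have c: "continuous_map A B f" "continuous_map C D g"
    and s: "f ` topspace A = topspace B" "g ` topspace C = topspace D"
    using assms quotient_imp_continuous_map quotient_imp_surjective_map by blast+
  have o: "open_map (prod_topology A C) (prod_topology B D) (\<lambda>(x, y). (f x, g y))"
    using assms by (intro open_map_prod)
  have "quotient_map (prod_topology A C) (prod_topology B D) (\<lambda>(x, y). (f x, g y))"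
  proof (rule continuous_open_imp_quotient_map[OF _ o])
    show "continuous_map (prod_topology A C) (prod_topology B D) (\<lambda>(x, y). (f x, g y))"
      unfolding case_prod_unfold using c
      by (intro continuous_map_pairedI)
        (auto simp: continuous_map_of_fst[unfolded o_def] continuous_map_of_snd[unfolded o_def])
    show "(\<lambda>(x, y). (f x, g y)) ` topspace (prod_topology A C) = topspace (prod_topology B D)"
      using s by (simp add: image_paired_Times)
  qed
  note q = this
  have S: "{x \<in> topspace (prod_topology A C). (case x of (x, y) \<Rightarrow> (f x, g y)) \<in> T}
      = topspace (prod_topology A C) \<inter> S"
    using assms(5) by auto
  show "quotient_map (subtopology (prod_topology A C) S) (subtopology (prod_topology B D) T)
      (\<lambda>(x, y). (f x, g y))"
    using quotient_map_restriction_open[OF q o S] by (simp only: subtopology_restrict)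
  show "open_map (subtopology (prod_topology A C) S) (subtopology (prod_topology B D) T)
      (\<lambda>(x, y). (f x, g y))"
    using open_map_restriction[OF o S] by (simp only: subtopology_restrict)
qed

lemma continuous_map_through_quotient:
  assumes "quotient_map A B f" "continuous_map A C (\<lambda>x. g (f x))"
  shows "continuous_map B C g"
  using continuous_compose_quotient_map[OF assms(1)] assms(2) by (simp add: o_def)

lemma quotient_map_imp_eq_quotient_topology:
  assumes "quotient_map A B q"
  shows "quotient_topology A q = B"
proof -
  have s: "q ` topspace A = topspace B" using assms quotient_imp_surjective_map by blast
  show ?thesis unfolding topology_eq openin_quotient_topology s
    using assms openin_subset unfolding quotient_map_def by blast
qed

lemma quotient_topology_locally_compact:
  assumes "open_map A (quotient_topology A q) q" "locally_compact_space A"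
  shows "locally_compact_space (quotient_topology A q)"
  using locally_compact_space_continuous_open_map_image assms
    quotient_imp_continuous_map[OF quotient_map_quotient_topology[of A q]]
  by (metis topspace_quotient_topology)

lemma quotient_topology_second_countable:
  assumes "open_map A (quotient_topology A q) q" "second_countable A"
  shows "second_countable (quotient_topology A q)"
  using second_countable_open_map_image assms
    quotient_imp_continuous_map[OF quotient_map_quotient_topology[of A q]]
  by (metis topspace_quotient_topology)

lemma quotient_topology_Hausdorff:
  assumes op: "open_map A (quotient_topology A q) q"
    and cl: "closedin (prod_topology A A) {(x, y). x \<in> topspace A \<and> y \<in> topspace A \<and> q x = q y}"
  shows "Hausdorff_space (quotient_topology A q)"
proof -
  have "\<exists>U V. openin (quotient_topology A q) U \<and> openin (quotient_topology A q) V \<and>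
      q x \<in> U \<and> q y \<in> V \<and> disjnt U V"
    if x: "x \<in> topspace A" and y: "y \<in> topspace A" and ne: "q x \<noteq> q y" for x y
  proof -
    let ?R = "{(x, y). x \<in> topspace A \<and> y \<in> topspace A \<and> q x = q y}"
    have "openin (prod_topology A A) (topspace (prod_topology A A) - ?R)"
      using cl by blast
    moreover have "(x, y) \<in> topspace (prod_topology A A) - ?R" using that by simp
    ultimately obtain V W where V: "openin A V" "openin A W" "x \<in> V" "y \<in> W"
      "V \<times> W \<subseteq> topspace (prod_topology A A) - ?R"
      unfolding openin_prod_topology_alt by meson
    \<comment> \<open>A box that misses the relation contains no pair of equivalent points, so the
      images of its sides are disjoint; they are open because \<open>q\<close> is.\<close>
    have "disjnt (q ` V) (q ` W)" using V(5) unfolding disjnt_def by auto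
    moreover have "openin (quotient_topology A q) (q ` V)" "openin (quotient_topology A q) (q ` W)"
      using op V unfolding open_map_def by auto
    ultimately show ?thesis using V(3,4) by blast
  qed
  then show ?thesis unfolding Hausdorff_space_def by auto
qed

text \<open>The hypotheses say that the classes \<open>q x\<close> are the fibres of
  \<open>f\<close>, so \<open>on_class f\<close> is an injective quotient map. It applies to the
  momentum maps once the orbits are known to be their fibres.\<close>

lemma homeomorphic_map_on_class:
  assumes f: "quotient_map A B f"
    and self: "\<And>x. x \<in> topspace A \<Longrightarrow> x \<in> q x"
    and sub: "\<And>x y. x \<in> topspace A \<Longrightarrow> y \<in> q x \<Longrightarrow> y \<in> topspace A \<and> f y = f x"
    and inj: "\<And>x y. x \<in> topspace A \<Longrightarrow> y \<in> topspace A \<Longrightarrow> f x = f y \<Longrightarrow> q x = q y"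
  shows "homeomorphic_map (quotient_topology A q) B (on_class f)"
proof -
  have oc: "on_class f (q x) = f x" if "x \<in> topspace A" for x
  proof -
    have "f ` q x = {f x}" using self[OF that] sub[OF that] by blast
    then show ?thesis by (simp add: on_class_def)
  qed
  have "quotient_map A B (on_class f \<circ> q)"
    by (rule quotient_map_eq[OF f]) (simp add: oc)
  note comp = this
  have "continuous_map (quotient_topology A q) B (on_class f)"
    using comp by (intro continuous_compose_quotient_map[OF quotient_map_quotient_topology]
      quotient_imp_continuous_map)
  then have "quotient_map (quotient_topology A q) B (on_class f)"
    by (rule quotient_map_from_composition
      [OF quotient_imp_continuous_map[OF quotient_map_quotient_topology] _ comp])
  moreover have "inj_on (on_class f) (topspace (quotient_topology A q))"
  proof (rule inj_onI)
    fix a b assume "a \<in> topspace (quotient_topology A q)" "b \<in> topspace (quotient_topology A q)"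
      and eq: "on_class f a = on_class f b"
    then obtain x y where xy: "x \<in> topspace A" "y \<in> topspace A" "a = q x" "b = q y" by auto
    then show "a = b" using eq inj[of x y] oc[of x] oc[of y] by simp
  qed
  ultimately show ?thesis by (simp add: homeomorphic_map_def)
qed

section \<open>Proper maps and closed embeddings\<close>

lemma proper_map_swap: "proper_map (prod_topology A B) (prod_topology B A) prod.swap"
proof (rule homeomorphic_imp_proper_map, rule homeomorphic_maps_imp_map)
  show "homeomorphic_maps (prod_topology A B) (prod_topology B A) prod.swap prod.swap"
    unfolding homeomorphic_maps_def prod.swap_def
    by (auto simp: continuous_map_fst continuous_map_snd intro!: continuous_map_pairedI)
qed

text \<open>\<open>f\<close> is a homeomorphism onto \<open>C\<close> with inverse \<open>g\<close>,
  followed by a closed inclusion; both are proper. Properness of an action thus reduces to a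
  continuous formula for the acting arrow on a closed set of pairs.\<close>

lemma proper_map_retract:
  assumes f: "continuous_map A B f" and C: "closedin B C"
    and fC: "\<And>a. a \<in> topspace A \<Longrightarrow> f a \<in> C"
    and g: "continuous_map (subtopology B C) A g"
    and gf: "\<And>a. a \<in> topspace A \<Longrightarrow> g (f a) = a"
    and fg: "\<And>c. c \<in> C \<Longrightarrow> f (g c) = c"
  shows "proper_map A B f"
proof -
  have "homeomorphic_maps A (subtopology B C) f g"
    unfolding homeomorphic_maps_def
    using f g gf fg fC by (auto simp: continuous_map_in_subtopology)
  then have "proper_map A (subtopology B C) f"
    using homeomorphic_maps_imp_map homeomorphic_imp_proper_map by blast
  moreover have "proper_map (subtopology B C) B id"
    using C closedin_subset[OF C] by (simp add: proper_map_inclusion closed_Int_compactin)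
  ultimately have "proper_map A B (id \<circ> f)" by (rule proper_map_compose)
  then show ?thesis by simp
qed

text \<open>A proper map is closed, and an injective continuous closed map is a closed embedding.
  For the map (k, z) to (k z, z) of a free proper action, the inverse produces the translating
  arrow.\<close>

lemma proper_map_inverse:
  assumes f: "continuous_map A B f" and p: "proper_map A B f" and inj: "inj_on f (topspace A)"
  shows "closedin B (f ` topspace A)"
    and "continuous_map (subtopology B (f ` topspace A)) A (inv_into (topspace A) f)"
proof -
  have c: "closed_map A B f" using p proper_imp_closed_map by blast
  then show "closedin B (f ` topspace A)" unfolding closed_map_def by blast
  have "embedding_map A B f" using injective_closed_imp_embedding_map f c inj by blast
  then have "homeomorphic_map A (subtopology B (f ` topspace A)) f"
    by (simp add: embedding_map_def)
  then obtain g where "homeomorphic_maps A (subtopology B (f ` topspace A)) f g"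
    using homeomorphic_map_maps by blast
  then have g: "continuous_map (subtopology B (f ` topspace A)) A g"
    and gf: "\<And>x. x \<in> topspace A \<Longrightarrow> g (f x) = x"
    unfolding homeomorphic_maps_def by auto
  show "continuous_map (subtopology B (f ` topspace A)) A (inv_into (topspace A) f)"
    by (rule continuous_map_eq[OF g]) (use gf inj in \<open>auto simp: inv_into_f_f\<close>)
qed

section \<open>Groupoids and their opposites\<close>

lemma composable_iff [simp]:
  "(x, y) \<in> composable K \<longleftrightarrow> x \<in> arrows K \<and> y \<in> arrows K \<and> src K x = rng K y"
  by (simp add: composable_def)

lemma topspace_unit_space [simp]: "topspace (unit_space K) = arrows K \<inter> units K"
  by (simp add: unit_space_def)

context lc_groupoid
begin

lemma unit_arrow [simp]: "u \<in> units K \<Longrightarrow> u \<in> arrows K"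
  using units_arrows by blast

lemma rng_arrow [simp]: "x \<in> arrows K \<Longrightarrow> rng K x \<in> arrows K"
  and src_arrow [simp]: "x \<in> arrows K \<Longrightarrow> src K x \<in> arrows K"
  using rng_units src_units by auto

lemma src_rng [simp]: "x \<in> arrows K \<Longrightarrow> src K (rng K x) = rng K x"
  and src_src [simp]: "x \<in> arrows K \<Longrightarrow> src K (src K x) = src K x"
  using rng_units src_units rng_unit src_unit by auto

lemma mul_closed [simp]:
  "x \<in> arrows K \<Longrightarrow> y \<in> arrows K \<Longrightarrow> src K x = rng K y \<Longrightarrow> x \<odot> y \<in> arrows K"
  and rng_mul' [simp]:
  "x \<in> arrows K \<Longrightarrow> y \<in> arrows K \<Longrightarrow> src K x = rng K y \<Longrightarrow> rng K (x \<odot> y) = rng K x"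
  and src_mul' [simp]:
  "x \<in> arrows K \<Longrightarrow> y \<in> arrows K \<Longrightarrow> src K x = rng K y \<Longrightarrow> src K (x \<odot> y) = src K y"
  by (simp_all add: mul_arrows rng_mul src_mul)

lemmas [simp] = inv_arrows rng_inv src_inv rng_unit src_unit rng_units src_units

lemma mul_assoc':
  "x \<in> arrows K \<Longrightarrow> y \<in> arrows K \<Longrightarrow> z \<in> arrows K \<Longrightarrow> src K x = rng K y \<Longrightarrow>
    src K y = rng K z \<Longrightarrow> x \<odot> y \<odot> z = x \<odot> (y \<odot> z)"
  by (simp add: mul_assoc)

lemma unit_mul: "u \<in> units K \<Longrightarrow> x \<in> arrows K \<Longrightarrow> u = rng K x \<Longrightarrow> u \<odot> x = x"
  and mul_unit: "u \<in> units K \<Longrightarrow> x \<in> arrows K \<Longrightarrow> src K x = u \<Longrightarrow> x \<odot> u = x"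
  using rng_mul_self mul_src_self by auto

lemma inv_mul_cancel [simp]:
  "x \<in> arrows K \<Longrightarrow> y \<in> arrows K \<Longrightarrow> src K x = rng K y \<Longrightarrow> ginv K x \<odot> (x \<odot> y) = y"
  using mul_assoc'[of "ginv K x" x y] by (simp add: inv_mul rng_mul_self)

lemma mul_inv_cancel [simp]:
  "x \<in> arrows K \<Longrightarrow> y \<in> arrows K \<Longrightarrow> src K x = rng K y \<Longrightarrow> x \<odot> y \<odot> ginv K y = x"
  using mul_assoc'[of x y "ginv K y"] mul_src_self[of x] by (simp add: mul_inv)

lemma mul_inv_cancel' [simp]:
  "x \<in> arrows K \<Longrightarrow> y \<in> arrows K \<Longrightarrow> src K x = src K y \<Longrightarrow> x \<odot> ginv K y \<odot> y = x"
  using mul_assoc'[of x "ginv K y" y] mul_src_self[of x] by (simp add: inv_mul)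

lemma mul_right_cancel:
  assumes "x \<in> arrows K" "x' \<in> arrows K" "y \<in> arrows K" "src K x = rng K y" "src K x' = rng K y"
    and "x \<odot> y = x' \<odot> y"
  shows "x = x'"
  using assms mul_inv_cancel by metis

lemma inv_unique:
  assumes "x \<in> arrows K" "y \<in> arrows K" "src K x = rng K y" "x \<odot> y \<in> units K"
  shows "y = ginv K x"
proof -
  have "x \<odot> y = rng K x" using assms rng_mul' rng_unit by metis
  then have "ginv K x \<odot> (x \<odot> y) = ginv K x \<odot> src K (ginv K x)" using assms by simp
  then show ?thesis using assms by (simp only: inv_mul_cancel mul_src_self inv_arrows)
qed

lemma inv_inv [simp]: "x \<in> arrows K \<Longrightarrow> ginv K (ginv K x) = x"
  using inv_unique[of "ginv K x" x] by (simp add: inv_mul)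

lemma inv_unit [simp]: "u \<in> units K \<Longrightarrow> ginv K u = u"
  using inv_unique[of u u] unit_mul[of u u] by simp

text \<open>Cancelling one x in x x = x leaves x = s(x). This is how h \<rhd> u and u \<lhd> x are
  recognised as units when u is one.\<close>

lemma idempotent_unit:
  assumes "x \<in> arrows K" "src K x = rng K x" "x \<odot> x = x"
  shows "x \<in> units K"
  using inv_mul_cancel[of x x] inv_mul[of x] assms by (metis src_units)

lemma continuous_map_mul:
  assumes "continuous_map T (arr_top K) f" "continuous_map T (arr_top K) g"
    and "\<And>z. z \<in> topspace T \<Longrightarrow> src K (f z) = rng K (g z)"
  shows "continuous_map T (arr_top K) (\<lambda>z. f z \<odot> g z)"
proof -
  have "continuous_map T (subtopology (prod_topology (arr_top K) (arr_top K)) (composable K))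
      (\<lambda>z. (f z, g z))"
    using assms continuous_map_funspace[OF assms(1)] continuous_map_funspace[OF assms(2)]
    by (auto simp: continuous_map_in_subtopology intro!: continuous_map_pairedI)
  from continuous_map_compose[OF this continuous_mul] show ?thesis by (simp add: o_def)
qed

lemma continuous_map_ginv:
  "continuous_map T (arr_top K) f \<Longrightarrow> continuous_map T (arr_top K) (\<lambda>z. ginv K (f z))"
  using continuous_map_compose[OF _ continuous_inv] by (simp add: o_def)

text \<open>The locale postulates continuity of product and inverse; r(z) = z z\<inverse> and s(z) =
  z\<inverse> z transfer it to range and source.\<close>

lemma continuous_map_rng_self: "continuous_map (arr_top K) (arr_top K) (rng K)"
proof (rule continuous_map_eq)
  show "continuous_map (arr_top K) (arr_top K) (\<lambda>z. z \<odot> ginv K z)"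
    by (intro continuous_map_mul continuous_map_ginv continuous_map_id[unfolded id_def]) simp
qed (simp add: mul_inv)

lemma continuous_map_src_self: "continuous_map (arr_top K) (arr_top K) (src K)"
proof (rule continuous_map_eq)
  show "continuous_map (arr_top K) (arr_top K) (\<lambda>z. ginv K z \<odot> z)"
    by (intro continuous_map_mul continuous_map_ginv continuous_map_id[unfolded id_def]) simp
qed (simp add: inv_mul)

lemma continuous_map_rng:
  "continuous_map T (arr_top K) f \<Longrightarrow> continuous_map T (arr_top K) (\<lambda>z. rng K (f z))"
  using continuous_map_compose[OF _ continuous_map_rng_self] by (simp add: o_def)

lemma continuous_map_src:
  "continuous_map T (arr_top K) f \<Longrightarrow> continuous_map T (arr_top K) (\<lambda>z. src K (f z))"
  using continuous_map_compose[OF _ continuous_map_src_self] by (simp add: o_def)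

lemma continuous_map_unit_space:
  "continuous_map T (unit_space K) f \<longleftrightarrow>
    continuous_map T (arr_top K) f \<and> (\<forall>z\<in>topspace T. f z \<in> units K)"
  by (auto simp: unit_space_def continuous_map_in_subtopology)

lemma open_map_rng:
  assumes "open_source K"
  shows "open_map (arr_top K) (unit_space K) (rng K)"
proof -
  have "homeomorphic_maps (arr_top K) (arr_top K) (ginv K) (ginv K)"
    by (simp add: homeomorphic_maps_def continuous_inv)
  then have "open_map (arr_top K) (arr_top K) (ginv K)"
    using homeomorphic_maps_imp_map homeomorphic_imp_open_map by blast
  then have "open_map (arr_top K) (unit_space K) (src K \<circ> ginv K)"
    using assms open_map_compose open_source_def by blast
  then show ?thesis by (rule open_map_eq) simp
qed

end

text \<open>Here \<open>L\<close> is just a record whose operations are those of the groupoid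
  \<open>K\<close>, transported with the order reversed. Opposites and the second product groupoid
  obtain their groupoid axioms this way, without a second verification.\<close>

locale groupoid_anti_isomorphism = lc_groupoid K
  for K :: "'k groupoid" (structure) and L :: "'l groupoid" and f g +
  assumes homeo: "homeomorphic_maps (arr_top K) (arr_top L) f g"
    and units: "units L = f ` units K"
    and rng: "x \<in> arrows K \<Longrightarrow> rng L (f x) = f (src K x)"
    and src: "x \<in> arrows K \<Longrightarrow> src L (f x) = f (rng K x)"
    and inv: "x \<in> arrows K \<Longrightarrow> ginv L (f x) = f (ginv K x)"
    and mul: "(x, y) \<in> composable K \<Longrightarrow> f y \<odot>\<^bsub>L\<^esub> f x = f (x \<odot> y)"
begin

lemma continuous_f: "continuous_map (arr_top K) (arr_top L) f"
  and continuous_g: "continuous_map (arr_top L) (arr_top K) g"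
  and g_f [simp]: "x \<in> arrows K \<Longrightarrow> g (f x) = x"
  and f_g [simp]: "y \<in> arrows L \<Longrightarrow> f (g y) = y"
  using homeo unfolding homeomorphic_maps_def by auto

lemma f_arrow [simp]: "x \<in> arrows K \<Longrightarrow> f x \<in> arrows L"
  using continuous_map_funspace[OF continuous_f] by blast

lemma g_arrow [simp]: "y \<in> arrows L \<Longrightarrow> g y \<in> arrows K"
  using continuous_map_funspace[OF continuous_g] by blast

lemma arrow_cases:
  assumes "y \<in> arrows L"
  obtains x where "x \<in> arrows K" "y = f x"
  using assms by (metis f_g g_arrow)

lemma f_eq_iff: "x \<in> arrows K \<Longrightarrow> y \<in> arrows K \<Longrightarrow> f x = f y \<longleftrightarrow> x = y"
  by (metis g_f)

lemma lc_groupoid_image: "lc_groupoid L"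
proof -
  note cf = continuous_f and cg = continuous_g and gf = g_f and fg = f_g and inj = f_eq_iff
    and fa = f_arrow and ga = g_arrow
  have ex: "\<exists>x\<in>arrows K. y = f x" if "y \<in> arrows L" for y
    using fg ga that by metis
  have comp: "(f x, f y) \<in> composable L \<longleftrightarrow> (y, x) \<in> composable K"
    if "x \<in> arrows K" "y \<in> arrows K" for x y
    using that by (auto simp: src rng inj fa)
  have f: "homeomorphic_map (arr_top K) (arr_top L) f"
    using homeo homeomorphic_maps_imp_map by blast
  then have hom: "arr_top K homeomorphic_space arr_top L"
    using homeomorphic_map_imp_homeomorphic_space by blast
  show ?thesis
  proof (unfold_locales)
    show "units L \<subseteq> arrows L" using units fa by auto
    show "rng L x \<in> units L" "src L x \<in> units L" "rng L x \<odot>\<^bsub>L\<^esub> x = x" "x \<odot>\<^bsub>L\<^esub> src L x = x"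
      "ginv L x \<in> arrows L" "rng L (ginv L x) = src L x" "src L (ginv L x) = rng L x"
      "x \<odot>\<^bsub>L\<^esub> ginv L x = rng L x" "ginv L x \<odot>\<^bsub>L\<^esub> x = src L x"
      if "x \<in> arrows L" for x
      using ex[OF that]
      by (auto simp: rng src inv units mul fa mul_src_self rng_mul_self mul_inv inv_mul)
    show "rng L u = u" "src L u = u" if "u \<in> units L" for u
      using that by (auto simp: units rng src)
    have c2: "\<exists>x\<in>arrows K. \<exists>y\<in>arrows K. a = f x \<and> b = f y \<and> src K y = rng K x"
      if "(a, b) \<in> composable L" for a b
      using that ex[of a] ex[of b] comp by (metis composable_iff)
    show "x \<odot>\<^bsub>L\<^esub> y \<in> arrows L" "rng L (x \<odot>\<^bsub>L\<^esub> y) = rng L x" "src L (x \<odot>\<^bsub>L\<^esub> y) = src L y"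
      if "(x, y) \<in> composable L" for x y
      using c2[OF that] by (auto simp: mul fa rng src)
    show "x \<odot>\<^bsub>L\<^esub> y \<odot>\<^bsub>L\<^esub> z = x \<odot>\<^bsub>L\<^esub> (y \<odot>\<^bsub>L\<^esub> z)"
      if xy: "(x, y) \<in> composable L" and yz: "(y, z) \<in> composable L" for x y z
    proof -
      obtain a b where ab: "a \<in> arrows K" "b \<in> arrows K" "x = f a" "y = f b" "src K b = rng K a"
        using c2[OF xy] by blast
      obtain c where c: "c \<in> arrows K" "z = f c" using ex[of z] yz by auto
      have "src K c = rng K b" using yz ab c comp by simp
      then show ?thesis using ab c by (simp add: mul mul_assoc')
    qed
    show "continuous_map (subtopology (prod_topology (arr_top L) (arr_top L)) (composable L))
        (arr_top L) (\<lambda>(x, y). x \<odot>\<^bsub>L\<^esub> y)"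
    proof (rule continuous_map_eq)
      let ?T = "subtopology (prod_topology (arr_top L) (arr_top L)) (composable L)"
      have "continuous_map ?T (arr_top K) (\<lambda>p. g (fst p))" "continuous_map ?T (arr_top K) (\<lambda>p. g (snd p))"
        by (intro continuous_map_compose[OF _ cg, unfolded o_def] continuous_map_from_subtopology
            continuous_map_fst continuous_map_snd)+
      moreover have "src K (g (snd p)) = rng K (g (fst p))" if "p \<in> topspace ?T" for p
        using c2[of "fst p" "snd p"] that gf by auto
      ultimately have "continuous_map ?T (arr_top K) (\<lambda>p. g (snd p) \<odot>\<^bsub>K\<^esub> g (fst p))"
        by (intro continuous_map_mul)
      from continuous_map_compose[OF this cf]
      show "continuous_map ?T (arr_top L) (\<lambda>p. f (g (snd p) \<odot>\<^bsub>K\<^esub> g (fst p)))" by (simp add: o_def)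
      show "f (g (snd p) \<odot>\<^bsub>K\<^esub> g (fst p)) = (case p of (x, y) \<Rightarrow> x \<odot>\<^bsub>L\<^esub> y)" if "p \<in> topspace ?T" for p
      proof -
        obtain a b where p: "p = (a, b)" by (cases p)
        with that have "(a, b) \<in> composable L" by simp
        from c2[OF this] p show ?thesis by (auto simp: mul gf)
      qed
    qed
    show "continuous_map (arr_top L) (arr_top L) (ginv L)"
    proof (rule continuous_map_eq)
      show "continuous_map (arr_top L) (arr_top L) (\<lambda>x. f (ginv K (g x)))"
        using continuous_map_compose[OF continuous_map_ginv[OF cg] cf] by (simp add: o_def)
    qed (metis inv fg ga)
    show "locally_compact_space (arr_top L)"
      using hom locally_compact homeomorphic_locally_compact_space by blast
    show "Hausdorff_space (arr_top L)"
      using hom Hausdorff homeomorphic_Hausdorff_space by blast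
    show "second_countable (arr_top L)"
      using second_countable_open_map_image[OF cf] second_countable
        homeomorphic_imp_open_map[OF f] homeomorphic_imp_surjective_map[OF f] by blast
  qed
qed

end

section \<open>Opposite groupoids\<close>

definition opposite :: "'a groupoid \<Rightarrow> 'a groupoid" where
  "opposite K = \<lparr> arr_top = arr_top K, units = units K, rng = src K, src = rng K,
     gmul = (\<lambda>x y. y \<odot>\<^bsub>K\<^esub> x), ginv = ginv K \<rparr>"

lemma opposite_simps [simp]:
  "arr_top (opposite K) = arr_top K" "units (opposite K) = units K"
  "rng (opposite K) = src K" "src (opposite K) = rng K"
  "x \<odot>\<^bsub>opposite K\<^esub> y = y \<odot>\<^bsub>K\<^esub> x" "ginv (opposite K) = ginv K"
  "unit_space (opposite K) = unit_space K"
  by (simp_all add: opposite_def unit_space_def)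

lemma opposite_opposite [simp]: "opposite (opposite K) = K"
  by (simp add: opposite_def)

lemma lc_groupoid_opposite: "lc_groupoid K \<Longrightarrow> lc_groupoid (opposite K)"
  by (rule groupoid_anti_isomorphism.lc_groupoid_image[where f = id and g = id])
    (auto simp: groupoid_anti_isomorphism_def groupoid_anti_isomorphism_axioms_def
      homeomorphic_maps_def continuous_map_id)

lemma open_source_opposite: "lc_groupoid K \<Longrightarrow> open_source K \<Longrightarrow> open_source (opposite K)"
  by (simp add: open_source_def lc_groupoid.open_map_rng)

section \<open>Free and proper actions\<close>

locale lc_left_action = K: lc_groupoid K + left_groupoid_action K Z m act
  for K :: "'k groupoid" and Z :: "'z topology" and m :: "'z \<Rightarrow> 'k" and act :: "'k \<Rightarrow> 'z \<Rightarrow> 'z"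
begin

abbreviation "orbit \<equiv> left_orbit K m act"

lemma topspace_left_pairs: "(k, z) \<in> topspace (left_pairs K Z m) \<longleftrightarrow>
    k \<in> arrows K \<and> z \<in> topspace Z \<and> src K k = m z"
  by (auto simp: left_pairs_def)

lemma act_closed: "k \<in> arrows K \<Longrightarrow> z \<in> topspace Z \<Longrightarrow> src K k = m z \<Longrightarrow> act k z \<in> topspace Z"
  using funcset_mem[OF continuous_map_funspace[OF continuous_act], of "(k, z)"]
  by (simp add: topspace_left_pairs)

lemma momentum_unit: "z \<in> topspace Z \<Longrightarrow> m z \<in> units K"
  using continuous_momentum by (simp add: K.continuous_map_unit_space)

lemma continuous_map_act:
  assumes "continuous_map T (arr_top K) f" "continuous_map T Z g"
    and "\<And>t. t \<in> topspace T \<Longrightarrow> src K (f t) = m (g t)"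
  shows "continuous_map T Z (\<lambda>t. act (f t) (g t))"
proof -
  have "continuous_map T (left_pairs K Z m) (\<lambda>t. (f t, g t))"
    using assms by (auto simp: left_pairs_def continuous_map_in_subtopology intro!: continuous_map_pairedI)
  from continuous_map_compose[OF this continuous_act] show ?thesis by (simp add: o_def)
qed

lemma act_inv_act:
  assumes "k \<in> arrows K" "z \<in> topspace Z" "src K k = m z"
  shows "act (ginv K k) (act k z) = z"
  using assms mul_act[of "ginv K k" k z] unit_act by (simp add: K.inv_mul)

lemma orbit_self: "z \<in> topspace Z \<Longrightarrow> z \<in> orbit z"
  using unit_act[of z] momentum_unit[of z] unfolding left_orbit_def
  by (metis (mono_tags, lifting) K.src_unit K.unit_arrow mem_Collect_eq)

lemma orbit_act_subset:
  assumes "k \<in> arrows K" "z \<in> topspace Z" "src K k = m z"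
  shows "orbit (act k z) \<subseteq> orbit z"
proof
  fix w assume "w \<in> orbit (act k z)"
  then obtain l where l: "l \<in> arrows K" "src K l = m (act k z)" "w = act l (act k z)"
    unfolding left_orbit_def by blast
  then have "w = act (l \<odot>\<^bsub>K\<^esub> k) z" "l \<odot>\<^bsub>K\<^esub> k \<in> arrows K" "src K (l \<odot>\<^bsub>K\<^esub> k) = m z"
    using assms momentum_act[of k z] mul_act[of l k z] by simp_all
  then show "w \<in> orbit z" unfolding left_orbit_def by blast
qed

lemma orbit_act:
  assumes "k \<in> arrows K" "z \<in> topspace Z" "src K k = m z"
  shows "orbit (act k z) = orbit z"
  using orbit_act_subset[OF assms] orbit_act_subset[of "ginv K k" "act k z"]
    act_inv_act[OF assms] act_closed[OF assms] momentum_act[OF assms] assms by auto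

lemma orbit_eq_iff:
  assumes "w \<in> topspace Z" "z \<in> topspace Z"
  shows "orbit w = orbit z \<longleftrightarrow> (\<exists>k\<in>arrows K. src K k = m z \<and> act k z = w)"
proof
  assume "orbit w = orbit z"
  then have "w \<in> orbit z" using orbit_self assms by blast
  then show "\<exists>k\<in>arrows K. src K k = m z \<and> act k z = w" unfolding left_orbit_def by blast
next
  assume "\<exists>k\<in>arrows K. src K k = m z \<and> act k z = w"
  then show "orbit w = orbit z" using orbit_act assms by blast
qed

lemma mem_orbit:
  assumes "z \<in> topspace Z"
  shows "w \<in> orbit z \<longleftrightarrow> w \<in> topspace Z \<and> orbit w = orbit z"
proof
  assume "w \<in> orbit z"
  then obtain k where "k \<in> arrows K" "src K k = m z" "w = act k z" unfolding left_orbit_def by blast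
  then show "w \<in> topspace Z \<and> orbit w = orbit z" using assms act_closed orbit_act by simp
next
  assume "w \<in> topspace Z \<and> orbit w = orbit z"
  then show "w \<in> orbit z" using orbit_self[of w] by simp
qed

lemma on_class_orbit:
  assumes z: "z \<in> topspace Z"
    and inv: "\<And>k. k \<in> arrows K \<Longrightarrow> src K k = m z \<Longrightarrow> f (act k z) = f z"
  shows "on_class f (orbit z) = f z"
proof -
  have "f ` orbit z = {f z}" using orbit_self[OF z] inv by (auto simp: left_orbit_def)
  then show ?thesis by (simp add: on_class_def)
qed

text \<open>If k z lies in \<open>U\<close>, a nearby y needs an arrow l near k with s(l) = m(y).
  Such arrows exist because the source image of a neighbourhood of k is open, and continuity of the
  action keeps l y in \<open>U\<close>; so the saturation of \<open>U\<close> is open.\<close>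

lemma open_map_orbit:
  assumes "open_source K"
  shows "open_map Z (quotient_topology Z orbit) orbit"
  unfolding open_map_def
proof (intro allI impI)
  fix U assume U: "openin Z U"
  let ?S = "{z \<in> topspace Z. orbit z \<in> orbit ` U}"
  have UZ: "U \<subseteq> topspace Z" using U openin_subset by blast
  have S: "z \<in> ?S \<longleftrightarrow> z \<in> topspace Z \<and> (\<exists>k\<in>arrows K. src K k = m z \<and> act k z \<in> U)" for z
  proof
    assume "z \<in> ?S"
    then obtain u where "z \<in> topspace Z" "u \<in> U" "orbit u = orbit z" by auto
    then show "z \<in> topspace Z \<and> (\<exists>k\<in>arrows K. src K k = m z \<and> act k z \<in> U)"
      using orbit_eq_iff[of u z] UZ by blast
  next
    assume "z \<in> topspace Z \<and> (\<exists>k\<in>arrows K. src K k = m z \<and> act k z \<in> U)"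
    then obtain k where k: "z \<in> topspace Z" "act k z \<in> U" "orbit (act k z) = orbit z"
      using orbit_act[of _ z] by auto
    then show "z \<in> ?S" using imageI[OF k(2), of orbit] by simp
  qed
  have "\<exists>N. openin Z N \<and> z \<in> N \<and> N \<subseteq> ?S" if z: "z \<in> ?S" for z
  proof -
    obtain k where k: "z \<in> topspace Z" "k \<in> arrows K" "src K k = m z" "act k z \<in> U"
      using z S[of z] by blast
    have "openin (left_pairs K Z m) {p \<in> topspace (left_pairs K Z m). (case p of (k, z) \<Rightarrow> act k z) \<in> U}"
      using continuous_act U openin_continuous_map_preimage by blast
    then obtain W where W: "openin (prod_topology (arr_top K) Z) W"
      "{p \<in> topspace (left_pairs K Z m). (case p of (k, z) \<Rightarrow> act k z) \<in> U} =
        W \<inter> {(k, z). src K k = m z}"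
      unfolding left_pairs_def openin_subtopology by blast
    have "(k, z) \<in> W \<inter> {(k, z). src K k = m z}"
      unfolding W(2)[symmetric] using k by (simp add: topspace_left_pairs)
    then have "(k, z) \<in> W" by blast
    then obtain A B where AB: "openin (arr_top K) A" "openin Z B" "k \<in> A" "z \<in> B" "A \<times> B \<subseteq> W"
      using W(1) unfolding openin_prod_topology_alt by metis
    \<comment> \<open>The points of \<open>B\<close> on which some arrow of \<open>A\<close> can
      act; that arrow moves them into \<open>U\<close>.\<close>
    let ?N = "{y \<in> topspace Z. m y \<in> src K ` A} \<inter> B"
    have "openin (unit_space K) (src K ` A)"
      using assms AB(1) unfolding open_source_def open_map_def by blast
    then have "openin Z ?N"
      by (intro openin_Int openin_continuous_map_preimage[OF continuous_momentum] AB(2))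
    moreover have "z \<in> ?N" using AB k by (simp add: image_eqI[of "m z" "src K" k])
    moreover have "?N \<subseteq> ?S"
    proof
      fix y assume y: "y \<in> ?N"
      then obtain l where l: "l \<in> A" "src K l = m y" by force
      then have "(l, y) \<in> W \<inter> {(k, z). src K k = m z}" using AB y by auto
      then have "(l, y) \<in> topspace (left_pairs K Z m) \<and> act l y \<in> U" unfolding W(2)[symmetric] by simp
      then show "y \<in> ?S" using S topspace_left_pairs by blast
    qed
    ultimately show ?thesis by blast
  qed
  then have "openin Z ?S" using openin_subopen by meson
  then show "openin (quotient_topology Z orbit) (orbit ` U)"
    using UZ by (auto simp: openin_quotient_topology)
qed

end

text \<open>The arrow carrying \<open>z\<close> to \<open>w\<close>; meaningful for free actions and \<open>w\<close> in the orbit of \<open>z\<close>.\<close>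

definition translator :: "'k groupoid \<Rightarrow> ('z \<Rightarrow> 'k) \<Rightarrow> ('k \<Rightarrow> 'z \<Rightarrow> 'z) \<Rightarrow> 'z \<Rightarrow> 'z \<Rightarrow> 'k" where
  "translator K m act w z = (THE k. k \<in> arrows K \<and> src K k = m z \<and> act k z = w)"

locale free_proper_action = lc_left_action +
  assumes free: "free_left K Z m act" and proper: "proper_left K Z m act"
begin

abbreviation "tr \<equiv> translator K m act"

lemma act_inject:
  assumes "k \<in> arrows K" "l \<in> arrows K" "z \<in> topspace Z" "src K k = m z" "src K l = m z"
    and "act k z = act l z"
  shows "k = l"
proof -
  have r: "rng K k = rng K l" using assms momentum_act by metis
  then have "act (ginv K l \<odot>\<^bsub>K\<^esub> k) z = z"
    using assms mul_act[of "ginv K l" k z] act_inv_act by simp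
  moreover have lk: "ginv K l \<odot>\<^bsub>K\<^esub> k \<in> arrows K" "src K (ginv K l \<odot>\<^bsub>K\<^esub> k) = m z"
    using assms r by simp_all
  ultimately have "ginv K l \<odot>\<^bsub>K\<^esub> k \<in> units K" using free assms(3) unfolding free_left_def by blast
  then have "k = ginv K (ginv K l)" by (intro K.inv_unique) (use assms r in simp_all)
  then show ?thesis using assms by simp
qed

lemma tr_eqI:
  assumes "k \<in> arrows K" "z \<in> topspace Z" "src K k = m z"
  shows "tr (act k z) z = k"
  unfolding translator_def using assms act_inject by blast

lemma tr:
  assumes "w \<in> topspace Z" "z \<in> topspace Z" "orbit w = orbit z"
  shows "tr w z \<in> arrows K" "src K (tr w z) = m z" "act (tr w z) z = w" "rng K (tr w z) = m w"
proof -
  obtain k where "k \<in> arrows K" "src K k = m z" "act k z = w" using orbit_eq_iff assms by blast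
  then show "tr w z \<in> arrows K" "src K (tr w z) = m z" "act (tr w z) z = w" "rng K (tr w z) = m w"
    using tr_eqI[of k z] momentum_act[of k z] assms by auto
qed

text \<open>The map (k, z) to (k z, z) is proper and, by freeness, injective, so it is a closed
  embedding. Its image is the orbit relation, and the first coordinate of its inverse is
  \<open>tr\<close>.\<close>

lemma closedin_orbit_relation:
  "closedin (prod_topology Z Z) {(w, z). w \<in> topspace Z \<and> z \<in> topspace Z \<and> orbit w = orbit z}"
  and continuous_map_tr_relation:
  "continuous_map (subtopology (prod_topology Z Z)
      {(w, z). w \<in> topspace Z \<and> z \<in> topspace Z \<and> orbit w = orbit z}) (arr_top K) (\<lambda>(w, z). tr w z)"
proof -
  let ?f = "\<lambda>(k, z). (act k z, z)"
  let ?P = "left_pairs K Z m"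
  let ?R = "{(w, z). w \<in> topspace Z \<and> z \<in> topspace Z \<and> orbit w = orbit z}"
  have c1: "continuous_map ?P (arr_top K) fst" and c2: "continuous_map ?P Z snd"
    unfolding left_pairs_def by (simp_all add: continuous_map_from_subtopology continuous_map_fst continuous_map_snd)
  have cf: "continuous_map ?P (prod_topology Z Z) ?f"
    unfolding case_prod_unfold
    by (intro continuous_map_pairedI continuous_map_act c1 c2) (auto simp: left_pairs_def)
  have im: "?f ` topspace ?P = ?R"
  proof
    show "?f ` topspace ?P \<subseteq> ?R" using act_closed orbit_act topspace_left_pairs by auto
    show "?R \<subseteq> ?f ` topspace ?P"
    proof clarify
      fix w z assume "w \<in> topspace Z" "z \<in> topspace Z" "orbit w = orbit z"
      then show "(w, z) \<in> ?f ` topspace ?P"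
        using tr[of w z] topspace_left_pairs by (intro image_eqI[of _ _ "(tr w z, z)"]) auto
    qed
  qed
  have inj: "inj_on ?f (topspace ?P)"
    using act_inject topspace_left_pairs by (auto simp: inj_on_def)
  have p: "proper_map ?P (prod_topology Z Z) ?f" using proper unfolding proper_left_def .
  show "closedin (prod_topology Z Z) ?R"
    using proper_map_inverse(1)[OF cf p inj] unfolding im .
  have g: "continuous_map (subtopology (prod_topology Z Z) ?R) ?P (inv_into (topspace ?P) ?f)"
    using proper_map_inverse(2)[OF cf p inj] unfolding im .
  show "continuous_map (subtopology (prod_topology Z Z) ?R) (arr_top K) (\<lambda>(w, z). tr w z)"
  proof (rule continuous_map_eq[OF continuous_map_compose[OF g c1]])
    fix c assume "c \<in> topspace (subtopology (prod_topology Z Z) ?R)"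
    then obtain w z where wz: "c = (w, z)" "w \<in> topspace Z" "z \<in> topspace Z" "orbit w = orbit z"
      by auto
    then have "inv_into (topspace ?P) ?f (?f (tr w z, z)) = (tr w z, z)"
      by (intro inv_into_f_f[OF inj]) (simp add: topspace_left_pairs tr)
    then show "(fst \<circ> inv_into (topspace ?P) ?f) c = (case c of (w, z) \<Rightarrow> tr w z)"
      using wz by (simp add: tr)
  qed
qed

lemma continuous_map_tr:
  assumes "continuous_map T Z f" "continuous_map T Z g"
    and "\<And>t. t \<in> topspace T \<Longrightarrow> orbit (f t) = orbit (g t)"
  shows "continuous_map T (arr_top K) (\<lambda>t. tr (f t) (g t))"
proof -
  have "continuous_map T (subtopology (prod_topology Z Z)
      {(w, z). w \<in> topspace Z \<and> z \<in> topspace Z \<and> orbit w = orbit z}) (\<lambda>t. (f t, g t))"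
    using assms continuous_map_funspace[OF assms(1)] continuous_map_funspace[OF assms(2)]
    by (auto simp: continuous_map_in_subtopology intro!: continuous_map_pairedI)
  from continuous_map_compose[OF this continuous_map_tr_relation] show ?thesis by (simp add: o_def)
qed

lemma Hausdorff_orbit_space:
  "open_source K \<Longrightarrow> Hausdorff_space (quotient_topology Z orbit)"
  by (intro quotient_topology_Hausdorff open_map_orbit closedin_orbit_relation)

end

section \<open>Right actions as left actions of the opposite groupoid\<close>

lemma right_orbit_opposite: "right_orbit L n act = left_orbit (opposite L) n (\<lambda>l z. act z l)"
  by (auto simp: right_orbit_def left_orbit_def fun_eq_iff)

lemma continuous_map_right_pairs_swap:
  assumes "continuous_map (right_pairs Z L n) A f"
  shows "continuous_map (left_pairs (opposite L) Z n) A (\<lambda>(l, z). f (z, l))"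
proof -
  have "continuous_map (left_pairs (opposite L) Z n) (right_pairs Z L n) (\<lambda>p. (snd p, fst p))"
    unfolding left_pairs_def right_pairs_def
    by (auto simp: continuous_map_in_subtopology continuous_map_from_subtopology
        continuous_map_fst continuous_map_snd intro!: continuous_map_pairedI)
  from continuous_map_compose[OF this assms] show ?thesis by (simp add: o_def case_prod_unfold)
qed

lemma free_left_opposite:
  "free_right L Z n act \<Longrightarrow> free_left (opposite L) Z n (\<lambda>l z. act z l)"
  unfolding free_right_def free_left_def by auto

lemma homeomorphic_map_swap_pairs:
  "homeomorphic_map (left_pairs (opposite L) Z n) (right_pairs Z L n) prod.swap"
proof -
  have "homeomorphic_maps (left_pairs (opposite L) Z n) (right_pairs Z L n) prod.swap prod.swap"
    unfolding left_pairs_def right_pairs_def homeomorphic_maps_def prod.swap_def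
    by (auto simp: continuous_map_in_subtopology continuous_map_from_subtopology
        continuous_map_fst continuous_map_snd intro!: continuous_map_pairedI)
  then show ?thesis using homeomorphic_maps_imp_map by blast
qed

lemma proper_left_opposite:
  assumes "proper_right L Z n act"
  shows "proper_left (opposite L) Z n (\<lambda>l z. act z l)"
proof -
  let ?f = "\<lambda>(z, l). (z, act z l)" and ?g = "\<lambda>(l, z). (act z l, z)"
  have "proper_map (left_pairs (opposite L) Z n) (prod_topology Z Z) (prod.swap \<circ> (?f \<circ> prod.swap))"
    using proper_map_swap homeomorphic_imp_proper_map[OF homeomorphic_map_swap_pairs] assms
    unfolding proper_right_def by (intro proper_map_compose)
  moreover have "prod.swap \<circ> (?f \<circ> prod.swap) = ?g" by auto
  ultimately show ?thesis unfolding proper_left_def by simp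
qed

section \<open>Self-similar actions and their product groupoids\<close>

sublocale self_similar_left \<subseteq> space: lc_left_action H "arr_top X" "\<lambda>x. \<rho>0 (rng X x)" act
proof
  show "continuous_map (arr_top X) (unit_space H) (\<lambda>x. \<rho>0 (rng X x))"
    using continuous_map_compose[OF _ continuous_\<rho>0, of "arr_top X" "rng X"]
      X.continuous_map_rng_self by (simp add: o_def X.continuous_map_unit_space)
qed (use continuous_act L1_rho_act L2_act L5 in auto)

context self_similar_left
begin

lemmas act_closed [simp] = space.act_closed

lemma rho_unit [simp]: "u \<in> units X \<Longrightarrow> \<rho>0 u \<in> units H"
  using surj_\<rho>0 by blast

lemma continuous_map_rho:
  assumes "continuous_map T (arr_top X) f" "\<And>z. z \<in> topspace T \<Longrightarrow> f z \<in> units X"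
  shows "continuous_map T (arr_top H) (\<lambda>z. \<rho>0 (f z))"
  using continuous_map_compose[OF _ continuous_\<rho>0, of T f] assms
  by (simp add: o_def X.continuous_map_unit_space H.continuous_map_unit_space)

lemma continuous_map_res:
  assumes "continuous_map T (arr_top H) f" "continuous_map T (arr_top X) g"
    and "\<And>t. t \<in> topspace T \<Longrightarrow> src H (f t) = \<rho>0 (rng X (g t))"
  shows "continuous_map T (arr_top H) (\<lambda>t. f t \<lhd> g t)"
proof -
  have "continuous_map T (left_pairs H (arr_top X) (rho_mom X \<rho>0)) (\<lambda>t. (f t, g t))"
    using assms by (auto simp: left_pairs_def continuous_map_in_subtopology intro!: continuous_map_pairedI)
  from continuous_map_compose[OF this continuous_res] show ?thesis by (simp add: o_def)
qed

lemma res_closed [simp]: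
  "h \<in> arrows H \<Longrightarrow> x \<in> arrows X \<Longrightarrow> src H h = \<rho>0 (rng X x) \<Longrightarrow> h \<lhd> x \<in> arrows H"
  using funcset_mem[OF continuous_map_funspace[OF continuous_res], of "(h, x)"]
  by (simp add: space.topspace_left_pairs)

lemma src_res [simp]:
  "h \<in> arrows H \<Longrightarrow> x \<in> arrows X \<Longrightarrow> src H h = \<rho>0 (rng X x) \<Longrightarrow> src H (h \<lhd> x) = \<rho>0 (src X x)"
  by (simp add: L1_src_res)

lemma res_unit [simp]:
  "h \<in> arrows H \<Longrightarrow> u \<in> units X \<Longrightarrow> src H h = \<rho>0 u \<Longrightarrow> h \<lhd> u = h"
  by (simp add: L2_res)

text \<open>Apply (L4) to u = u u: as h \<lhd> u = h, the element h \<rhd> u is idempotent.\<close>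

lemma act_unit [simp]:
  assumes "h \<in> arrows H" "u \<in> units X" "src H h = \<rho>0 u"
  shows "h \<rhd> u \<in> units X"
proof (rule X.idempotent_unit)
  show "src X (h \<rhd> u) = rng X (h \<rhd> u)" using src_act[of h u u] assms by simp
  show "(h \<rhd> u) \<odot>\<^bsub>X\<^esub> (h \<rhd> u) = h \<rhd> u" using L4[of h u u] assms by (simp add: X.unit_mul)
qed (use assms in simp)

text \<open>This is \<open>src_act\<close> for the pair (r(x), x), where h \<lhd> r(x) = h; the next
  lemma uses the pair (x, s(x)).\<close>

lemma rng_act [simp]:
  assumes "h \<in> arrows H" "x \<in> arrows X" "src H h = \<rho>0 (rng X x)"
  shows "rng X (h \<rhd> x) = h \<rhd> rng X x"
  using src_act[of h "rng X x" x] assms by simp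

lemma src_act_eq [simp]:
  assumes "h \<in> arrows H" "x \<in> arrows X" "src H h = \<rho>0 (rng X x)"
  shows "src X (h \<rhd> x) = (h \<lhd> x) \<rhd> src X x"
  using src_act[of h x "src X x"] assms by simp

lemma rho_act [simp]:
  "h \<in> arrows H \<Longrightarrow> u \<in> units X \<Longrightarrow> src H h = \<rho>0 u \<Longrightarrow> \<rho>0 (h \<rhd> u) = rng H h"
  using L1_rho_act[of h u] by simp

lemma unit_act [simp]: "x \<in> arrows X \<Longrightarrow> u = \<rho>0 (rng X x) \<Longrightarrow> u \<rhd> x = x"
  by (simp add: L2_act)

text \<open>(L6) for u = u u makes u \<lhd> x idempotent, because u \<rhd> x = x.\<close>

lemma unit_res [simp]:
  assumes "x \<in> arrows X" "u = \<rho>0 (rng X x)"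
  shows "u \<lhd> x = \<rho>0 (src X x)"
proof -
  have u: "u \<in> units H" using assms by simp
  have r: "rng H (u \<lhd> x) = \<rho>0 (src X x)" using L1_rng_res[of u x] assms u by simp
  have "u \<lhd> x \<in> units H"
    by (rule H.idempotent_unit) (use L6[of u u x] assms u r in \<open>simp_all add: H.unit_mul\<close>)
  then show ?thesis using r by simp
qed

lemma mul_act':
  "h \<in> arrows H \<Longrightarrow> k \<in> arrows H \<Longrightarrow> src H h = rng H k \<Longrightarrow> x \<in> arrows X \<Longrightarrow>
    src H k = \<rho>0 (rng X x) \<Longrightarrow> (h \<odot>\<^bsub>H\<^esub> k) \<rhd> x = h \<rhd> (k \<rhd> x)"
  and mul_res:
  "h \<in> arrows H \<Longrightarrow> k \<in> arrows H \<Longrightarrow> src H h = rng H k \<Longrightarrow> x \<in> arrows X \<Longrightarrow>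
    src H k = \<rho>0 (rng X x) \<Longrightarrow> (h \<odot>\<^bsub>H\<^esub> k) \<lhd> x = (h \<lhd> (k \<rhd> x)) \<odot>\<^bsub>H\<^esub> (k \<lhd> x)"
  and act_mul:
  "h \<in> arrows H \<Longrightarrow> x \<in> arrows X \<Longrightarrow> y \<in> arrows X \<Longrightarrow> src X x = rng X y \<Longrightarrow>
    src H h = \<rho>0 (rng X x) \<Longrightarrow> h \<rhd> (x \<odot>\<^bsub>X\<^esub> y) = (h \<rhd> x) \<odot>\<^bsub>X\<^esub> ((h \<lhd> x) \<rhd> y)"
  and res_mul:
  "h \<in> arrows H \<Longrightarrow> x \<in> arrows X \<Longrightarrow> y \<in> arrows X \<Longrightarrow> src X x = rng X y \<Longrightarrow>
    src H h = \<rho>0 (rng X x) \<Longrightarrow> h \<lhd> (x \<odot>\<^bsub>X\<^esub> y) = (h \<lhd> x) \<lhd> y"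
  by (simp_all add: L3 L4 L5 L6)

lemma act_ginv_cancel [simp]:
  "h \<in> arrows H \<Longrightarrow> x \<in> arrows X \<Longrightarrow> rng H h = \<rho>0 (rng X x) \<Longrightarrow> h \<rhd> (ginv H h \<rhd> x) = x"
  "h \<in> arrows H \<Longrightarrow> x \<in> arrows X \<Longrightarrow> src H h = \<rho>0 (rng X x) \<Longrightarrow> ginv H h \<rhd> (h \<rhd> x) = x"
  using mul_act'[of h "ginv H h" x] mul_act'[of "ginv H h" h x] by (simp_all add: H.mul_inv H.inv_mul)

section \<open>The self-similar product groupoid\<close>

abbreviation "prd \<equiv> left_product X H \<rho>0 act res"

lemma left_product_arrows [simp]:
  "(x, h) \<in> arrows prd \<longleftrightarrow> x \<in> arrows X \<and> h \<in> arrows H \<and> \<rho>0 (src X x) = rng H h"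
  by (auto simp: left_product_def)

lemma left_product_simps:
  "units prd = (\<lambda>u. (u, \<rho>0 u)) ` units X"
  "rng prd (x, h) = (rng X x, \<rho>0 (rng X x))"
  "src prd (x, h) = (ginv H h \<rhd> src X x, \<rho>0 (ginv H h \<rhd> src X x))"
  "(x, h) \<odot>\<^bsub>prd\<^esub> (y, k) = (x \<odot>\<^bsub>X\<^esub> (h \<rhd> y), (h \<lhd> y) \<odot>\<^bsub>H\<^esub> k)"
  "ginv prd (x, h) = (ginv H h \<rhd> ginv X x, ginv H h \<lhd> ginv X x)"
  by (simp_all add: left_product_def Let_def)

text \<open>The source in the product is written with h\<inverse>; applying h to r(y) = h\<inverse>
  \<rhd> s(x) gives the usual condition for composability.\<close>

lemma left_product_composable:
  assumes "x \<in> arrows X" "h \<in> arrows H" "\<rho>0 (src X x) = rng H h" "y \<in> arrows X" "k \<in> arrows H"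
    "\<rho>0 (src X y) = rng H k" and eq: "src prd (x, h) = rng prd (y, k)"
  shows "src H h = \<rho>0 (rng X y)" "src X x = h \<rhd> rng X y"
proof -
  have *: "rng X y = ginv H h \<rhd> src X x" using eq by (simp add: left_product_simps)
  show "src H h = \<rho>0 (rng X y)" "src X x = h \<rhd> rng X y" unfolding * using assms(1-3) by simp_all
qed

lemma left_product_arr_top:
  "arr_top prd = subtopology (prod_topology (arr_top X) (arr_top H)) (arrows prd)"
  by (simp add: left_product_def flip: topspace_prod_topology) (simp only: subtopology_restrict)

lemma continuous_map_into_left_product:
  "continuous_map T (arr_top prd) f \<longleftrightarrow> continuous_map T (arr_top X) (\<lambda>z. fst (f z)) \<and>
     continuous_map T (arr_top H) (\<lambda>z. snd (f z)) \<and> (\<forall>z\<in>topspace T. f z \<in> arrows prd)"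
  by (subst left_product_arr_top)
    (auto simp: continuous_map_in_subtopology continuous_map_pairwise o_def)

lemma lc_groupoid_left_product: "lc_groupoid prd"
proof
  have unit: "(u, \<rho>0 u) \<in> units prd" if "u \<in> units X" for u
    using that by (simp add: left_product_simps)
  show "units prd \<subseteq> arrows prd" by (auto simp: left_product_simps)
  fix p q r :: "'x \<times> 'h"
  obtain x h y k z l where pqr: "p = (x, h)" "q = (y, k)" "r = (z, l)" by (metis prod.collapse)
  { assume "p \<in> arrows prd"
    then have a: "x \<in> arrows X" "h \<in> arrows H" "\<rho>0 (src X x) = rng H h" using pqr by simp_all
    show "rng prd p \<in> units prd" "src prd p \<in> units prd"
      unfolding pqr left_product_simps(2,3) by (intro unit; use a in simp)+
    \<comment> \<open>The entries of the products of (x, h) with its inverse: (L6) for h h\<inverse>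
      at x\<inverse>, then (L4) and (L3) for x\<inverse> x.\<close>
    have f1: "(h \<lhd> (ginv H h \<rhd> ginv X x)) \<odot>\<^bsub>H\<^esub> (ginv H h \<lhd> ginv X x) = \<rho>0 (rng X x)"
      using mul_res[of h "ginv H h" "ginv X x", symmetric] a by (simp add: H.mul_inv)
    have f2: "(ginv H h \<rhd> ginv X x) \<odot>\<^bsub>X\<^esub> ((ginv H h \<lhd> ginv X x) \<rhd> x) = ginv H h \<rhd> src X x"
      using act_mul[of "ginv H h" "ginv X x" x, symmetric] a by (simp add: X.inv_mul)
    have f3: "(ginv H h \<lhd> ginv X x) \<lhd> x = ginv H h"
      using res_mul[of "ginv H h" "ginv X x" x, symmetric] a by (simp add: X.inv_mul)
    show "ginv prd p \<in> arrows prd" using a by (simp add: pqr left_product_simps)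
    show "rng prd p \<odot>\<^bsub>prd\<^esub> p = p" "p \<odot>\<^bsub>prd\<^esub> src prd p = p"
      using a by (simp_all add: pqr left_product_simps H.unit_mul X.unit_mul H.mul_unit X.mul_unit)
    show "rng prd (ginv prd p) = src prd p" "src prd (ginv prd p) = rng prd p"
      using a by (simp_all add: pqr left_product_simps)
    show "p \<odot>\<^bsub>prd\<^esub> ginv prd p = rng prd p" "ginv prd p \<odot>\<^bsub>prd\<^esub> p = src prd p"
      using a by (simp_all add: pqr left_product_simps X.mul_inv H.inv_mul f1 f2 f3) }
  { assume "p \<in> units prd"
    then show "rng prd p = p" "src prd p = p" by (auto simp: left_product_simps) }
  { assume "(p, q) \<in> composable prd"
    then have a: "x \<in> arrows X" "h \<in> arrows H" "\<rho>0 (src X x) = rng H h"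
      and b: "y \<in> arrows X" "k \<in> arrows H" "\<rho>0 (src X y) = rng H k"
      and c: "src H h = \<rho>0 (rng X y)" "src X x = h \<rhd> rng X y"
      unfolding pqr composable_iff using left_product_composable by auto
    show "p \<odot>\<^bsub>prd\<^esub> q \<in> arrows prd" "rng prd (p \<odot>\<^bsub>prd\<^esub> q) = rng prd p"
      using a b c by (simp_all add: pqr left_product_simps)
    have "ginv H ((h \<lhd> y) \<odot>\<^bsub>H\<^esub> k) \<rhd> ((h \<lhd> y) \<rhd> src X y) = ginv H k \<rhd> src X y"
    proof -
      \<comment> \<open>Cancellation replaces expanding the inverse of a product: \<open>?g\<close>
        carries \<open>?u\<close> to (h \<lhd> y) \<rhd> s(y), so its inverse carries that point
        back.\<close>
      let ?g = "(h \<lhd> y) \<odot>\<^bsub>H\<^esub> k" and ?u = "ginv H k \<rhd> src X y"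
      have "?g \<rhd> ?u = (h \<lhd> y) \<rhd> src X y" using b c a by (simp add: mul_act')
      moreover have "ginv H ?g \<rhd> (?g \<rhd> ?u) = ?u" by (rule act_ginv_cancel) (use a b c in simp_all)
      ultimately show ?thesis by simp
    qed
    then show "src prd (p \<odot>\<^bsub>prd\<^esub> q) = src prd q"
      using a b c by (simp add: pqr left_product_simps)
    assume "(q, r) \<in> composable prd"
    then have d: "z \<in> arrows X" "l \<in> arrows H" "\<rho>0 (src X z) = rng H l"
      and e: "src H k = \<rho>0 (rng X z)" "src X y = k \<rhd> rng X z"
      unfolding pqr composable_iff using left_product_composable by auto
    show "p \<odot>\<^bsub>prd\<^esub> q \<odot>\<^bsub>prd\<^esub> r = p \<odot>\<^bsub>prd\<^esub> (q \<odot>\<^bsub>prd\<^esub> r)"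
      using a b c d e
      by (simp add: pqr left_product_simps X.mul_assoc' H.mul_assoc' act_mul res_mul mul_act' mul_res) }
next
  let ?A = "arr_top prd"
  have fs: "continuous_map ?A (arr_top X) fst" "continuous_map ?A (arr_top H) snd"
    by (subst left_product_arr_top; simp add: continuous_map_from_subtopology continuous_map_fst continuous_map_snd)+
  let ?T = "subtopology (prod_topology ?A ?A) (composable prd)"
  have c1: "continuous_map ?T ?A fst" "continuous_map ?T ?A snd"
    by (simp_all add: continuous_map_from_subtopology continuous_map_fst continuous_map_snd)
  have c2: "continuous_map ?T (arr_top X) (\<lambda>p. fst (fst p))" "continuous_map ?T (arr_top H) (\<lambda>p. snd (fst p))"
    "continuous_map ?T (arr_top X) (\<lambda>p. fst (snd p))" "continuous_map ?T (arr_top H) (\<lambda>p. snd (snd p))"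
    using c1[THEN continuous_map_compose, OF fs(1)] c1[THEN continuous_map_compose, OF fs(2)]
    by (simp_all add: o_def)
  have T: "fst (fst p) \<in> arrows X \<and> snd (fst p) \<in> arrows H \<and> fst (snd p) \<in> arrows X \<and>
      snd (snd p) \<in> arrows H \<and> \<rho>0 (src X (fst (fst p))) = rng H (snd (fst p)) \<and>
      \<rho>0 (src X (fst (snd p))) = rng H (snd (snd p)) \<and> src H (snd (fst p)) = \<rho>0 (rng X (fst (snd p))) \<and>
      src X (fst (fst p)) = snd (fst p) \<rhd> rng X (fst (snd p))" if "p \<in> topspace ?T" for p
    using that left_product_composable by (cases p) auto
  show "continuous_map ?T ?A (\<lambda>(x, y). x \<odot>\<^bsub>prd\<^esub> y)"
  proof (rule continuous_map_eq)
    show "continuous_map ?T ?A (\<lambda>p. (fst (fst p) \<odot>\<^bsub>X\<^esub> (snd (fst p) \<rhd> fst (snd p)),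
        (snd (fst p) \<lhd> fst (snd p)) \<odot>\<^bsub>H\<^esub> snd (snd p)))"
      unfolding continuous_map_into_left_product fst_conv snd_conv
      by (intro conjI ballI X.continuous_map_mul H.continuous_map_mul space.continuous_map_act
          continuous_map_res c2) (use T in simp_all)
  qed (auto simp: left_product_simps)
  show "continuous_map ?A ?A (ginv prd)"
  proof (rule continuous_map_eq)
    show "continuous_map ?A ?A (\<lambda>p. (ginv H (snd p) \<rhd> ginv X (fst p), ginv H (snd p) \<lhd> ginv X (fst p)))"
      unfolding continuous_map_into_left_product fst_conv snd_conv
      by (intro conjI ballI X.continuous_map_ginv H.continuous_map_ginv space.continuous_map_act
          continuous_map_res fs) auto
  qed (auto simp: left_product_simps)
  show "Hausdorff_space ?A"
    by (subst left_product_arr_top)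
      (simp add: Hausdorff_space_subtopology Hausdorff_space_prod_topology H.Hausdorff X.Hausdorff)
  show "second_countable ?A"
    by (subst left_product_arr_top)
      (simp add: second_countable_subtopology second_countable_prod_topology H.second_countable X.second_countable)
  \<comment> \<open>Local compactness passes to closed subspaces, and the arrows of the product form
    the equaliser of two continuous maps into the Hausdorff space of arrows of
    \<open>H\<close>.\<close>
  have "continuous_map (prod_topology (arr_top X) (arr_top H)) (arr_top H) (\<lambda>p. \<rho>0 (src X (fst p)))"
    "continuous_map (prod_topology (arr_top X) (arr_top H)) (arr_top H) (\<lambda>p. rng H (snd p))"
    by (intro continuous_map_rho X.continuous_map_src H.continuous_map_rng continuous_map_fst
        continuous_map_snd; auto)+
  from closedin_continuous_maps_eq[OF H.Hausdorff this]
  have "closedin (prod_topology (arr_top X) (arr_top H)) (arrows prd)"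
    by (rule back_subst[of "closedin _"]) auto
  then show "locally_compact_space ?A"
    by (subst left_product_arr_top)
      (simp add: locally_compact_space_closed_subset locally_compact_space_prod_topology
        H.locally_compact X.locally_compact)
qed

end

context self_similar_left
begin

text \<open>By (L4) the two factors multiply to h \<rhd> (x x\<inverse>), the image of a unit, and
  inverses are unique.\<close>

lemma ginv_act:
  assumes "h \<in> arrows H" "x \<in> arrows X" "src H h = \<rho>0 (rng X x)"
  shows "ginv X (h \<rhd> x) = (h \<lhd> x) \<rhd> ginv X x"
proof (rule X.inv_unique[symmetric])
  have "(h \<rhd> x) \<odot>\<^bsub>X\<^esub> ((h \<lhd> x) \<rhd> ginv X x) = h \<rhd> rng X x"
    using act_mul[of h x "ginv X x", symmetric] assms by (simp add: X.mul_inv)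
  then show "(h \<rhd> x) \<odot>\<^bsub>X\<^esub> ((h \<lhd> x) \<rhd> ginv X x) \<in> units X" using assms by simp
qed (use assms in simp_all)

lemma homeomorphic_map_left_product_units:
  "homeomorphic_map (unit_space X) (unit_space prd) (\<lambda>u. (u, \<rho>0 u))"
proof (rule homeomorphic_maps_imp_map)
  have id: "continuous_map (unit_space X) (arr_top X) (\<lambda>u. u)"
    by (simp add: unit_space_def continuous_map_from_subtopology)
  have c: "continuous_map (unit_space X) (arr_top prd) (\<lambda>u. (u, \<rho>0 u))"
    unfolding continuous_map_into_left_product fst_conv snd_conv
    by (intro conjI ballI id continuous_map_rho) auto
  have d: "continuous_map (unit_space prd) (arr_top X) fst"
    unfolding unit_space_def
    by (subst left_product_arr_top) (simp add: continuous_map_from_subtopology continuous_map_fst)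
  show "homeomorphic_maps (unit_space X) (unit_space prd) (\<lambda>u. (u, \<rho>0 u)) fst"
    unfolding homeomorphic_maps_def
    by (intro conjI) (use c d in \<open>auto simp: X.continuous_map_unit_space left_product_simps
      unit_space_def continuous_map_in_subtopology\<close>)
qed

end

text \<open>Reversing both groupoids turns (R3) to (R6) into (L3) to (L6), because the order of both
  multiplications flips. The source of \<open>X\<close> becomes the range of
  \<open>opposite X\<close>, so the momentum map \<sigma> takes the form required of \<rho>.\<close>

lemma self_similar_left_opposite:
  assumes "self_similar_right G X \<sigma>0 ra rr"
  shows "self_similar_left (opposite G) (opposite X) \<sigma>0 (\<lambda>t x. ra x t) (\<lambda>t x. rr x t)"
proof -
  interpret self_similar_right G X \<sigma>0 ra rr by fact
  interpret G': lc_groupoid "opposite G" by (rule lc_groupoid_opposite) unfold_locales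
  interpret X': lc_groupoid "opposite X" by (rule lc_groupoid_opposite) unfold_locales
  have rp: "left_pairs (opposite G) (arr_top (opposite X)) (rho_mom (opposite X) \<sigma>0) =
      left_pairs (opposite G) (arr_top X) (sigma_mom X \<sigma>0)" by simp
  show ?thesis
  proof
    show "continuous_map (left_pairs (opposite G) (arr_top (opposite X)) (rho_mom (opposite X) \<sigma>0))
        (arr_top (opposite X)) (\<lambda>(t, x). ra x t)"
      using continuous_map_right_pairs_swap[OF continuous_act] by simp
    show "continuous_map (left_pairs (opposite G) (arr_top (opposite X)) (rho_mom (opposite X) \<sigma>0))
        (arr_top (opposite G)) (\<lambda>(t, x). rr x t)"
      using continuous_map_right_pairs_swap[OF continuous_res] by simp
  qed (use continuous_\<sigma>0 surj_\<sigma>0 R1_sigma_act R1_rng_res R1_src_res R2_res R2_act src_act R3 R4 R5 R6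
      in \<open>simp_all add: eq_commute[of "rng G _"]\<close>)
qed

section \<open>The quotient groupoid\<close>

lemma quotient_groupoid_opposite:
  "quotient_groupoid (opposite X) q = opposite (quotient_groupoid X q)"
proof -
  have "{q (y \<odot>\<^bsub>X\<^esub> x) |x y. x \<in> \<xi> \<and> y \<in> \<eta> \<and> rng X x = src X y} =
      {q (x \<odot>\<^bsub>X\<^esub> y) |x y. x \<in> \<eta> \<and> y \<in> \<xi> \<and> src X x = rng X y}" for \<xi> \<eta>
    by (auto; metis)
  then show ?thesis by (simp add: quotient_groupoid_def opposite_def)
qed

locale quotient_action = self_similar_left H X \<rho>0 act res
  for H :: "'h groupoid" and X :: "'x groupoid" and \<rho>0 :: "'x \<Rightarrow> 'h"
    and act :: "'h \<Rightarrow> 'x \<Rightarrow> 'x" (infixr "\<rhd>" 75)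
    and res :: "'h \<Rightarrow> 'x \<Rightarrow> 'h" (infixl "\<lhd>" 75) +
  assumes free: "free_left H (arr_top X) (rho_mom X \<rho>0) act"
    and proper: "proper_left H (arr_top X) (rho_mom X \<rho>0) act"
    and open_H: "open_source H"

sublocale quotient_action \<subseteq> space: free_proper_action H "arr_top X" "\<lambda>x. \<rho>0 (rng X x)" act
  by unfold_locales (use free proper in auto)

context quotient_action
begin

abbreviation "p \<equiv> space.orbit"
abbreviation "Q \<equiv> quotient_groupoid X p"

lemmas p_act [simp] = space.orbit_act

lemma p_self [simp]: "x \<in> arrows X \<Longrightarrow> x \<in> p x"
  by (simp add: space.orbit_self)

lemma p_eqE:
  assumes "p x = p y" "x \<in> arrows X" "y \<in> arrows X"
  obtains h where "h \<in> arrows H" "src H h = \<rho>0 (rng X y)" "x = h \<rhd> y"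
  using assms space.orbit_eq_iff[of x y] by auto

text \<open>A translate h \<rhd> y has range h \<rhd> r(y), source (h \<lhd> y) \<rhd> s(y) and
  inverse (h \<lhd> y) \<rhd> y\<inverse>, each a translate of the corresponding element for
  y.\<close>

lemma p_rng_src:
  assumes "p x = p y" "x \<in> arrows X" "y \<in> arrows X"
  shows "p (rng X x) = p (rng X y)" "p (src X x) = p (src X y)" "p (ginv X x) = p (ginv X y)"
proof -
  obtain h where "h \<in> arrows H" "src H h = \<rho>0 (rng X y)" "x = h \<rhd> y" using p_eqE[OF assms] .
  then show "p (rng X x) = p (rng X y)" "p (src X x) = p (src X y)" "p (ginv X x) = p (ginv X y)"
    using assms by (simp_all add: ginv_act)
qed

text \<open>The member of the class of z that y can be multiplied with: the arrow taking r(z) to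
  s(y) also moves z. Using the translator instead of a choice in the class gives continuity in y and
  z.\<close>

definition match :: "'x \<Rightarrow> 'x \<Rightarrow> 'x" where
  "match y z = space.tr (src X y) (rng X z) \<rhd> z"

lemma match:
  assumes "y \<in> arrows X" "z \<in> arrows X" "p (src X y) = p (rng X z)"
  shows "match y z \<in> arrows X" "rng X (match y z) = src X y" "p (match y z) = p z"
  using space.tr[of "src X y" "rng X z"] assms by (simp_all add: match_def)

text \<open>The arrow taking y to x fixes the unit r(y), so it is a unit by freeness.\<close>

lemma match_unique:
  assumes "p x = p y" "x \<in> arrows X" "y \<in> arrows X" "rng X x = rng X y"
  shows "x = y"
proof -
  obtain h where h: "h \<in> arrows H" "src H h = \<rho>0 (rng X y)" "x = h \<rhd> y"
    using p_eqE assms by metis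
  then have "h \<rhd> rng X y = rng X y" using assms by simp
  then have "h \<in> units H" using free[unfolded free_left_def, rule_format, of h "rng X y"] h assms by simp
  then show ?thesis using h assms by simp
qed

lemma continuous_map_match:
  assumes "continuous_map T (arr_top X) f" "continuous_map T (arr_top X) g"
    and "\<And>t. t \<in> topspace T \<Longrightarrow> p (src X (f t)) = p (rng X (g t))"
  shows "continuous_map T (arr_top X) (\<lambda>t. match (f t) (g t))"
  unfolding match_def
proof (rule space.continuous_map_act)
  have fg: "f t \<in> arrows X" "g t \<in> arrows X" if "t \<in> topspace T" for t
    using that assms(1,2) continuous_map_funspace by blast+
  show "continuous_map T (arr_top H) (\<lambda>t. space.tr (src X (f t)) (rng X (g t)))"
    by (intro space.continuous_map_tr X.continuous_map_src X.continuous_map_rng assms)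
  show "src H (space.tr (src X (f t)) (rng X (g t))) = \<rho>0 (rng X (g t))" if "t \<in> topspace T" for t
    using space.tr(2)[of "src X (f t)" "rng X (g t)"] fg[OF that] assms(3)[OF that] by simp
qed fact

text \<open>If x' = h \<rhd> x, then y' and (h \<lhd> x) \<rhd> y lie in one orbit and have the same
  range s(x'), so they coincide; (L4) then exhibits x' y' as h \<rhd> (x y).\<close>

lemma p_mul:
  assumes "p x = p x'" "p y = p y'" "src X x = rng X y" "src X x' = rng X y'"
    and a: "x \<in> arrows X" "y \<in> arrows X" "x' \<in> arrows X" "y' \<in> arrows X"
  shows "p (x' \<odot>\<^bsub>X\<^esub> y') = p (x \<odot>\<^bsub>X\<^esub> y)"
proof -
  obtain h where h: "h \<in> arrows H" "src H h = \<rho>0 (rng X x)" "x' = h \<rhd> x"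
    using p_eqE[OF assms(1)[symmetric]] a by metis
  have "y' = (h \<lhd> x) \<rhd> y"
    by (rule match_unique) (use assms h in simp_all)
  then have "x' \<odot>\<^bsub>X\<^esub> y' = h \<rhd> (x \<odot>\<^bsub>X\<^esub> y)" using h assms by (simp add: act_mul)
  then show ?thesis using h assms by simp
qed

lemma quotient_simps:
  assumes "x \<in> arrows X"
  shows "rng Q (p x) = p (rng X x)" "src Q (p x) = p (src X x)" "ginv Q (p x) = p (ginv X x)"
proof -
  show "rng Q (p x) = p (rng X x)" "src Q (p x) = p (src X x)" "ginv Q (p x) = p (ginv X x)"
    unfolding quotient_groupoid_def groupoid.simps
    by (rule space.on_class_orbit[OF assms], rule p_rng_src; use assms in simp)+
qed

lemma quotient_mul:
  assumes "x \<in> arrows X" "y \<in> arrows X" "src X x = rng X y"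
  shows "p x \<odot>\<^bsub>Q\<^esub> p y = p (x \<odot>\<^bsub>X\<^esub> y)"
proof -
  have "p (u \<odot>\<^bsub>X\<^esub> v) = p (x \<odot>\<^bsub>X\<^esub> y)" if "u \<in> p x" "v \<in> p y" "src X u = rng X v" for u v
    using that assms by (intro p_mul) (auto simp: space.mem_orbit)
  then have "{p (u \<odot>\<^bsub>X\<^esub> v) |u v. u \<in> p x \<and> v \<in> p y \<and> src X u = rng X v} = {p (x \<odot>\<^bsub>X\<^esub> y)}"
    using assms p_self[of x] p_self[of y] by blast
  then show ?thesis by (simp add: quotient_groupoid_def)
qed

lemma quotient_arr_top: "arr_top Q = quotient_topology (arr_top X) p"
  and quotient_units: "units Q = p ` units X"
  by (simp_all add: quotient_groupoid_def)

lemma open_map_p: "open_map (arr_top X) (arr_top Q) p"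
  unfolding quotient_arr_top by (rule space.open_map_orbit[OF open_H])

lemma quotient_map_p: "quotient_map (arr_top X) (arr_top Q) p"
  unfolding quotient_arr_top by (rule quotient_map_quotient_topology)

lemma continuous_map_p: "continuous_map T (arr_top X) f \<Longrightarrow> continuous_map T (arr_top Q) (\<lambda>t. p (f t))"
  using continuous_map_compose[OF _ quotient_imp_continuous_map[OF quotient_map_p]] by (simp add: o_def)

lemma quotient_arrows: "arrows Q = p ` arrows X"
  by (simp add: quotient_arr_top)

lemma p_closed [simp]: "x \<in> arrows X \<Longrightarrow> p x \<in> arrows Q"
  by (simp add: quotient_arrows)

text \<open>Keeping the left representative fixed lets a chain of classes be lifted one factor at a
  time, as associativity requires.\<close>

lemma quotient_composable:
  assumes "x \<in> arrows X" "\<eta> \<in> arrows Q" "p (src X x) = rng Q \<eta>"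
  obtains y where "y \<in> arrows X" "\<eta> = p y" "src X x = rng X y"
proof -
  obtain z where z: "z \<in> arrows X" "\<eta> = p z" using assms quotient_arrows by auto
  then have "p (src X x) = p (rng X z)" using assms(3) by (simp add: quotient_simps)
  from match[OF assms(1) z(1) this] show ?thesis using z by (intro that[of "match x z"]) simp_all
qed

lemma lc_groupoid_quotient: "lc_groupoid Q"
proof
  show "units Q \<subseteq> arrows Q" by (auto simp: quotient_units)
  { fix \<xi> assume "\<xi> \<in> arrows Q"
    then obtain x where x: "x \<in> arrows X" "\<xi> = p x" using quotient_arrows by auto
    show "rng Q \<xi> \<in> units Q" "src Q \<xi> \<in> units Q" "ginv Q \<xi> \<in> arrows Q"
      "rng Q (ginv Q \<xi>) = src Q \<xi>" "src Q (ginv Q \<xi>) = rng Q \<xi>"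
      using x by (simp_all add: quotient_simps quotient_units)
    show "rng Q \<xi> \<odot>\<^bsub>Q\<^esub> \<xi> = \<xi>" "\<xi> \<odot>\<^bsub>Q\<^esub> src Q \<xi> = \<xi>" "\<xi> \<odot>\<^bsub>Q\<^esub> ginv Q \<xi> = rng Q \<xi>"
      "ginv Q \<xi> \<odot>\<^bsub>Q\<^esub> \<xi> = src Q \<xi>"
      using x by (simp_all add: quotient_simps quotient_mul X.mul_inv X.inv_mul X.unit_mul X.mul_unit) }
  show "rng Q \<xi> = \<xi>" "src Q \<xi> = \<xi>" if "\<xi> \<in> units Q" for \<xi>
    using that by (auto simp: quotient_units quotient_simps)
  { fix \<xi> \<eta> assume "(\<xi>, \<eta>) \<in> composable Q"
    then have c: "\<xi> \<in> arrows Q" "\<eta> \<in> arrows Q" "src Q \<xi> = rng Q \<eta>" by auto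
    then obtain x where x: "x \<in> arrows X" "\<xi> = p x" using quotient_arrows by auto
    then have "p (src X x) = rng Q \<eta>" using c by (simp add: quotient_simps)
    then obtain y where y: "y \<in> arrows X" "\<eta> = p y" "src X x = rng X y"
      using quotient_composable x c by metis
    show "\<xi> \<odot>\<^bsub>Q\<^esub> \<eta> \<in> arrows Q" "rng Q (\<xi> \<odot>\<^bsub>Q\<^esub> \<eta>) = rng Q \<xi>" "src Q (\<xi> \<odot>\<^bsub>Q\<^esub> \<eta>) = src Q \<eta>"
      using x y by (simp_all add: quotient_mul quotient_simps)
    fix \<zeta> assume "(\<eta>, \<zeta>) \<in> composable Q"
    then have "\<zeta> \<in> arrows Q" "p (src X y) = rng Q \<zeta>" using y by (auto simp: quotient_simps)
    then obtain z where z: "z \<in> arrows X" "\<zeta> = p z" "src X y = rng X z"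
      using quotient_composable y by metis
    show "\<xi> \<odot>\<^bsub>Q\<^esub> \<eta> \<odot>\<^bsub>Q\<^esub> \<zeta> = \<xi> \<odot>\<^bsub>Q\<^esub> (\<eta> \<odot>\<^bsub>Q\<^esub> \<zeta>)"
      using x y z by (simp add: quotient_mul X.mul_assoc') }
  \<comment> \<open>The preimage of the composable pairs of \<open>Q\<close> asks only that s(x) and
    r(y) have the same class; \<open>match\<close> corrects the second factor before
    multiplying.\<close>
  let ?S = "{(x, y). p (src X x) = p (rng X y)}"
  let ?P = "subtopology (prod_topology (arr_top X) (arr_top X)) ?S"
  have qm: "quotient_map ?P (subtopology (prod_topology (arr_top Q) (arr_top Q)) (composable Q))
      (\<lambda>(x, y). (p x, p y))"
    by (intro quotient_map_prod_restrict quotient_map_p open_map_p) (simp add: quotient_simps)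
  show "continuous_map (subtopology (prod_topology (arr_top Q) (arr_top Q)) (composable Q))
      (arr_top Q) (\<lambda>(\<xi>, \<eta>). \<xi> \<odot>\<^bsub>Q\<^esub> \<eta>)"
  proof (rule continuous_map_through_quotient[OF qm], rule continuous_map_eq)
    have c: "continuous_map ?P (arr_top X) fst" "continuous_map ?P (arr_top X) snd"
      by (simp_all add: continuous_map_from_subtopology continuous_map_fst continuous_map_snd)
    show "continuous_map ?P (arr_top Q) (\<lambda>t. p (fst t \<odot>\<^bsub>X\<^esub> match (fst t) (snd t)))"
      by (intro continuous_map_p X.continuous_map_mul continuous_map_match c) (auto simp: match)
    show "p (fst t \<odot>\<^bsub>X\<^esub> match (fst t) (snd t)) =
        (case case t of (x, y) \<Rightarrow> (p x, p y) of (\<xi>, \<eta>) \<Rightarrow> \<xi> \<odot>\<^bsub>Q\<^esub> \<eta>)" if "t \<in> topspace ?P" for t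
      using that quotient_mul[of "fst t" "match (fst t) (snd t)"] by (auto simp: match)
  qed
  show "continuous_map (arr_top Q) (arr_top Q) (ginv Q)"
  proof (rule continuous_map_through_quotient[OF quotient_map_p], rule continuous_map_eq)
    show "continuous_map (arr_top X) (arr_top Q) (\<lambda>x. p (ginv X x))"
      by (intro continuous_map_p X.continuous_inv)
  qed (simp add: quotient_simps)
  show "locally_compact_space (arr_top Q)" "Hausdorff_space (arr_top Q)" "second_countable (arr_top Q)"
    using open_map_p quotient_topology_locally_compact[OF _ X.locally_compact]
      space.Hausdorff_orbit_space[OF open_H] quotient_topology_second_countable[OF _ X.second_countable]
    unfolding quotient_arr_top by blast+
qed

text \<open>Orbits of units consist of units. So the units are saturated, which lets
  \<open>p\<close> restrict to an open quotient map between unit spaces.\<close>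

lemma p_units_iff: "x \<in> arrows X \<Longrightarrow> p x \<in> units Q \<longleftrightarrow> x \<in> units X"
proof
  assume x: "x \<in> arrows X" and "p x \<in> units Q"
  then obtain u where u: "u \<in> units X" "p x = p u" unfolding quotient_units by auto
  then obtain h where "h \<in> arrows H" "src H h = \<rho>0 (rng X u)" "x = h \<rhd> u"
    using p_eqE[OF u(2) x] by auto
  then show "x \<in> units X" using u by simp
qed (simp add: quotient_units)

lemma quotient_map_p_units: "quotient_map (unit_space X) (unit_space Q) p"
  and open_map_p_units: "open_map (unit_space X) (unit_space Q) p"
proof -
  have u: "{x \<in> arrows X. p x \<in> units Q} = units X" using p_units_iff X.unit_arrow by blast
  show "quotient_map (unit_space X) (unit_space Q) p" "open_map (unit_space X) (unit_space Q) p"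
    unfolding unit_space_def
    using quotient_map_restriction_open[OF quotient_map_p open_map_p u]
      open_map_restriction[OF open_map_p u] by simp_all
qed

end

section \<open>In-tune actions\<close>

text \<open>The right action of \<open>G\<close> on \<open>X\<close> enters as the left action of \<open>G' = opposite G\<close> on
  \<open>opposite X\<close>. In this form the hypotheses are symmetric under exchanging \<open>(H, X)\<close> with
  \<open>(G', opposite X)\<close>, so only one half of the theorem needs a proof.\<close>

locale tuned_actions =
  left: quotient_action H X \<rho>0 la lr + right: quotient_action G' "opposite X" \<sigma>0 ga gr
  for H :: "'h groupoid" and X :: "'x groupoid" and \<rho>0 :: "'x \<Rightarrow> 'h"
    and la :: "'h \<Rightarrow> 'x \<Rightarrow> 'x" and lr :: "'h \<Rightarrow> 'x \<Rightarrow> 'h"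
    and G' :: "'g groupoid" and \<sigma>0 :: "'x \<Rightarrow> 'g"
    and ga :: "'g \<Rightarrow> 'x \<Rightarrow> 'x" and gr :: "'g \<Rightarrow> 'x \<Rightarrow> 'g" +
  assumes open_X: "open_source X"
    and tune: "h \<in> arrows H \<Longrightarrow> x \<in> arrows X \<Longrightarrow> t \<in> arrows G' \<Longrightarrow> src H h = \<rho>0 (rng X x) \<Longrightarrow>
      \<sigma>0 (src X x) = src G' t \<Longrightarrow>
        \<sigma>0 (src X (la h x)) = \<sigma>0 (src X x) \<and> \<rho>0 (rng X (ga t x)) = \<rho>0 (rng X x) \<and>
        la h (ga t x) = ga t (la h x) \<and> gr t (la h x) = gr t x \<and> lr h (ga t x) = lr h x"
begin

abbreviation "p \<equiv> left_orbit H (\<lambda>x. \<rho>0 (rng X x)) la"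
abbreviation "q \<equiv> left_orbit G' (\<lambda>x. \<sigma>0 (src X x)) ga"
abbreviation "XG \<equiv> quotient_groupoid X q"

text \<open>The facts about \<open>right\<close> live on \<open>opposite X\<close>;
  \<open>simplified\<close> rewrites them on \<open>X\<close>, with range and source exchanged.
  Hence \<open>src_ga\<close> stems from \<open>rng_act\<close>, and \<open>q_match\<close> adjusts
  the left factor of a product, its source being prescribed.\<close>

lemmas ga_closed [simp] = right.act_closed[simplified]
  and gr_closed [simp] = right.res_closed[simplified]
  and ga_unit [simp] = right.act_unit[simplified]
  and src_ga [simp] = right.rng_act[simplified]
  and rng_ga [simp] = right.src_act_eq[simplified]
  and src_gr [simp] = right.src_res[simplified]
  and ga_mul = right.act_mul[simplified]
  and q_act [simp] = right.p_act[simplified]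
  and q_self [simp] = right.p_self[simplified]
  and q_orbit = right.space.mem_orbit[simplified]
  and q_on_class = right.space.on_class_orbit[simplified]
  and q_match = right.match[simplified]
  and q_match_unique = right.match_unique[simplified]
  and continuous_map_q_match = right.continuous_map_match[simplified]
  and quotient_map_q = right.quotient_map_p[simplified quotient_groupoid_opposite opposite_simps]
  and open_map_q = right.open_map_p[simplified quotient_groupoid_opposite opposite_simps]
  and continuous_map_q = right.continuous_map_p[simplified quotient_groupoid_opposite opposite_simps]
  and quotient_map_q_units = right.quotient_map_p_units[simplified quotient_groupoid_opposite opposite_simps]
  and open_map_q_units = right.open_map_p_units[simplified quotient_groupoid_opposite opposite_simps]
  and XG_arrows = right.quotient_arrows[simplified quotient_groupoid_opposite opposite_simps]
  and XG_simps = right.quotient_simps[simplified quotient_groupoid_opposite opposite_simps]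
  and XG_mul = right.quotient_mul[simplified quotient_groupoid_opposite opposite_simps]
  and XG_composable_right = right.quotient_composable[simplified quotient_groupoid_opposite opposite_simps]
  and XG_units = right.quotient_units[simplified quotient_groupoid_opposite opposite_simps]

lemma lc_groupoid_XG: "lc_groupoid XG"
  using lc_groupoid_opposite[OF right.lc_groupoid_quotient] by (simp add: quotient_groupoid_opposite)

lemma q_closed [simp]: "x \<in> arrows X \<Longrightarrow> q x \<in> arrows XG"
  by (simp add: XG_arrows)

lemma XG_composableE:
  assumes "(\<xi>, \<eta>) \<in> composable XG"
  obtains x y where "x \<in> arrows X" "y \<in> arrows X" "\<xi> = q x" "\<eta> = q y" "src X x = rng X y"
proof -
  from assms obtain y where y: "y \<in> arrows X" "\<eta> = q y" by (auto simp: XG_arrows)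
  then have "q (rng X y) = src XG \<xi>" using assms by (simp add: XG_simps)
  then show ?thesis using XG_composable_right[of y \<xi>] y assms that by (metis composable_iff)
qed

text \<open>\<open>tune\<close> compares an arrow h with an arrow t; taking t to be the unit
  \<sigma>(x) leaves a statement about h alone. Dually, \<open>tune_ga\<close> takes h to be
  \<rho>(x).\<close>

lemma tune_la:
  assumes "h \<in> arrows H" "x \<in> arrows X" "src H h = \<rho>0 (rng X x)"
  shows "\<sigma>0 (src X (la h x)) = \<sigma>0 (src X x)"
  using tune[of h x "\<sigma>0 (src X x)"] assms right.rho_unit right.H.unit_arrow by simp

lemma tune_ga:
  assumes "t \<in> arrows G'" "x \<in> arrows X" "src G' t = \<sigma>0 (src X x)"
  shows "\<rho>0 (rng X (ga t x)) = \<rho>0 (rng X x)"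
  using tune[of "\<rho>0 (rng X x)" x t] assms by simp

lemma q_la_ga:
  assumes "h \<in> arrows H" "x \<in> arrows X" "src H h = \<rho>0 (rng X x)" "t \<in> arrows G'" "src G' t = \<sigma>0 (src X x)"
  shows "q (la h (ga t x)) = q (la h x)"
  using tune[of h x t] assms tune_la[of h x] by simp

lemma on_class_la: "h \<in> arrows H \<Longrightarrow> x \<in> arrows X \<Longrightarrow> src H h = \<rho>0 (rng X x) \<Longrightarrow>
    on_class (\<lambda>x. q (la h x)) (q x) = q (la h x)"
  by (rule q_on_class) (simp_all add: q_la_ga)

lemma on_class_lr: "h \<in> arrows H \<Longrightarrow> x \<in> arrows X \<Longrightarrow> src H h = \<rho>0 (rng X x) \<Longrightarrow>
    on_class (lr h) (q x) = lr h x"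
  by (rule q_on_class) (simp_all add: tune)

lemma on_class_rho: "u \<in> units X \<Longrightarrow> on_class \<rho>0 (q u) = \<rho>0 u"
  using tune_ga[of _ u] by (intro q_on_class) simp_all

lemma quotient_map_left_pairs:
  "quotient_map (left_pairs H (arr_top X) (\<lambda>x. \<rho>0 (rng X x)))
     (left_pairs H (arr_top XG) (rho_mom XG (on_class \<rho>0))) (\<lambda>(h, x). (h, q x))"
  unfolding left_pairs_def
  by (rule quotient_map_prod_restrict[where f = "\<lambda>h. h"])
    (auto simp: quotient_map_q open_map_q XG_simps on_class_rho quotient_map_ident open_map_id[unfolded id_def])

end

text \<open>Being in tune makes the structure maps respect the classes of \<open>q\<close>. Each
  axiom then follows from the same axiom in \<open>X\<close>, evaluated at representatives that are
  composable where the axiom asks for it.\<close>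

sublocale tuned_actions \<subseteq>
  XG: self_similar_left H XG "on_class \<rho>0" "\<lambda>h. on_class (\<lambda>x. q (la h x))" "\<lambda>h. on_class (lr h)"
proof -
  interpret XG: lc_groupoid XG by (rule lc_groupoid_XG)
  let ?\<rho> = "on_class \<rho>0" and ?la = "\<lambda>h. on_class (\<lambda>x. q (la h x))" and ?lr = "\<lambda>h. on_class (lr h)"
  note ev = XG_simps XG_mul on_class_rho on_class_la on_class_lr
  show "self_similar_left H XG ?\<rho> ?la ?lr"
  proof
    show "continuous_map (unit_space XG) (unit_space H) ?\<rho>"
    proof (rule continuous_map_through_quotient[OF quotient_map_q_units])
      show "continuous_map (unit_space X) (unit_space H) (\<lambda>x. ?\<rho> (q x))"
        by (rule continuous_map_eq[OF left.continuous_\<rho>0]) (simp add: on_class_rho)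
    qed
    show "?\<rho> ` units XG = units H"
      using left.surj_\<rho>0 by (auto simp: XG_units on_class_rho image_image)
    have pairs: "k \<in> arrows H \<and> y \<in> arrows X \<and> src H k = \<rho>0 (rng X y)"
      if "(k, y) \<in> topspace (left_pairs H (arr_top X) (\<lambda>x. \<rho>0 (rng X x)))" for k y
      using that by (auto simp: left_pairs_def)
    have c: "continuous_map (left_pairs H (arr_top X) (\<lambda>x. \<rho>0 (rng X x))) (arr_top XG) (\<lambda>(h, x). q (la h x))"
      using continuous_map_q[OF left.continuous_act] by (simp add: case_prod_unfold)
    show "continuous_map (left_pairs H (arr_top XG) (rho_mom XG ?\<rho>)) (arr_top XG) (\<lambda>(h, x). ?la h x)"
      by (rule continuous_map_through_quotient[OF quotient_map_left_pairs], rule continuous_map_eq[OF c])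
        (auto dest!: pairs simp: ev)
    show "continuous_map (left_pairs H (arr_top XG) (rho_mom XG ?\<rho>)) (arr_top H) (\<lambda>(h, x). ?lr h x)"
      by (rule continuous_map_through_quotient[OF quotient_map_left_pairs],
          rule continuous_map_eq[OF left.continuous_res])
        (auto dest!: pairs simp: ev)
    fix h k \<xi> \<eta>
    { assume h: "h \<in> arrows H"
      { assume "\<xi> \<in> arrows XG"
        then obtain x where x: "x \<in> arrows X" "\<xi> = q x" by (auto simp: XG_arrows)
        assume m: "src H h = ?\<rho> (rng XG \<xi>)"
        show "rng H h = ?\<rho> (rng XG (?la h \<xi>))" "src H (?lr h \<xi>) = ?\<rho> (rng XG (ginv XG \<xi>))"
          "rng H (?lr h \<xi>) = ?\<rho> (rng XG (ginv XG (?la h \<xi>)))"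
          using h x m by (simp_all add: ev) }
      { assume "\<xi> \<in> units XG"
        then obtain x where x: "x \<in> units X" "\<xi> = q x" by (auto simp: XG_units)
        assume m: "src H h = ?\<rho> (rng XG \<xi>)"
        show "?lr h \<xi> = h" using h x m by (simp add: ev) }
      { assume "(\<xi>, \<eta>) \<in> composable XG"
        then obtain x y where xy: "x \<in> arrows X" "y \<in> arrows X" "\<xi> = q x" "\<eta> = q y" "src X x = rng X y"
          using XG_composableE by metis
        assume m: "src H h = ?\<rho> (rng XG \<xi>)"
        show "src XG (?la h \<xi>) = rng XG (?la (?lr h \<xi>) \<eta>)" "?lr h (\<xi> \<odot>\<^bsub>XG\<^esub> \<eta>) = ?lr (?lr h \<xi>) \<eta>"
          "?la h (\<xi> \<odot>\<^bsub>XG\<^esub> \<eta>) = ?la h \<xi> \<odot>\<^bsub>XG\<^esub> ?la (?lr h \<xi>) \<eta>"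
          using h xy m by (simp_all add: ev left.act_mul left.res_mul) } }
    { assume "\<xi> \<in> arrows XG"
      then obtain x where x: "x \<in> arrows X" "\<xi> = q x" by (auto simp: XG_arrows)
      show "?la (?\<rho> (rng XG \<xi>)) \<xi> = \<xi>" using x by (simp add: ev)
      assume "(h, k) \<in> composable H" "src H k = ?\<rho> (rng XG \<xi>)"
      then show "?la (h \<odot>\<^bsub>H\<^esub> k) \<xi> = ?la h (?la k \<xi>)"
        "?lr (h \<odot>\<^bsub>H\<^esub> k) \<xi> = ?lr h (?la k \<xi>) \<odot>\<^bsub>H\<^esub> ?lr k \<xi>"
        using x by (simp_all add: ev left.mul_act' left.mul_res) }
  qed
qed

section \<open>The action of the product groupoid\<close>

context tuned_actions
begin

abbreviation "K \<equiv> XG.prd"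
abbreviation "mom y \<equiv> (q (rng X y), on_class \<rho>0 (q (rng X y)))"

definition lact :: "'x set \<times> 'h \<Rightarrow> 'x \<Rightarrow> 'x" where
  "lact = (\<lambda>(\<xi>, h) y. (THE x. x \<in> \<xi> \<and> (x, la h y) \<in> composable X) \<odot>\<^bsub>X\<^esub> la h y)"

lemma K_pairD:
  assumes "(q x, h) \<in> arrows K" "x \<in> arrows X" "y \<in> arrows X" "src K (q x, h) = mom y"
  shows "h \<in> arrows H" "src H h = \<rho>0 (rng X y)" "q (src X x) = q (la h (rng X y))"
proof -
  have a: "q x \<in> arrows XG" "h \<in> arrows H" "on_class \<rho>0 (src XG (q x)) = rng H h"
    using assms(1) by simp_all
  \<comment> \<open>The pair (q y, \<rho>(s(y))) is an arrow of \<open>K\<close> with range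
    \<open>mom y\<close>. It allows the momentum condition to be read as composability in
    \<open>K\<close>.\<close>
  have b: "q y \<in> arrows XG" "\<rho>0 (src X y) \<in> arrows H" "on_class \<rho>0 (src XG (q y)) = rng H (\<rho>0 (src X y))"
    using assms(3) by (simp_all add: XG_simps on_class_rho)
  have "src K (q x, h) = rng K (q y, \<rho>0 (src X y))"
    using assms(3,4) by (simp add: XG.left_product_simps XG_simps)
  note c = XG.left_product_composable[OF a b this]
  show "h \<in> arrows H" by fact
  show h: "src H h = \<rho>0 (rng X y)" using c(1) assms(3) by (simp add: XG_simps on_class_rho)
  show "q (src X x) = q (la h (rng X y))"
    using c(2) h a(2) assms(2,3) by (simp add: XG_simps on_class_la)
qed

text \<open>The normal form for the computations with \<open>K\<close>: the class is represented by
  the x with s(x) = r(h \<rhd> y), so acting on y is the plain product x (h \<rhd> y).\<close>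

lemma K_pairE:
  assumes "k \<in> arrows K" "y \<in> arrows X" "src K k = mom y"
  obtains x h where "k = (q x, h)" "x \<in> arrows X" "h \<in> arrows H" "src H h = \<rho>0 (rng X y)"
    "src X x = la h (rng X y)"
proof -
  obtain \<xi> h where k: "k = (\<xi>, h)" by (cases k)
  then have "\<xi> \<in> arrows XG" using assms(1) by simp
  then obtain x where x: "x \<in> arrows X" "\<xi> = q x" by (auto simp: XG_arrows)
  note d = K_pairD[of x h y]
  have h: "h \<in> arrows H" "src H h = \<rho>0 (rng X y)" and e: "q (src X x) = q (la h (rng X y))"
    using d assms k x by auto
  have "q (rng X (la h y)) = q (src X x)" using h e assms by simp
  from q_match[OF _ x(1) this] h show ?thesis
    using assms k x by (intro that[of "right.match (la h y) x" h]) simp_all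
qed

lemma K_pairI:
  assumes "x \<in> arrows X" "y \<in> arrows X" "h \<in> arrows H" "src H h = \<rho>0 (rng X y)"
    "src X x = la h (rng X y)"
  shows "(q x, h) \<in> arrows K" "src K (q x, h) = mom y"
  using assms by (simp_all add: XG_simps on_class_rho XG.left_product_simps on_class_la)

text \<open>By freeness of the action of \<open>G'\<close>, two members of one of its orbits with
  equal source coincide.\<close>

lemma K_match_unique:
  assumes "x \<in> arrows X" "y \<in> arrows X" "h \<in> arrows H" "src H h = \<rho>0 (rng X y)"
    "src X x = la h (rng X y)"
  shows "x' \<in> q x \<and> (x', la h y) \<in> composable X \<longleftrightarrow> x' = x"
  using assms q_match_unique[of x' x] q_orbit[of x x'] by auto

lemma lact_eq:
  assumes "x \<in> arrows X" "y \<in> arrows X" "h \<in> arrows H" "src H h = \<rho>0 (rng X y)"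
    "src X x = la h (rng X y)"
  shows "lact (q x, h) y = x \<odot>\<^bsub>X\<^esub> la h y"
  unfolding lact_def using K_match_unique[OF assms] by simp

lemma lact_ex1:
  assumes "(\<xi>, h) \<in> arrows K" "y \<in> arrows X" "src K (\<xi>, h) = mom y"
  shows "\<exists>!x. x \<in> \<xi> \<and> (x, la h y) \<in> composable X"
proof -
  obtain x where "\<xi> = q x" "x \<in> arrows X" "h \<in> arrows H" "src H h = \<rho>0 (rng X y)"
    "src X x = la h (rng X y)"
    using K_pairE[OF assms] by (metis prod.inject)
  then show ?thesis using K_match_unique assms(2) by simp
qed

text \<open>\<open>mom\<close> is the range map followed by \<open>q\<close> on units and by the
  identification of the units of \<open>XG\<close> with those of \<open>K\<close>. The range is open
  because the source is, and onto because it fixes units.\<close>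

lemma quotient_map_mom: "quotient_map (arr_top X) (unit_space K) mom"
  and open_map_mom: "open_map (arr_top X) (unit_space K) mom"
proof -
  have h: "homeomorphic_map (unit_space XG) (unit_space K) (\<lambda>u. (u, on_class \<rho>0 u))"
    by (rule XG.homeomorphic_map_left_product_units)
  have r: "quotient_map (arr_top X) (unit_space X) (rng X)"
  proof (rule continuous_open_imp_quotient_map)
    show "continuous_map (arr_top X) (unit_space X) (rng X)"
      by (simp add: left.X.continuous_map_unit_space left.X.continuous_map_rng_self)
    show "rng X ` arrows X = topspace (unit_space X)"
    proof
      show "topspace (unit_space X) \<subseteq> rng X ` arrows X"
      proof
        fix u assume "u \<in> topspace (unit_space X)"
        then show "u \<in> rng X ` arrows X" by (intro image_eqI[of u _ u]) simp_all
      qed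
    qed auto
  qed (rule left.X.open_map_rng[OF open_X])
  have "quotient_map (arr_top X) (unit_space K) ((\<lambda>u. (u, on_class \<rho>0 u)) \<circ> (q \<circ> rng X))"
    using h by (intro quotient_map_compose[OF quotient_map_compose[OF r quotient_map_q_units]])
      (simp add: homeomorphic_map_def)
  then show "quotient_map (arr_top X) (unit_space K) mom" by (simp add: o_def)
  have "open_map (arr_top X) (unit_space K) ((\<lambda>u. (u, on_class \<rho>0 u)) \<circ> (q \<circ> rng X))"
    by (rule open_map_compose[OF open_map_compose[OF left.X.open_map_rng[OF open_X] open_map_q_units]
          homeomorphic_imp_open_map[OF h]])
  then show "open_map (arr_top X) (unit_space K) mom" by (simp add: o_def)
qed

lemma homeomorphic_map_units_K:
  "homeomorphic_map (quotient_topology (unit_space X) q) (unit_space K) (\<lambda>\<omega>. (\<omega>, on_class \<rho>0 \<omega>))"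
  unfolding quotient_map_imp_eq_quotient_topology[OF quotient_map_q_units]
  by (rule XG.homeomorphic_map_left_product_units)

text \<open>The class in an arrow of \<open>K\<close> is replaced by an arbitrary representative x,
  first within \<open>K\<close> and then in the pairs on which \<open>K\<close> acts. At this stage
  x need not be composable with h \<rhd> y; \<open>match\<close> takes care of that in
  \<open>lact_match\<close>.\<close>

lemma quotient_map_K_pairs:
  "quotient_map
    (subtopology (prod_topology (subtopology (prod_topology (arr_top X) (arr_top H))
      {(x, h). \<rho>0 (src X x) = rng H h}) (arr_top X)) {((x, h), y). src K (q x, h) = mom y})
    (left_pairs K (arr_top X) mom) (\<lambda>((x, h), y). ((q x, h), y))"
proof -
  let ?A = "subtopology (prod_topology (arr_top X) (arr_top H)) {(x, h). \<rho>0 (src X x) = rng H h}"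
  have K: "arr_top K = subtopology (prod_topology (arr_top XG) (arr_top H))
      {(x, h). on_class \<rho>0 (rng XG (ginv XG x)) = rng H h}"
    by (simp add: left_product_def)
  have "quotient_map ?A (arr_top K) (\<lambda>(x, h). (q x, h))" "open_map ?A (arr_top K) (\<lambda>(x, h). (q x, h))"
    unfolding K by (rule quotient_map_prod_restrict[where g = "\<lambda>h. h"];
      auto simp: quotient_map_q open_map_q XG_simps on_class_rho quotient_map_ident open_map_id[unfolded id_def])+
  note k = this
  have *: "quotient_map
    (subtopology (prod_topology ?A (arr_top X)) {((x, h), y). src K (q x, h) = mom y})
    (left_pairs K (arr_top X) mom) (\<lambda>(a, y). (case a of (x, h) \<Rightarrow> (q x, h), y))"
    unfolding left_pairs_def
    by (rule quotient_map_prod_restrict(1)[OF k quotient_map_ident open_map_id[unfolded id_def]]) auto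
  show ?thesis by (rule quotient_map_eq[OF *]) auto
qed

text \<open>Expresses the action through an arbitrary representative, by a formula composed of
  continuous maps; the unique choice in the definition of \<open>lact\<close> does not display
  continuity.\<close>

lemma lact_match:
  assumes "(q x, h) \<in> arrows K" "x \<in> arrows X" "y \<in> arrows X" "src K (q x, h) = mom y"
  shows "lact (q x, h) y = right.match (la h y) x \<odot>\<^bsub>X\<^esub> la h y"
    and "src X (right.match (la h y) x) = la h (rng X y)"
proof -
  note d = K_pairD[OF assms]
  have "q (rng X (la h y)) = q (src X x)" using d assms by simp
  note r = q_match[OF _ assms(2) this]
  show s: "src X (right.match (la h y) x) = la h (rng X y)" using r d assms by simp
  have "lact (q (right.match (la h y) x), h) y = right.match (la h y) x \<odot>\<^bsub>X\<^esub> la h y"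
    by (rule lact_eq) (use r d s assms in simp_all)
  then show "lact (q x, h) y = right.match (la h y) x \<odot>\<^bsub>X\<^esub> la h y" using r d assms by simp
qed

lemma continuous_map_lact: "continuous_map (left_pairs K (arr_top X) mom) (arr_top X) (\<lambda>(k, z). lact k z)"
proof (rule continuous_map_through_quotient[OF quotient_map_K_pairs], rule continuous_map_eq)
  let ?T = "subtopology (prod_topology (subtopology (prod_topology (arr_top X) (arr_top H))
      {(x, h). \<rho>0 (src X x) = rng H h}) (arr_top X)) {((x, h), y). src K (q x, h) = mom y}"
  have T: "(q x, h) \<in> arrows K" "x \<in> arrows X" "y \<in> arrows X" "src K (q x, h) = mom y"
    if "((x, h), y) \<in> topspace ?T" for x h y
    using that by (auto simp: XG_simps on_class_rho)
  have F: "snd (fst t) \<in> arrows H" "src H (snd (fst t)) = \<rho>0 (rng X (snd t))" "snd t \<in> arrows X"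
    "q (src X (fst (fst t))) = q (la (snd (fst t)) (rng X (snd t)))"
    "src X (right.match (la (snd (fst t)) (snd t)) (fst (fst t))) = la (snd (fst t)) (rng X (snd t))"
    if "t \<in> topspace ?T" for t
  proof -
    have "((fst (fst t), snd (fst t)), snd t) \<in> topspace ?T" using that by simp
    from K_pairD[OF T[OF this]] T[OF this] lact_match(2)[OF T[OF this]]
    show "snd (fst t) \<in> arrows H" "src H (snd (fst t)) = \<rho>0 (rng X (snd t))" "snd t \<in> arrows X"
      "q (src X (fst (fst t))) = q (la (snd (fst t)) (rng X (snd t)))"
      "src X (right.match (la (snd (fst t)) (snd t)) (fst (fst t))) = la (snd (fst t)) (rng X (snd t))"
      by blast+
  qed
  have c: "continuous_map ?T (arr_top X) (\<lambda>t. fst (fst t))" "continuous_map ?T (arr_top H) (\<lambda>t. snd (fst t))"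
    "continuous_map ?T (arr_top X) snd"
  proof -
    have *: "continuous_map ?T (subtopology (prod_topology (arr_top X) (arr_top H))
      {(x, h). \<rho>0 (src X x) = rng H h}) fst"
      by (simp add: continuous_map_from_subtopology continuous_map_fst)
    show "continuous_map ?T (arr_top X) (\<lambda>t. fst (fst t))" "continuous_map ?T (arr_top H) (\<lambda>t. snd (fst t))"
      using continuous_map_compose[OF *, of "arr_top X" fst] continuous_map_compose[OF *, of "arr_top H" snd]
      by (simp_all add: o_def continuous_map_from_subtopology continuous_map_fst continuous_map_snd)
    show "continuous_map ?T (arr_top X) snd"
      by (simp add: continuous_map_from_subtopology continuous_map_snd)
  qed
  show "continuous_map ?T (arr_top X)
      (\<lambda>t. right.match (la (snd (fst t)) (snd t)) (fst (fst t)) \<odot>\<^bsub>X\<^esub> la (snd (fst t)) (snd t))"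
    by (intro left.X.continuous_map_mul continuous_map_q_match left.space.continuous_map_act c)
      (simp_all add: F)
  show "right.match (la (snd (fst t)) (snd t)) (fst (fst t)) \<odot>\<^bsub>X\<^esub> la (snd (fst t)) (snd t) =
      (\<lambda>(k, z). lact k z) ((\<lambda>((x, h), y). ((q x, h), y)) t)" if "t \<in> topspace ?T" for t
  proof -
    obtain x h y where t: "t = ((x, h), y)" by (metis prod.collapse)
    with that have "((x, h), y) \<in> topspace ?T" by simp
    from lact_match(1)[OF T[OF this]] show ?thesis by (simp add: t)
  qed
qed

lemma continuous_map_mom: "continuous_map (arr_top X) (unit_space K) mom"
  using quotient_map_mom quotient_imp_continuous_map by blast

lemma left_groupoid_action_K: "left_groupoid_action K (arr_top X) mom lact"
proof
  show "continuous_map (arr_top X) (unit_space K) mom" by (rule continuous_map_mom)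
  show "continuous_map (left_pairs K (arr_top X) mom) (arr_top X) (\<lambda>(k, z). lact k z)"
    by (rule continuous_map_lact)
  fix z assume z: "z \<in> arrows X"
  show "lact (mom z) z = z"
    using lact_eq[of "rng X z" z "\<rho>0 (rng X z)"] z
    by (simp add: on_class_rho left.X.unit_mul)
  fix k l
  show "mom (lact k z) = rng K k" if k: "k \<in> arrows K" and m: "src K k = mom z"
  proof -
    obtain x h where "k = (q x, h)" "x \<in> arrows X" "h \<in> arrows H" "src H h = \<rho>0 (rng X z)"
      "src X x = la h (rng X z)"
      using K_pairE[OF k z m] .
    then show ?thesis using z by (simp add: lact_eq XG.left_product_simps XG_simps)
  qed
  show "lact (k \<odot>\<^bsub>K\<^esub> l) z = lact k (lact l z)"
    if kl: "(k, l) \<in> composable K" and m: "src K l = mom z"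
  proof -
    have l: "l \<in> arrows K" and k: "k \<in> arrows K" and s: "src K k = rng K l" using kl by auto
    obtain y j where y: "l = (q y, j)" "y \<in> arrows X" "j \<in> arrows H" "src H j = \<rho>0 (rng X z)"
      "src X y = la j (rng X z)"
      using K_pairE[OF l z m] .
    have lz: "lact l z = y \<odot>\<^bsub>X\<^esub> la j z" using y z by (simp add: lact_eq)
    have w: "y \<odot>\<^bsub>X\<^esub> la j z \<in> arrows X" "rng X (y \<odot>\<^bsub>X\<^esub> la j z) = rng X y"
      using y z by simp_all
    \<comment> \<open>k acts on y (j \<rhd> z), whose range is r(y); thus the representative x found
      next is composable with h \<rhd> y as well.\<close>
    have "src K k = mom (y \<odot>\<^bsub>X\<^esub> la j z)"
      using s y w by (simp add: XG.left_product_simps XG_simps)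
    from K_pairE[OF k w(1) this] obtain x h where
      x: "k = (q x, h)" "x \<in> arrows X" "h \<in> arrows H" "src H h = \<rho>0 (rng X y)" "src X x = la h (rng X y)"
      unfolding w(2) .
    have j: "\<rho>0 (src X y) = rng H j" using y z by simp
    have kl: "k \<odot>\<^bsub>K\<^esub> l = (q (x \<odot>\<^bsub>X\<^esub> la h y), lr h y \<odot>\<^bsub>H\<^esub> j)"
      using x y by (simp add: XG.left_product_simps on_class_la on_class_lr XG_mul)
    have "lact (k \<odot>\<^bsub>K\<^esub> l) z = (x \<odot>\<^bsub>X\<^esub> la h y) \<odot>\<^bsub>X\<^esub> la (lr h y \<odot>\<^bsub>H\<^esub> j) z"
      unfolding kl by (rule lact_eq) (use x y z j in \<open>simp_all add: left.mul_act'\<close>)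
    \<comment> \<open>(L4) in the form h \<rhd> (y (j \<rhd> z)) = (h \<rhd> y) ((h \<lhd> y) \<rhd>
      (j \<rhd> z)).\<close>
    also have "\<dots> = x \<odot>\<^bsub>X\<^esub> la h (y \<odot>\<^bsub>X\<^esub> la j z)"
      using x y z j by (simp add: left.act_mul left.mul_act' left.X.mul_assoc')
    also have "\<dots> = lact k (lact l z)"
      unfolding lz x(1) by (rule lact_eq[symmetric]) (use x w in simp_all)
    finally show ?thesis .
  qed
qed

text \<open>From x (h \<rhd> y) = y the sources give (h \<lhd> y) \<rhd> s(y) = s(y), so h \<lhd> y
  is a unit. Restricting along y\<inverse> shows that h is a unit; then h \<rhd> y = y, and
  cancelling y gives x = r(y).\<close>

lemma free_left_K: "free_left K (arr_top X) mom lact"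
  unfolding free_left_def
proof (intro ballI impI)
  fix k y assume k: "k \<in> arrows K" and y: "y \<in> arrows X" and m: "src K k = mom y" and f: "lact k y = y"
  obtain x h where x: "k = (q x, h)" "x \<in> arrows X" "h \<in> arrows H" "src H h = \<rho>0 (rng X y)"
    "src X x = la h (rng X y)"
    using K_pairE[OF k y m] .
  have xy: "x \<odot>\<^bsub>X\<^esub> la h y = y" using f x y lact_eq by metis
  have "src X (x \<odot>\<^bsub>X\<^esub> la h y) = la (lr h y) (src X y)" using x y by simp
  then have "la (lr h y) (src X y) = src X y" using xy by simp
  then have "lr h y \<in> units H"
    using left.free[unfolded free_left_def, rule_format, of "lr h y" "src X y"] x y by simp
  then have u: "lr h y = \<rho>0 (src X y)" using left.src_res[of h y] x y by simp
  have "h = lr (lr h y) (ginv X y)"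
    using left.res_mul[of h y "ginv X y", symmetric] x y by (simp add: left.X.mul_inv)
  also have "\<dots> = \<rho>0 (rng X y)" unfolding u using y by simp
  finally have h: "h = \<rho>0 (rng X y)" .
  then have "la h y = y" using y by simp
  then have "x \<odot>\<^bsub>X\<^esub> y = rng X y \<odot>\<^bsub>X\<^esub> y" using xy y by (simp add: left.X.unit_mul)
  then have "x = rng X y"
    by (intro left.X.mul_right_cancel[of x "rng X y" y]) (use x y h in simp_all)
  then show "k \<in> units K"
    using x h y by (simp add: XG.left_product_simps XG_units on_class_rho image_image)
qed

section \<open>Orbits and properness of the action of the product groupoid\<close>

lemma lact_closed:
  assumes "k \<in> arrows K" "y \<in> arrows X" "src K k = mom y"
  shows "lact k y \<in> arrows X" "p (src X (lact k y)) = p (src X y)"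
proof -
  obtain x h where "k = (q x, h)" "x \<in> arrows X" "h \<in> arrows H" "src H h = \<rho>0 (rng X y)"
    "src X x = la h (rng X y)"
    using K_pairE[OF assms] .
  then show "lact k y \<in> arrows X" "p (src X (lact k y)) = p (src X y)"
    using assms by (simp_all add: lact_eq)
qed

text \<open>The arrow of \<open>K\<close> carrying \<open>y\<close> to \<open>w\<close>, obtained from \<open>k\<close> with \<open>k \<rhd> s(y) = s(w)\<close>
  by solving \<open>h \<lhd> y = k\<close>.\<close>

abbreviation "K_trans_H w y \<equiv> lr (left.space.tr (src X w) (src X y)) (ginv X y)"
abbreviation "K_trans_X w y \<equiv> w \<odot>\<^bsub>X\<^esub> ginv X (la (K_trans_H w y) y)"

lemma K_trans:
  assumes "w \<in> arrows X" "y \<in> arrows X" "p (src X w) = p (src X y)"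
  shows "K_trans_X w y \<in> arrows X" "K_trans_H w y \<in> arrows H" "src H (K_trans_H w y) = \<rho>0 (rng X y)"
    "src X (K_trans_X w y) = la (K_trans_H w y) (rng X y)"
    "lact (q (K_trans_X w y), K_trans_H w y) y = w"
    "src X w = src X (la (K_trans_H w y) y)"
proof -
  let ?k = "left.space.tr (src X w) (src X y)" and ?h = "K_trans_H w y"
  have k: "?k \<in> arrows H" "src H ?k = \<rho>0 (src X y)" "la ?k (src X y) = src X w"
    using left.space.tr[of "src X w" "src X y"] assms by simp_all
  show h: "?h \<in> arrows H" "src H ?h = \<rho>0 (rng X y)" using k assms by simp_all
  \<comment> \<open>(L3) undoes y\<inverse>: (k \<lhd> y\<inverse>) \<lhd> y = k \<lhd> s(y) = k.
    Hence h \<rhd> y has source k \<rhd> s(y) = s(w), so w can be multiplied with its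
    inverse.\<close>
  have "lr ?h y = ?k"
    using left.res_mul[of ?k "ginv X y" y, symmetric] k assms by (simp add: left.X.inv_mul)
  then show s: "src X w = src X (la ?h y)" using h k assms by simp
  have la: "la ?h y \<in> arrows X" using h assms by simp
  show x: "K_trans_X w y \<in> arrows X" "src X (K_trans_X w y) = la ?h (rng X y)"
    using assms s la h by simp_all
  have "K_trans_X w y \<odot>\<^bsub>X\<^esub> la ?h y = w"
    by (rule left.X.mul_inv_cancel') (use s la assms in simp_all)
  then show "lact (q (K_trans_X w y), ?h) y = w" using lact_eq[OF x(1) assms(2) h x(2)] by simp
qed

text \<open>The orbits are the fibres of the momentum map of the other side. This yields both the
  homeomorphism from the orbit space and the invariance of that momentum map.\<close>

lemma left_orbit_K:
  assumes "y \<in> arrows X"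
  shows "left_orbit K mom lact y = {w \<in> arrows X. p (src X w) = p (src X y)}"
proof
  show "left_orbit K mom lact y \<subseteq> {w \<in> arrows X. p (src X w) = p (src X y)}"
  proof
    fix w assume "w \<in> left_orbit K mom lact y"
    then obtain k where "w = lact k y" "k \<in> arrows K" "src K k = mom y"
      unfolding left_orbit_def[of K] by blast
    then show "w \<in> {w \<in> arrows X. p (src X w) = p (src X y)}" using lact_closed assms by blast
  qed
  show "{w \<in> arrows X. p (src X w) = p (src X y)} \<subseteq> left_orbit K mom lact y"
  proof clarify
    fix w assume w: "w \<in> arrows X" "p (src X w) = p (src X y)"
    note t = K_trans[OF w(1) assms w(2)]
    show "w \<in> left_orbit K mom lact y"
      using K_pairI[OF t(1) assms t(2-4)] t(5) unfolding left_orbit_def[of K]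
      by (intro CollectI exI[of _ "(q (K_trans_X w y), K_trans_H w y)"] conjI) (simp_all only:)
  qed
qed

lemma proper_left_K: "proper_left K (arr_top X) mom lact"
  unfolding proper_left_def
proof (rule proper_map_retract)
  let ?XX = "prod_topology (arr_top X) (arr_top X)"
  let ?C = "{c \<in> topspace ?XX. p (src X (fst c)) = p (src X (snd c))}"
  let ?g = "\<lambda>c. ((q (K_trans_X (fst c) (snd c)), K_trans_H (fst c) (snd c)), snd c)"
  have pairs: "(k, y) \<in> topspace (left_pairs K (arr_top X) mom) \<longleftrightarrow>
      k \<in> arrows K \<and> y \<in> arrows X \<and> src K k = mom y" for k y
    unfolding left_pairs_def by (simp del: XG.left_product_arrows)
  have snd: "continuous_map (left_pairs K (arr_top X) mom) (arr_top X) snd"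
    by (simp add: left_pairs_def continuous_map_from_subtopology continuous_map_snd)
  show "continuous_map (left_pairs K (arr_top X) mom) ?XX (\<lambda>(k, z). (lact k z, z))"
    using continuous_map_pairedI[OF continuous_map_lact snd] by (simp add: case_prod_unfold)
  \<comment> \<open>\<open>?C\<close> is the equaliser of two continuous maps into the arrow space
    of the quotient of \<open>X\<close> by \<open>H\<close>, which is Hausdorff.\<close>
  have "continuous_map ?XX (arr_top left.Q) (\<lambda>c. p (src X (fst c)))"
    "continuous_map ?XX (arr_top left.Q) (\<lambda>c. p (src X (snd c)))"
    by (intro left.continuous_map_p left.X.continuous_map_src continuous_map_fst continuous_map_snd)+
  then show "closedin ?XX ?C"
    using closedin_continuous_maps_eq lc_groupoid.Hausdorff[OF left.lc_groupoid_quotient] by blast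
  show "(case a of (k, z) \<Rightarrow> (lact k z, z)) \<in> ?C" if "a \<in> topspace (left_pairs K (arr_top X) mom)" for a
  proof -
    obtain k y where ky: "a = (k, y)" by (cases a)
    then have "k \<in> arrows K" "y \<in> arrows X" "src K k = mom y" using that pairs by blast+
    then show ?thesis using ky lact_closed[of k y] by simp
  qed
  have C: "c \<in> topspace (subtopology ?XX ?C) \<longleftrightarrow> fst c \<in> arrows X \<and> snd c \<in> arrows X \<and>
      p (src X (fst c)) = p (src X (snd c))" for c
    by (cases c) auto
  show "continuous_map (subtopology ?XX ?C) (left_pairs K (arr_top X) mom) ?g"
  proof -
    let ?T = "subtopology ?XX ?C"
    have c: "continuous_map ?T (arr_top X) fst" "continuous_map ?T (arr_top X) snd"
      by (simp_all add: continuous_map_from_subtopology continuous_map_fst continuous_map_snd)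
    have tr: "continuous_map ?T (arr_top H) (\<lambda>c. left.space.tr (src X (fst c)) (src X (snd c)))"
      by (intro left.space.continuous_map_tr left.X.continuous_map_src c) (simp add: C)
    have h: "continuous_map ?T (arr_top H) (\<lambda>c. K_trans_H (fst c) (snd c))"
      by (intro left.continuous_map_res tr left.X.continuous_map_ginv c)
        (simp add: mem_Times_iff left.space.tr(2)[of "src X (fst _)" "src X (snd _)"])
    have hy: "continuous_map ?T (arr_top X) (\<lambda>c. la (K_trans_H (fst c) (snd c)) (snd c))"
      by (intro left.space.continuous_map_act h c) (simp add: K_trans(3) mem_Times_iff)
    have x: "continuous_map ?T (arr_top X) (\<lambda>c. K_trans_X (fst c) (snd c))"
    proof (intro left.X.continuous_map_mul left.X.continuous_map_ginv c hy)
      fix c assume "c \<in> topspace ?T"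
      then have a: "fst c \<in> arrows X" "snd c \<in> arrows X" "p (src X (fst c)) = p (src X (snd c))"
        using C by blast+
      note t = K_trans[OF a]
      show "src X (fst c) = rng X (ginv X (la (K_trans_H (fst c) (snd c)) (snd c)))"
        using t(2,3,6) a(2) left.act_closed[OF t(2) a(2)] by simp
    qed
    have m: "?g c \<in> topspace (left_pairs K (arr_top X) mom)" if "c \<in> topspace ?T" for c
    proof -
      have a: "fst c \<in> arrows X" "snd c \<in> arrows X" "p (src X (fst c)) = p (src X (snd c))"
        using C that by blast+
      show ?thesis unfolding pairs using K_pairI[OF K_trans(1)[OF a] a(2) K_trans(2-4)[OF a]] a(2) by blast
    qed
    have "continuous_map ?T (arr_top K) (\<lambda>c. (q (K_trans_X (fst c) (snd c)), K_trans_H (fst c) (snd c)))"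
      unfolding XG.continuous_map_into_left_product fst_conv snd_conv
      by (intro conjI ballI continuous_map_q x h) (use m pairs in blast)
    then have "continuous_map ?T (prod_topology (arr_top K) (arr_top X)) ?g"
      by (intro continuous_map_pairedI c)
    then show ?thesis using m pairs
      unfolding left_pairs_def continuous_map_in_subtopology by blast
  qed
  show "?g (case a of (k, z) \<Rightarrow> (lact k z, z)) = a"
    if a: "a \<in> topspace (left_pairs K (arr_top X) mom)" for a
  proof -
    obtain k y where ky: "a = (k, y)" by (cases a)
    then have k: "k \<in> arrows K" "y \<in> arrows X" "src K k = mom y" using a pairs by blast+
    obtain x h where x: "k = (q x, h)" "x \<in> arrows X" "h \<in> arrows H" "src H h = \<rho>0 (rng X y)"
      "src X x = la h (rng X y)"
      using K_pairE[OF k] .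
    have l: "lact k y = x \<odot>\<^bsub>X\<^esub> la h y" using x k lact_eq by simp
    have s: "src X (lact k y) = la (lr h y) (src X y)" unfolding l using x k by simp
    \<comment> \<open>Solving backwards: x (h \<rhd> y) has source (h \<lhd> y) \<rhd> s(y), so the
      translator is h \<lhd> y; restricting along y\<inverse> returns h, and dividing by h \<rhd> y
      returns x.\<close>
    have "left.space.tr (src X (lact k y)) (src X y) = lr h y"
      unfolding s by (rule left.space.tr_eqI) (use x k in simp_all)
    moreover have "lr (lr h y) (ginv X y) = h"
      using left.res_mul[of h y "ginv X y", symmetric] x k by (simp add: left.X.mul_inv)
    ultimately have h: "K_trans_H (lact k y) y = h" by simp
    have "x \<odot>\<^bsub>X\<^esub> la h y \<odot>\<^bsub>X\<^esub> ginv X (la h y) = x" using x k by simp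
    then have "K_trans_X (lact k y) y = x" unfolding h unfolding l .
    then show ?thesis using ky x(1) h by simp
  qed
  show "(case ?g c of (k, z) \<Rightarrow> (lact k z, z)) = c" if "c \<in> ?C" for c
    using that K_trans(5)[of "fst c" "snd c"] by auto
qed

end

section \<open>Passage to the opposite side\<close>

context groupoid_anti_isomorphism
begin

lemma homeomorphic_map_unit_spaces: "homeomorphic_map (unit_space K) (unit_space L) f"
proof (rule homeomorphic_maps_imp_map)
  have "continuous_map (unit_space K) (arr_top L) f" "continuous_map (unit_space L) (arr_top K) g"
    unfolding unit_space_def
    by (simp_all add: continuous_map_from_subtopology continuous_f continuous_g)
  then show "homeomorphic_maps (unit_space K) (unit_space L) f g"
    by (auto simp: homeomorphic_maps_def units unit_space_def continuous_map_in_subtopology)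
qed

end

text \<open>In the product of the opposites, (y, t) times (x, s) has the entries
  \<open>ra x t\<close> times y and s times \<open>rr x t\<close>. These are the entries of (s, x)
  times (t, y) in exchanged order, so \<open>prod.swap\<close> reverses products.\<close>

lemma groupoid_anti_isomorphism_products:
  assumes "lc_groupoid (left_product (opposite Y) (opposite G) \<sigma> (\<lambda>t y. ra y t) (\<lambda>t y. rr y t))"
  shows "groupoid_anti_isomorphism
    (left_product (opposite Y) (opposite G) \<sigma> (\<lambda>t y. ra y t) (\<lambda>t y. rr y t))
    (right_product G Y \<sigma> ra rr) prod.swap prod.swap"
  (is "groupoid_anti_isomorphism ?K ?L _ _")
proof -
  have "continuous_map (arr_top ?K) (arr_top ?L) prod.swap" "continuous_map (arr_top ?L) (arr_top ?K) prod.swap"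
    unfolding prod.swap_def
    by (auto simp: left_product_def right_product_def continuous_map_in_subtopology
        continuous_map_from_subtopology continuous_map_fst continuous_map_snd intro!: continuous_map_pairedI)
  then show ?thesis
    by (intro groupoid_anti_isomorphism.intro assms groupoid_anti_isomorphism_axioms.intro)
      (auto simp: homeomorphic_maps_def left_product_def right_product_def Let_def image_image)
qed

text \<open>Letting l act by the corresponding arrow of \<open>K\<close> turns a left action of
  \<open>K\<close> into a right action of \<open>L\<close>, since the correspondence reverses
  products. Freeness, properness and the orbits carry over.\<close>

locale anti_isomorphic_action =
  groupoid_anti_isomorphism K L f g + free_proper_action K Z m act
  for K :: "'k groupoid" and L :: "'l groupoid" and f g
    and Z :: "'z topology" and m :: "'z \<Rightarrow> 'k" and act :: "'k \<Rightarrow> 'z \<Rightarrow> 'z"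
begin

abbreviation "n z \<equiv> f (m z)"
abbreviation "ract z l \<equiv> act (g l) z"

lemma momentum_iff: "z \<in> topspace Z \<Longrightarrow> l \<in> arrows L \<Longrightarrow> n z = rng L l \<longleftrightarrow> src K (g l) = m z"
  by (erule arrow_cases) (auto simp: rng f_eq_iff momentum_unit)

lemma homeomorphic_maps_pairs:
  "homeomorphic_maps (right_pairs Z L n) (left_pairs K Z m) (\<lambda>(z, l). (g l, z)) (\<lambda>(k, z). (z, f k))"
proof -
  have r: "(z, l) \<in> topspace (right_pairs Z L n) \<longleftrightarrow> z \<in> topspace Z \<and> l \<in> arrows L \<and> src K (g l) = m z" for z l
    using momentum_iff by (auto simp: right_pairs_def)
  have c: "continuous_map (right_pairs Z L n) Z fst" "continuous_map (right_pairs Z L n) (arr_top L) snd"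
    "continuous_map (left_pairs K Z m) (arr_top K) fst" "continuous_map (left_pairs K Z m) Z snd"
    unfolding right_pairs_def left_pairs_def
    by (simp_all add: continuous_map_from_subtopology continuous_map_fst continuous_map_snd)
  have gf: "continuous_map (right_pairs Z L n) (arr_top K) (\<lambda>p. g (snd p))"
    "continuous_map (left_pairs K Z m) (arr_top L) (\<lambda>p. f (fst p))"
    using continuous_map_compose[OF c(2) continuous_g] continuous_map_compose[OF c(3) continuous_f]
    by (simp_all add: o_def)
  have "continuous_map (right_pairs Z L n) (left_pairs K Z m) (\<lambda>(z, l). (g l, z))"
    unfolding case_prod_unfold using continuous_map_pairedI[OF gf(1) c(1)] r
    by (subst left_pairs_def) (auto simp: continuous_map_in_subtopology)
  moreover have "continuous_map (left_pairs K Z m) (right_pairs Z L n) (\<lambda>(k, z). (z, f k))"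
    unfolding case_prod_unfold using continuous_map_pairedI[OF c(4) gf(2)]
    by (subst right_pairs_def) (auto simp: continuous_map_in_subtopology topspace_left_pairs rng)
  ultimately show ?thesis
    unfolding homeomorphic_maps_def using r by (auto simp: topspace_left_pairs)
qed

lemma right_action: "right_groupoid_action L Z n ract"
proof
  show "continuous_map Z (unit_space L) n"
    using continuous_map_compose[OF continuous_momentum
        homeomorphic_imp_continuous_map[OF homeomorphic_map_unit_spaces]]
    by (simp add: o_def)
  have "continuous_map (right_pairs Z L n) (left_pairs K Z m) (\<lambda>(z, l). (g l, z))"
    using homeomorphic_maps_pairs unfolding homeomorphic_maps_def by blast
  from continuous_map_compose[OF this continuous_act]
  show "continuous_map (right_pairs Z L n) Z (\<lambda>(z, l). ract z l)"
    by (simp add: o_def case_prod_unfold)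
  fix z assume z: "z \<in> topspace Z"
  show "ract z (n z) = z" using z momentum_unit unit_act by simp
  fix k l
  show "n (ract z l) = src L l" if l: "l \<in> arrows L" and m: "n z = rng L l"
  proof -
    have "src K (g l) = m z" using momentum_iff[OF z l] m by blast
    moreover have "src L (f (g l)) = f (rng K (g l))" by (rule src[OF g_arrow[OF l]])
    ultimately show ?thesis using z l momentum_act by simp
  qed
  show "ract z (k \<odot>\<^bsub>L\<^esub> l) = ract (ract z k) l" if kl: "(k, l) \<in> composable L" and m: "n z = rng L k"
  proof -
    have "k \<in> arrows L" "l \<in> arrows L" "src L k = rng L l" using kl by auto
    then obtain a b where ab: "a \<in> arrows K" "b \<in> arrows K" "k = f a" "l = f b" "rng K a = src K b"
      by (metis arrow_cases rng src f_eq_iff src_arrow rng_arrow)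
    then have "src K a = m z" using momentum_iff[OF z, of k] m by simp
    then show ?thesis using ab z mul[of b a] mul_act[of b a z] by simp
  qed
qed

lemma free_right: "free_right L Z n ract"
  unfolding free_right_def
proof (intro ballI impI)
  fix z l assume z: "z \<in> topspace Z" and l: "l \<in> arrows L"
    and m: "n z = rng L l" and e: "ract z l = z"
  have "g l \<in> units K"
    by (rule free[unfolded free_left_def, rule_format, OF g_arrow[OF l] z _ e])
      (use momentum_iff[OF z l] m in blast)
  then have "f (g l) \<in> units L" unfolding units by (rule imageI)
  then show "l \<in> units L" using l by simp
qed

lemma proper_right: "proper_right L Z n ract"
proof -
  have *: "proper_map (right_pairs Z L n) (prod_topology Z Z)
      (prod.swap \<circ> ((\<lambda>(k, z). (act k z, z)) \<circ> (\<lambda>(z, l). (g l, z))))"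
    using homeomorphic_imp_proper_map[OF homeomorphic_maps_imp_map[OF homeomorphic_maps_pairs]] proper
      proper_map_swap[of Z Z]
    unfolding proper_left_def by (intro proper_map_compose)
  have "prod.swap \<circ> ((\<lambda>(k, z). (act k z, z)) \<circ> (\<lambda>(z, l). (g l, z))) = (\<lambda>(z, l). (z, ract z l))"
    by auto
  with * show ?thesis unfolding proper_right_def by (simp only:)
qed

lemma right_orbit_eq: "z \<in> topspace Z \<Longrightarrow> right_orbit L n ract z = left_orbit K m act z"
  unfolding right_orbit_def left_orbit_def
  by (auto simp: momentum_iff) (metis f_arrow g_f momentum_iff)

end

lemma (in tuned_actions) dual: "tuned_actions G' (opposite X) \<sigma>0 ga gr H \<rho>0 la lr"
proof -
  \<comment> \<open>The locale places its second action on the opposite of its groupoid, here the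
    double opposite of \<open>X\<close>, which is \<open>X\<close> again.\<close>
  interpret op: quotient_action H "opposite (opposite X)" \<rho>0 la lr by simp unfold_locales
  show ?thesis
    by unfold_locales (use open_source_opposite[OF left.X.lc_groupoid_axioms open_X] tune in auto)
qed

text \<open>With k given by the class of x and by h, and l by the class of w and by t, both sides
  equal the triple product of \<open>ga ?s x\<close>, \<open>la h (ga t z)\<close> and
  \<open>la ?k w\<close>, where \<open>?s = gr t z\<close> and \<open>?k = lr h z\<close>. The dual
  product groupoid is spelled out as \<open>D\<close>, its interpretation being made only inside the
  proof.\<close>

lemma (in tuned_actions) lact_commute:
  assumes k: "k \<in> arrows K" "src K k = mom z" and z: "z \<in> arrows X"
    and D: "D = left_product (quotient_groupoid (opposite X) p) G' (on_class \<sigma>0)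
      (\<lambda>t. on_class (\<lambda>x. p (ga t x))) (\<lambda>t. on_class (gr t))"
    and l: "l \<in> arrows D" "src D l = (p (src X z), on_class \<sigma>0 (p (src X z)))"
  shows "tuned_actions.lact (opposite X) ga l (lact k z) = lact k (tuned_actions.lact (opposite X) ga l z)"
proof -
  interpret D: tuned_actions G' "opposite X" \<sigma>0 ga gr H \<rho>0 la lr by (rule dual)
  obtain x h where x: "k = (q x, h)" "x \<in> arrows X" "h \<in> arrows H" "src H h = \<rho>0 (rng X z)"
      "src X x = la h (rng X z)"
    using K_pairE[OF k(1) z k(2)] .
  have "l \<in> arrows D.K" "src D.K l = D.mom z" "z \<in> arrows (opposite X)" using l z by (simp_all add: D)
  from D.K_pairE[OF this(1,3,2)] obtain w t where
    w: "l = (p w, t)" "w \<in> arrows X" "t \<in> arrows G'" "src G' t = \<sigma>0 (src X z)" "rng X w = ga t (src X z)"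
    by auto
  \<comment> \<open>When t passes through x (h \<rhd> z), it reaches x as
    \<open>gr t (la h z)\<close>, which is \<open>gr t z\<close> as the actions are in tune.
    Likewise h reaches w as \<open>lr h (ga t z)\<close>, which is \<open>lr h z\<close>.\<close>
  let ?s = "gr t z" and ?k = "lr h z"
  have k': "?k \<in> arrows H" "src H ?k = \<rho>0 (src X z)" using x z by simp_all
  have s': "?s \<in> arrows G'" "src G' ?s = \<sigma>0 (rng X z)" using w z by simp_all
  have D_lact: "D.lact (p v, t) y = ga t y \<odot>\<^bsub>X\<^esub> v"
    if "v \<in> arrows X" "y \<in> arrows X" "src G' t = \<sigma>0 (src X y)" "rng X v = ga t (src X y)" for v y
    using D.lact_eq[of v y t] that w(3) by simp
  have t1: "ga t (la h z) = la h (ga t z)" "gr t (la h z) = gr t z" "lr h (ga t z) = lr h z"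
    "\<sigma>0 (src X (la h z)) = \<sigma>0 (src X z)" "\<rho>0 (rng X (ga t z)) = \<rho>0 (rng X z)"
    using tune[OF x(3) z w(3)] x w by simp_all
  \<comment> \<open>The in-tune conditions at the unit s(z) for \<open>?k\<close> and t, and in
    \<open>t3\<close> at the unit r(z) for h and \<open>?s\<close>. They place \<open>?w\<close> and
    \<open>?x\<close> so that the products below are defined.\<close>
  have t2: "la ?k (ga t (src X z)) = ga t (la ?k (src X z))"
    "\<sigma>0 (la ?k (src X z)) = \<sigma>0 (src X z)" "\<rho>0 (ga t (src X z)) = \<rho>0 (src X z)"
  proof -
    have a: "src X z \<in> arrows X" "src H ?k = \<rho>0 (rng X (src X z))" "\<sigma>0 (src X (src X z)) = src G' t"
      using k' w z by simp_all
    have u: "src X (la ?k (src X z)) = la ?k (src X z)" "rng X (ga t (src X z)) = ga t (src X z)"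
      using left.act_unit[of ?k "src X z"] ga_unit[of t "src X z"] k' w z
        left.X.src_unit left.X.rng_unit left.X.src_units by metis+
    from tune[OF k'(1) a(1) w(3) a(2,3)]
    show "la ?k (ga t (src X z)) = ga t (la ?k (src X z))"
      "\<sigma>0 (la ?k (src X z)) = \<sigma>0 (src X z)" "\<rho>0 (ga t (src X z)) = \<rho>0 (src X z)"
      unfolding u using z by simp_all
  qed
  have t3: "la h (ga ?s (rng X z)) = ga ?s (la h (rng X z))"
    "\<sigma>0 (la h (rng X z)) = \<sigma>0 (rng X z)" "\<rho>0 (ga ?s (rng X z)) = \<rho>0 (rng X z)"
  proof -
    have a: "rng X z \<in> arrows X" "src H h = \<rho>0 (rng X (rng X z))" "\<sigma>0 (src X (rng X z)) = src G' ?s"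
      using s' x z by simp_all
    have u: "src X (la h (rng X z)) = la h (rng X z)" "rng X (ga ?s (rng X z)) = ga ?s (rng X z)"
      using left.act_unit[of h "rng X z"] ga_unit[of ?s "rng X z"] s' x z
        left.X.src_unit left.X.rng_unit left.X.rng_units by metis+
    from tune[OF x(3) a(1) s'(1) a(2,3)]
    show "la h (ga ?s (rng X z)) = ga ?s (la h (rng X z))"
      "\<sigma>0 (la h (rng X z)) = \<sigma>0 (rng X z)" "\<rho>0 (ga ?s (rng X z)) = \<rho>0 (rng X z)"
      unfolding u using z by simp_all
  qed
  \<comment> \<open>Each action moves the point, so the representative used by the other one has to
    be changed within its class: w to \<open>?w\<close> and x to \<open>?x\<close>.\<close>
  let ?w = "la ?k w" and ?x = "ga ?s x"
  have w': "?w \<in> arrows X" "rng X ?w = la ?k (ga t (src X z))" "p ?w = p w"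
    using w k' t2 by simp_all
  have x': "?x \<in> arrows X" "src X ?x = ga ?s (la h (rng X z))" "q ?x = q x"
    using x s' t3 by simp_all
  have a: "x \<odot>\<^bsub>X\<^esub> la h z \<in> arrows X" "src X (x \<odot>\<^bsub>X\<^esub> la h z) = la ?k (src X z)" "la h z \<in> arrows X"
    using x z by simp_all
  have b: "ga t z \<odot>\<^bsub>X\<^esub> w \<in> arrows X" "rng X (ga t z \<odot>\<^bsub>X\<^esub> w) = ga ?s (rng X z)" "ga t z \<in> arrows X"
    using w z by simp_all
  have "D.lact l (lact k z) = D.lact (p ?w, t) (x \<odot>\<^bsub>X\<^esub> la h z)"
    unfolding x(1) w(1) w'(3) using x z by (simp add: lact_eq)
  also have "\<dots> = ga t (x \<odot>\<^bsub>X\<^esub> la h z) \<odot>\<^bsub>X\<^esub> ?w"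
    by (rule D_lact) (use w w' a t2 in simp_all)
  also have "ga t (x \<odot>\<^bsub>X\<^esub> la h z) = ?x \<odot>\<^bsub>X\<^esub> la h (ga t z)"
  proof -
    have "rng X (la h z) = src X x" using x z by simp
    from ga_mul[OF w(3) a(3) x(2) this] show ?thesis using t1 w(4) by simp
  qed
  also have "?x \<odot>\<^bsub>X\<^esub> la h (ga t z) \<odot>\<^bsub>X\<^esub> ?w = ?x \<odot>\<^bsub>X\<^esub> la h (ga t z \<odot>\<^bsub>X\<^esub> w)"
  proof -
    have e: "src X (ga t z) = rng X w" "src H h = \<rho>0 (rng X (ga t z))" using w z x t1(5) by simp_all
    have "src X ?x = rng X (la h (ga t z))"
      unfolding x'(2) using t3(1) left.rng_act[OF x(3) b(3) e(2)] w z by simp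
    moreover have "src X (la h (ga t z)) = rng X ?w"
      unfolding w'(2) using left.src_act_eq[OF x(3) b(3) e(2)] t1(3) w z by simp
    moreover have "la h (ga t z) \<in> arrows X" using x b e by simp
    ultimately show ?thesis
      using left.act_mul[OF x(3) b(3) w(2) e] t1(3) left.X.mul_assoc'[OF x'(1) _ w'(1)] by simp
  qed
  also have "\<dots> = lact (q ?x, h) (ga t z \<odot>\<^bsub>X\<^esub> w)"
    by (rule lact_eq[symmetric]) (use x x' b t3 in simp_all)
  also have "\<dots> = lact k (D.lact l z)"
    unfolding x'(3) x(1) w(1) using D_lact[of w z] w z by simp
  finally show ?thesis .
qed


section \<open>The equivalence\<close>

theorem theorem3p10:
  fixes H :: "'h groupoid" and G :: "'g groupoid" and X :: "'x groupoid"
    and \<rho>0 :: "'x \<Rightarrow> 'h" and la :: "'h \<Rightarrow> 'x \<Rightarrow> 'x" and lr :: "'h \<Rightarrow> 'x \<Rightarrow> 'h"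
    and \<sigma>0 :: "'x \<Rightarrow> 'g" and ra :: "'x \<Rightarrow> 'g \<Rightarrow> 'x" and rr :: "'x \<Rightarrow> 'g \<Rightarrow> 'g"
  assumes "lc_groupoid H" "lc_groupoid G" "lc_groupoid X"
    and "open_source H" "open_source G" "open_source X"
    and "self_similar_left H X \<rho>0 la lr"
    and "free_left H (arr_top X) (rho_mom X \<rho>0) la"
    and "proper_left H (arr_top X) (rho_mom X \<rho>0) la"
    and "self_similar_right G X \<sigma>0 ra rr"
    and "free_right G (arr_top X) (sigma_mom X \<sigma>0) ra"
    and "proper_right G (arr_top X) (sigma_mom X \<sigma>0) ra"
    and "in_tune H G X \<rho>0 la lr \<sigma>0 ra rr"
  shows
    "let p = left_orbit H (rho_mom X \<rho>0) la;
         q = right_orbit G (sigma_mom X \<sigma>0) ra;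
         K = quotient_left_product X q H \<rho>0 la lr;
         L = right_quotient_product G X p \<sigma>0 ra rr;
         \<iota> = (\<lambda>\<omega>. (\<omega>, on_class \<rho>0 \<omega>));
         \<kappa> = (\<lambda>\<omega>. (on_class \<sigma>0 \<omega>, \<omega>));
         m = (\<lambda>x. \<iota> (q (rng X x)));
         n = (\<lambda>x. \<kappa> (p (src X x)))
     in homeomorphic_map (quotient_topology (unit_space X) q) (unit_space K) \<iota> \<and>
        homeomorphic_map (quotient_topology (unit_space X) p) (unit_space L) \<kappa> \<and>
        (\<forall>\<xi> h y. (\<xi>, h) \<in> arrows K \<longrightarrow> y \<in> arrows X \<longrightarrow> src K (\<xi>, h) = m y \<longrightarrow>
           (\<exists>!x. x \<in> \<xi> \<and> (x, la h y) \<in> composable X)) \<and>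
        (\<forall>y t \<eta>. y \<in> arrows X \<longrightarrow> (t, \<eta>) \<in> arrows L \<longrightarrow> n y = rng L (t, \<eta>) \<longrightarrow>
           (\<exists>!z. z \<in> \<eta> \<and> (ra y t, z) \<in> composable X)) \<and>
        groupoid_equivalence K L (arr_top X) m n
          (\<lambda>(\<xi>, h) y. (THE x. x \<in> \<xi> \<and> (x, la h y) \<in> composable X) \<odot>\<^bsub>X\<^esub> la h y)
          (\<lambda>y (t, \<eta>). ra y t \<odot>\<^bsub>X\<^esub> (THE z. z \<in> \<eta> \<and> (ra y t, z) \<in> composable X))"
proof -
  interpret left: self_similar_left H X \<rho>0 la lr by fact
  interpret left: quotient_action H X \<rho>0 la lr by unfold_locales fact+
  interpret right: self_similar_left "opposite G" "opposite X" \<sigma>0 "\<lambda>t x. ra x t" "\<lambda>t x. rr x t"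
    by (rule self_similar_left_opposite) fact
  interpret right: quotient_action "opposite G" "opposite X" \<sigma>0 "\<lambda>t x. ra x t" "\<lambda>t x. rr x t"
    by unfold_locales (use assms free_left_opposite proper_left_opposite open_source_opposite in auto)
  interpret T: tuned_actions H X \<rho>0 la lr "opposite G" \<sigma>0 "\<lambda>t x. ra x t" "\<lambda>t x. rr x t"
    by unfold_locales (use assms(6,13) in \<open>auto simp: in_tune_def\<close>)
  \<comment> \<open>The right-hand side read as a left-hand one: the orbit map \<open>D.p\<close>
    belongs to \<open>G\<close> and \<open>D.q\<close> to \<open>H\<close>.\<close>
  interpret D: tuned_actions "opposite G" "opposite X" \<sigma>0 "\<lambda>t x. ra x t" "\<lambda>t x. rr x t" H \<rho>0 la lr
    by (rule T.dual)
  define p where "p = left_orbit H (rho_mom X \<rho>0) la"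
  define q where "q = right_orbit G (sigma_mom X \<sigma>0) ra"
  define K where "K = quotient_left_product X q H \<rho>0 la lr"
  define L where "L = right_quotient_product G X p \<sigma>0 ra rr"
  define m where "m = (\<lambda>x. (q (rng X x), on_class \<rho>0 (q (rng X x))))"
  define n where "n = (\<lambda>x. (on_class \<sigma>0 (p (src X x)), p (src X x)))"
  define lact where "lact = (\<lambda>(\<xi>, h) y. (THE x. x \<in> \<xi> \<and> (x, la h y) \<in> composable X) \<odot>\<^bsub>X\<^esub> la h y)"
  define ract where "ract = (\<lambda>y (t, \<eta>). ra y t \<odot>\<^bsub>X\<^esub> (THE z. z \<in> \<eta> \<and> (ra y t, z) \<in> composable X))"
  have q: "T.q = q" by (simp add: q_def right_orbit_opposite)
  have K: "left_product (quotient_groupoid X q) H (on_class \<rho>0) (\<lambda>h. on_class (\<lambda>x. q (la h x)))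
      (\<lambda>h. on_class (lr h)) = K"
    by (simp add: K_def quotient_left_product_def)
  have m: "(\<lambda>x. (q (rng X x), on_class \<rho>0 (q (rng X x)))) = m" by (simp add: m_def)
  have lact: "T.lact = lact" unfolding lact_def T.lact_def ..
  define D_K where "D_K = D.K"
  have Dq: "D.q = p" by (simp add: p_def)
  have Dp: "D.p = q" using q by simp
  have composable_flip: "(z, w) \<in> composable (opposite X) \<longleftrightarrow> (w, z) \<in> composable X" for w z
    by auto
  have ract: "ract z (t, \<eta>) = D.lact (\<eta>, t) z" for z t \<eta>
    by (simp add: ract_def D.lact_def composable_flip del: composable_iff)
  have ract': "ract = (\<lambda>z l. D.lact (prod.swap l) z)"
    by (intro ext) (metis ract swap_simp prod.collapse)
  have D_K: "D_K = left_product (opposite (quotient_groupoid X p)) (opposite G) (on_class \<sigma>0)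
      (\<lambda>t. on_class (\<lambda>x. p (ra x t))) (\<lambda>t. on_class (\<lambda>x. rr x t))"
    unfolding D_K_def Dq quotient_groupoid_opposite ..
  \<comment> \<open>\<open>L\<close> is reached by the swap from \<open>D_K\<close>, the first
    product groupoid of the dual situation; \<open>act\<close> then carries the dual action to a
    right action of \<open>L\<close>.\<close>
  have "lc_groupoid D_K" unfolding D_K_def by (rule D.XG.lc_groupoid_left_product)
  then interpret iso: groupoid_anti_isomorphism D_K L prod.swap prod.swap
    unfolding D_K L_def right_quotient_product_def by (rule groupoid_anti_isomorphism_products)
  interpret D_act: left_groupoid_action D_K "arr_top X" D.mom D.lact
    using D.left_groupoid_action_K unfolding D_K_def by simp
  interpret act: anti_isomorphic_action D_K L prod.swap prod.swap "arr_top X" D.mom D.lact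
    by unfold_locales (use D.free_left_K D.proper_left_K in \<open>simp_all add: D_K_def\<close>)
  have n: "(\<lambda>z. prod.swap (D.mom z)) = n" by (simp add: n_def p_def)
  note right_facts = act.right_action act.free_right act.proper_right
  \<comment> \<open>The dual description of orbits speaks of the source in
    \<open>opposite X\<close>, that is, of the range in \<open>X\<close>: the orbits of
    \<open>L\<close> are the fibres of \<open>m\<close>.\<close>
  have orbits: "right_orbit L n ract y = {w \<in> arrows X. q (rng X w) = q (rng X y)}"
    if "y \<in> arrows X" for y
    using act.right_orbit_eq[of y] D.left_orbit_K[of y] that
    unfolding n ract'[symmetric] D_K_def[symmetric] Dp by simp
  have orbits': "left_orbit K m lact y = {w \<in> arrows X. p (src X w) = p (src X y)}"
    if "y \<in> arrows X" for y
    using T.left_orbit_K[OF that] unfolding q K m lact p_def .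
  have \<iota>: "homeomorphic_map (quotient_topology (unit_space X) q) (unit_space K) (\<lambda>\<omega>. (\<omega>, on_class \<rho>0 \<omega>))"
    using T.homeomorphic_map_units_K unfolding q K .
  have "homeomorphic_map (quotient_topology (unit_space X) p) (unit_space D_K) (\<lambda>\<omega>. (\<omega>, on_class \<sigma>0 \<omega>))"
    using D.homeomorphic_map_units_K unfolding Dq by (simp add: D_K quotient_groupoid_opposite)
  from homeomorphic_map_compose[OF this iso.homeomorphic_map_unit_spaces]
  have \<kappa>: "homeomorphic_map (quotient_topology (unit_space X) p) (unit_space L) (\<lambda>\<omega>. (on_class \<sigma>0 \<omega>, \<omega>))"
    by (simp add: o_def)
  have ex1: "\<exists>!x. x \<in> \<xi> \<and> (x, la h y) \<in> composable X"
    if "(\<xi>, h) \<in> arrows K" "y \<in> arrows X" "src K (\<xi>, h) = m y" for \<xi> h y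
    using T.lact_ex1[of \<xi> h y] that unfolding q K by (simp add: m_def)
  have ex1': "\<exists>!z. z \<in> \<eta> \<and> (ra y t, z) \<in> composable X"
    if y: "y \<in> arrows X" and t: "(t, \<eta>) \<in> arrows L" "n y = rng L (t, \<eta>)" for y t \<eta>
  proof -
    have "(\<eta>, t) \<in> arrows D_K" "src D_K (\<eta>, t) = D.mom y"
      using iso.g_arrow[OF t(1)] act.momentum_iff[OF y t(1)] t(2) unfolding n[symmetric] by simp_all
    then show ?thesis
      using D.lact_ex1[of \<eta> t y] y unfolding D_K_def composable_flip by simp
  qed
  have m_quot: "quotient_map (arr_top X) (unit_space K) m" "open_map (arr_top X) (unit_space K) m"
    using T.quotient_map_mom T.open_map_mom unfolding q K m by blast+
  have "quotient_map (arr_top X) (unit_space D_K) D.mom" "open_map (arr_top X) (unit_space D_K) D.mom"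
    using D.quotient_map_mom D.open_map_mom unfolding D_K_def by simp_all
  then have n_quot: "quotient_map (arr_top X) (unit_space L) n" "open_map (arr_top X) (unit_space L) n"
    using quotient_map_compose[of _ _ D.mom] open_map_compose[of _ _ D.mom]
      iso.homeomorphic_map_unit_spaces homeomorphic_imp_open_map[OF iso.homeomorphic_map_unit_spaces]
    unfolding n[symmetric] homeomorphic_map_def o_def by blast+
  have lcK: "lc_groupoid K" using T.XG.lc_groupoid_left_product unfolding q K .
  have lactK: "left_groupoid_action K (arr_top X) m lact"
    using T.left_groupoid_action_K unfolding q K m lact .
  have equiv: "groupoid_equivalence K L (arr_top X) m n lact ract"
  proof (intro groupoid_equivalence.intro groupoid_equivalence_axioms.intro)
    show "lc_groupoid K" "left_groupoid_action K (arr_top X) m lact" by fact+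
    show "lc_groupoid L" by (rule iso.lc_groupoid_image)
    show "right_groupoid_action L (arr_top X) n ract" "free_right L (arr_top X) n ract"
      "proper_right L (arr_top X) n ract"
      using right_facts unfolding n ract' by blast+
    show "locally_compact_space (arr_top X)" "Hausdorff_space (arr_top X)"
      by (rule left.X.locally_compact left.X.Hausdorff)+
    show "free_left K (arr_top X) m lact" "proper_left K (arr_top X) m lact"
      using T.free_left_K T.proper_left_K unfolding q K m lact by blast+
    show "open_map (arr_top X) (unit_space K) m" "open_map (arr_top X) (unit_space L) n" by fact+
    show "m ` arrows X = units K" "n ` arrows X = units L"
      using quotient_imp_surjective_map[OF m_quot(1)] quotient_imp_surjective_map[OF n_quot(1)]
        lc_groupoid.units_arrows[OF lcK] lc_groupoid.units_arrows[OF iso.lc_groupoid_image]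
      by (simp_all only: topspace_unit_space Int_absorb1)
    show "homeomorphic_map (quotient_topology (arr_top X) (right_orbit L n ract)) (unit_space K) (on_class m)"
      by (rule homeomorphic_map_on_class[OF m_quot(1)]) (auto simp: orbits m_def)
    show "homeomorphic_map (quotient_topology (arr_top X) (left_orbit K m lact)) (unit_space L) (on_class n)"
      by (rule homeomorphic_map_on_class[OF n_quot(1)]) (auto simp: orbits' n_def)
    fix k z l
    show "n (lact k z) = n z" if "k \<in> arrows K" "z \<in> arrows X" "src K k = m z"
    proof -
      \<comment> \<open>As the orbits of \<open>K\<close> are contained in the fibres of
        \<open>n\<close>, invariance follows without computation.\<close>
      have "lact k z \<in> left_orbit K m lact z" unfolding left_orbit_def[of K] using that by blast
      then show ?thesis unfolding orbits'[OF that(2)] by (simp add: n_def)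
    qed
    show "m (ract z l) = m z" if "z \<in> arrows X" "l \<in> arrows L" "n z = rng L l"
    proof -
      have "ract z l \<in> right_orbit L n ract z" unfolding right_orbit_def[of L] using that by blast
      then show ?thesis unfolding orbits[OF that(1)] by (simp add: m_def)
    qed
    show "ract (lact k z) l = lact k (ract z l)"
      if "k \<in> arrows K" "z \<in> arrows X" "l \<in> arrows L" "src K k = m z" "n z = rng L l"
    proof -
      have l: "prod.swap l \<in> arrows D_K" "src D_K (prod.swap l) = D.mom z"
        using iso.g_arrow[OF that(3)] act.momentum_iff[OF that(2,3)] that(5) unfolding n[symmetric] by blast+
      show ?thesis
        unfolding ract' lact[symmetric]
        by (rule T.lact_commute[where D = D_K]) (use that l in \<open>simp_all add: q K m_def p_def D_K quotient_groupoid_opposite\<close>)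
    qed
  qed
  show ?thesis
    unfolding Let_def
    using \<iota> \<kappa> ex1 ex1' equiv
    unfolding m_def n_def lact_def ract_def K_def L_def p_def q_def by blast
qed

end
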